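(* Fix the (large) blow-up constant $C>0$. Given $0<\Omega<1$, $0<\epsilon<1$ and $0\le\gamma<1/2$, there exist $R>0$, $s>0$ and a compact embedded minimal disk $\Sigma\subset\mathbb{R}^3$ with $0\in\Sigma$ and $\partial\Sigma\subset\partial B_R$, such that $(0,s)$ is a blow-up pair in $\Sigma$ and such that the connected component of $B_{\Omega R^{1-\gamma}s^{\gamma}}\cap\Sigma$ containing $0$ is not bi-Lipschitz to a piece of a helicoid with Lipschitz constant in $\left((1+\epsilon)^{-1},\,1+\epsilon\right)$.
   Context: $B_r(x)$ denotes the Euclidean ball of radius $r$ centered at $x$ in $\mathbb{R}^3$, and $B_r=B_r(0)$. An embedded minimal disk is a smoothly embedded surface in $\mathbb{R}^3$, diffeomorphic to a disk, with zero mean curvature. It carries the induced Riemannian metric. $|A|$ denotes the norm of its second fundamental form ($|A|^2$ is the sum of the squares of the principal curvatures). Blow-up pair: a large constant $C>0$ is fixed once and for all. For a minimal surface $\Sigma\subset\mathbb{R}^3$, a pair $(y,s)\in\Sigma\times\mathbb{R}^+$ is a ($C$) blow-up pair if $$\sup_{B_s(y)\cap\Sigma}|A|^2\le 4C^2s^{-2}=4|A|^2(y).$$ In particular $|A|(y)=C/s$. Helicoid: any image of the surface $\{(t\cos\phi,t\sin\phi,\phi): t,\phi\in\mathbb{R}\}$ under a homothety and rigid motion of $\mathbb{R}^3$. A piece of a helicoid is a subset $\Gamma$ of a helicoid. For $\alpha>1$, a surface $\Sigma'$ is bi-Lipschitz to a piece of a helicoid with Lipschitz constant in $(\alpha^{-1},\alpha)$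 if there are a subset $\Gamma$ of a helicoid and a diffeomorphism $f:\Sigma'\to\Gamma$ such that $f$ and $f^{-1}$ both have Lipschitz constant less than $\alpha$, with respect to the intrinsic distances on $\Sigma'$ and $\Gamma$ given by the metrics induced from $\mathbb{R}^3$. *)

theory Defs
  imports "HOL-Analysis.Analysis"
begin

section \<open>Smooth maps\<close>

text \<open>Intended for open \<open>U\<close>; \<open>Ck_on k U f\<close> then says that \<open>f\<close> is of class $C^k$ on \<open>U\<close>.\<close>

primrec Ck_on ::
  "nat \<Rightarrow> 'a::euclidean_space set \<Rightarrow> ('a \<Rightarrow> 'b::euclidean_space) \<Rightarrow> bool"
where
  "Ck_on 0 U f \<longleftrightarrow> continuous_on U f"
| "Ck_on (Suc k) U f \<longleftrightarrow>
     (\<forall>x\<in>U. f differentiable (at x)) \<and>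
     (\<forall>v. Ck_on k U (\<lambda>x. frechet_derivative f (at x) v))"

definition smooth_on_open ::
  "'a::euclidean_space set \<Rightarrow> ('a \<Rightarrow> 'b::euclidean_space) \<Rightarrow> bool"
where
  "smooth_on_open U f \<longleftrightarrow> open U \<and> (\<forall>k. Ck_on k U f)"

text \<open>Smoothness of a map on an arbitrary subset of Euclidean space: locally, it is the
  restriction of a smooth map on an open set. On embedded submanifolds (with or without boundary)
  this is smoothness in the usual sense of charts.\<close>

definition smooth_map_on ::
  "'a::euclidean_space set \<Rightarrow> ('a \<Rightarrow> 'b::euclidean_space) \<Rightarrow> bool"
where
  "smooth_map_on X f \<longleftrightarrow>
     (\<forall>x\<in>X. \<exists>V g. x \<in> V \<and> smooth_on_open V g \<and> (\<forall>z\<in>V \<inter> X. g z = f z))"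

definition diffeomorphism_between ::
  "'a::euclidean_space set \<Rightarrow> 'b::euclidean_space set \<Rightarrow> ('a \<Rightarrow> 'b) \<Rightarrow> bool"
where
  "diffeomorphism_between X Y f \<longleftrightarrow>
     bij_betw f X Y \<and> smooth_map_on X f \<and> smooth_map_on Y (inv_into X f)"


section \<open>Parametrized surfaces\<close>

definition pderiv1 :: "(real^2 \<Rightarrow> real^3) \<Rightarrow> 2 \<Rightarrow> real^2 \<Rightarrow> real^3" where
  "pderiv1 F i p = frechet_derivative F (at p) (axis i 1)"

definition pderiv2 :: "(real^2 \<Rightarrow> real^3) \<Rightarrow> 2 \<Rightarrow> 2 \<Rightarrow> real^2 \<Rightarrow> real^3" where
  "pderiv2 F i j p = frechet_derivative (pderiv1 F i) (at p) (axis j 1)"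

definition unit_normal :: "(real^2 \<Rightarrow> real^3) \<Rightarrow> real^2 \<Rightarrow> real^3" where
  "unit_normal F p = sgn (cross3 (pderiv1 F 1 p) (pderiv1 F 2 p))"

definition first_fundamental_form :: "(real^2 \<Rightarrow> real^3) \<Rightarrow> real^2 \<Rightarrow> real^2^2" where
  "first_fundamental_form F p = (\<chi> i j. pderiv1 F i p \<bullet> pderiv1 F j p)"

definition second_fundamental_form :: "(real^2 \<Rightarrow> real^3) \<Rightarrow> real^2 \<Rightarrow> real^2^2" where
  "second_fundamental_form F p = (\<chi> i j. pderiv2 F i j p \<bullet> unit_normal F p)"

text \<open>The eigenvalues of the shape operator are the principal curvatures.\<close>

definition shape_operator :: "(real^2 \<Rightarrow> real^3) \<Rightarrow> real^2 \<Rightarrow> real^2^2" where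
  "shape_operator F p = matrix_inv (first_fundamental_form F p) ** second_fundamental_form F p"

definition mean_curvature :: "(real^2 \<Rightarrow> real^3) \<Rightarrow> real^2 \<Rightarrow> real" where
  "mean_curvature F p = trace (shape_operator F p) / 2"

text \<open>The squared norm of the second fundamental form $h$ with respect to the induced metric $g$,
  $|A|^2 = g^{ik} g^{jl} h_{ij} h_{kl}$, which is the trace of the square of the shape operator.\<close>

definition sff_norm_sq :: "(real^2 \<Rightarrow> real^3) \<Rightarrow> real^2 \<Rightarrow> real" where
  "sff_norm_sq F p = trace (shape_operator F p ** shape_operator F p)"

lemma curvatures_eq_principal_curvatures:
  assumes "\<And>x. det (mat x - shape_operator F p) = (x - k1) * (x - k2)"
  shows "mean_curvature F p = (k1 + k2) / 2" and "sff_norm_sq F p = k1\<^sup>2 + k2\<^sup>2"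
proof -
  define S where "S = shape_operator F p"
  have char: "(x - S$1$1) * (x - S$2$2) - S$1$2 * S$2$1 = (x - k1) * (x - k2)" for x
    using assms[of x] by (simp add: det_2 mat_def S_def)
  have d: "S$1$1 * S$2$2 - S$1$2 * S$2$1 = k1 * k2"
    using char[of 0] by simp
  have t: "S$1$1 + S$2$2 = k1 + k2"
    using char[of 1] d by (simp add: algebra_simps)
  show "mean_curvature F p = (k1 + k2) / 2"
    using t by (simp add: mean_curvature_def trace_def sum_2 S_def)
  have "sff_norm_sq F p = (S$1$1 + S$2$2)\<^sup>2 - 2 * (S$1$1 * S$2$2 - S$1$2 * S$2$1)"
    by (simp add: sff_norm_sq_def trace_def matrix_matrix_mult_def sum_2 S_def
        power2_eq_square algebra_simps)
  also have "\<dots> = k1\<^sup>2 + k2\<^sup>2"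
    unfolding t d by (simp add: power2_eq_square algebra_simps)
  finally show "sff_norm_sq F p = k1\<^sup>2 + k2\<^sup>2" .
qed


section \<open>Compact embedded minimal disks\<close>

text \<open>A compact embedded disk is given by a parametrization \<open>F\<close> over the closed unit disk, smooth
  up to the boundary (that is, on a neighbourhood of the closed disk). Only the values of \<open>F\<close> near
  the closed disk matter. By compactness, an injective immersion of the closed disk is a smooth
  embedding.\<close>

definition compact_embedded_disk :: "(real^2 \<Rightarrow> real^3) \<Rightarrow> bool" where
  "compact_embedded_disk F \<longleftrightarrow>
     (\<exists>U. cball 0 1 \<subseteq> U \<and> smooth_on_open U F) \<and>
     inj_on F (cball 0 1) \<and>
     (\<forall>p\<in>cball 0 1. inj (frechet_derivative F (at p)))"

definition compact_embedded_minimal_disk :: "(real^2 \<Rightarrow> real^3) \<Rightarrow> bool" where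
  "compact_embedded_minimal_disk F \<longleftrightarrow>
     compact_embedded_disk F \<and> (\<forall>p\<in>cball 0 1. mean_curvature F p = 0)"

definition surface :: "(real^2 \<Rightarrow> real^3) \<Rightarrow> (real^3) set" where
  "surface F = F ` cball 0 1"

definition surface_boundary :: "(real^2 \<Rightarrow> real^3) \<Rightarrow> (real^3) set" where
  "surface_boundary F = F ` sphere 0 1"

text \<open>$|A|^2(x)$ at a point \<open>x\<close> of the surface.\<close>

definition A_sq :: "(real^2 \<Rightarrow> real^3) \<Rightarrow> real^3 \<Rightarrow> real" where
  "A_sq F x = sff_norm_sq F (inv_into (cball 0 1) F x)"

definition blow_up_pair :: "real \<Rightarrow> (real^2 \<Rightarrow> real^3) \<Rightarrow> real^3 \<Rightarrow> real \<Rightarrow> bool" where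
  "blow_up_pair C F y s \<longleftrightarrow>
     y \<in> surface F \<and> s > 0 \<and>
     (SUP x\<in>ball y s \<inter> surface F. ereal (A_sq F x)) \<le> ereal (4 * C\<^sup>2 / s\<^sup>2) \<and>
     4 * C\<^sup>2 / s\<^sup>2 = 4 * A_sq F y"


section \<open>Helicoids and bi-Lipschitz maps\<close>

definition standard_helicoid :: "(real^3) set" where
  "standard_helicoid = {vector [t * cos \<phi>, t * sin \<phi>, \<phi>] | t \<phi>. True}"

definition helicoid :: "(real^3) set \<Rightarrow> bool" where
  "helicoid H \<longleftrightarrow>
     (\<exists>a c T. c > 0 \<and> orthogonal_transformation T \<and> H = (\<lambda>x. a + c *\<^sub>R T x) ` standard_helicoid)"

text \<open>The length takes values in \<open>ennreal\<close> because the speed of a \<open>valid_path\<close> may be unbounded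
  near its finitely many break points. The latter form a null set.\<close>

definition curve_length :: "(real \<Rightarrow> 'a::euclidean_space) \<Rightarrow> ennreal" where
  "curve_length g = (\<integral>\<^sup>+t\<in>{0..1}. ennreal (norm (vector_derivative g (at t))) \<partial>lborel)"

definition intrinsic_dist :: "'a::euclidean_space set \<Rightarrow> 'a \<Rightarrow> 'a \<Rightarrow> ennreal" where
  "intrinsic_dist X x y =
     (INF g\<in>{g. valid_path g \<and> path_image g \<subseteq> X \<and> pathstart g = x \<and> pathfinish g = y}.
        curve_length g)"

definition intrinsic_lipschitz_less ::
  "real \<Rightarrow> 'a::euclidean_space set \<Rightarrow> 'b::euclidean_space set \<Rightarrow> ('a \<Rightarrow> 'b) \<Rightarrow> bool"
where
  "intrinsic_lipschitz_less \<alpha> X Y f \<longleftrightarrow>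
     (\<exists>L. 0 \<le> L \<and> L < \<alpha> \<and>
        (\<forall>x\<in>X. \<forall>y\<in>X. intrinsic_dist Y (f x) (f y) \<le> ennreal L * intrinsic_dist X x y))"

definition bilipschitz_to_helicoid_piece :: "real \<Rightarrow> (real^3) set \<Rightarrow> bool" where
  "bilipschitz_to_helicoid_piece \<alpha> X \<longleftrightarrow>
     (\<exists>H \<Gamma> f. helicoid H \<and> \<Gamma> \<subseteq> H \<and> diffeomorphism_between X \<Gamma> f \<and>
        intrinsic_lipschitz_less \<alpha> X \<Gamma> f \<and>
        intrinsic_lipschitz_less \<alpha> \<Gamma> X (inv_into X f))"

end

theory Submission
  imports Defs "HOL-Complex_Analysis.Cauchy_Integral_Formula" "HOL-Real_Asymp.Real_Asymp"
begin

text \<open>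
  The surface is a helicoid-like disk whose pitch varies along its axis. The Weierstrass data
  $g = e^{ih}$, $dx_3 = dz$ with $h(z) = B((1+\mu)z + \sin z)$ give a conformal minimal immersion of
  a thin strip around the real axis whose height function is $\mathrm{Re}\, z$ and whose horizontal
  slices are graphs over a line, hence embedded. The axis has pitch about $1/h'$, namely
  $1/(B(2+\mu))$ at $0$ and $1/(B\mu)$ at $\pi$. Since the slices grow exponentially in
  $\sqrt B$, the disk reaches $\partial B_R$ with $R = B^2$, while $s$ is of order $1/B$; thus
  $\Omega R^{1-\gamma}s^\gamma$ tends to infinity with $B$ whereas the two axis points stay at
  bounded distance.

  A map of a neighbourhood of these axis points to a helicoid of pitch $c$ with bi-Lipschitz constant
  less than $2$ is excluded by counting separated points. Near an axis point of pitch $p$ many points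
  at distance of order $p$ are pairwise separated by a fixed fraction of this distance; a
  helicoid has such configurations only where its conformal factor, in particular $c$, is at most a
  constant times $p$. Hence $c$ is at most a multiple of the small pitch, and the image of the other
  axis point lies close to the axis of the helicoid. There the helicoid contains more separated points
  than the surface does at the scale of the large pitch.
\<close>

section \<open>Lengths of curves and intrinsic distances\<close>

text \<open>A bi-Lipschitz constant close to 2 says nothing about curvature, and \<Gamma> is an
  arbitrary subset whose intrinsic distance may exceed that of the helicoid. Counting separated
  points survives both defects, because it only compares distances up to constants. The price is a
  pitch ratio far above the Lipschitz constant: it is dictated by packing numbers of the plane, and
  \<mu> is chosen accordingly small. As \<epsilon> < 1, every admissible constant is below 2 and one
  argument serves all \<epsilon>.

  The width of the strip is a compromise. At parameter distance y from the axis the tangent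
  direction of a slice has turned by about B y^2, so embeddedness wants y of order B^(-1/2); there
  \<open>v\<close> is still at least of order \<mu> B^(1/2), which is where the exponential growth
  comes from.

  The function sin z modulates the pitch at a fixed scale while the pitches are of order 1/B. Near
  the critical points 0 and pi of h' the surface is therefore almost an exact helicoid over any
  prescribed number of turns once B is large. The condition \<gamma> < 1/2 enters through
  R^(1-\<gamma>) s^\<gamma> \<ge> sqrt (R s), where R s is of order B.\<close>

lemma valid_path_speed:
  fixes g :: "real \<Rightarrow> 'a::euclidean_space"
  assumes "valid_path g"
  obtains S k where "finite S"
    and "\<And>t. t \<in> {0..1} - S \<Longrightarrow> (g has_vector_derivative vector_derivative g (at t)) (at t)"
    and "k \<in> borel_measurable borel"
    and "k = (\<lambda>t. indicator ({0..1} - S) t * norm (vector_derivative g (at t)))"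
    and "curve_length g = (\<integral>\<^sup>+t. ennreal (k t) \<partial>lborel)"
proof -
  obtain S where S: "finite S" "g C1_differentiable_on ({0..1} - S)"
    using assms unfolding valid_path_def piecewise_C1_differentiable_on_def by blast
  \<comment> \<open>The derivative is arbitrary at the break points. Cutting the speed to zero there
    and outside the unit interval makes it Borel measurable on the whole line without changing the
    integral.\<close>
  define k where "k = (\<lambda>t. indicator ({0..1} - S) t * norm (vector_derivative g (at t)))"
  have d: "(g has_vector_derivative vector_derivative g (at t)) (at t)" if "t \<in> {0..1} - S" for t
    using S(2) that unfolding C1_differentiable_on_eq
    by (simp add: vector_derivative_works)
  have "continuous_on ({0..1} - S) (\<lambda>t. norm (vector_derivative g (at t)))"
    using S(2) unfolding C1_differentiable_on_eq by (intro continuous_on_norm) auto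
  moreover have "{0..1} - S \<in> sets borel"
    using S(1) by (auto intro!: sets.Diff simp: finite_imp_closed)
  ultimately have "(\<lambda>t. indicator ({0..1} - S) t *\<^sub>R norm (vector_derivative g (at t))) \<in> borel_measurable borel"
    by (intro borel_measurable_continuous_on_indicator)
  then have meas: "k \<in> borel_measurable borel" by (simp add: k_def)
  have "AE t in lborel. t \<notin> S"
    using S(1) by (intro AE_not_in) (simp add: finite_imp_null_set_lborel)
  then have "curve_length g = (\<integral>\<^sup>+t. ennreal (k t) \<partial>lborel)"
    unfolding curve_length_def
    by (intro nn_integral_cong_AE, eventually_elim) (auto simp: k_def indicator_def)
  with S(1) d meas k_def show ?thesis using that by blast
qed

lemma curve_length_join:
  fixes g1 g2 :: "real \<Rightarrow> 'a::euclidean_space"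
  assumes "valid_path g1" "valid_path g2"
  shows "curve_length (g1 +++ g2) \<le> curve_length g1 + curve_length g2"
proof -
  obtain S1 k1 where S1: "finite S1"
    "\<And>t. t \<in> {0..1} - S1 \<Longrightarrow> (g1 has_vector_derivative vector_derivative g1 (at t)) (at t)"
    "k1 \<in> borel_measurable borel"
    "k1 = (\<lambda>t. indicator ({0..1} - S1) t * norm (vector_derivative g1 (at t)))"
    "curve_length g1 = (\<integral>\<^sup>+t. ennreal (k1 t) \<partial>lborel)"
    using valid_path_speed[OF assms(1)] by blast
  obtain S2 k2 where S2: "finite S2"
    "\<And>t. t \<in> {0..1} - S2 \<Longrightarrow> (g2 has_vector_derivative vector_derivative g2 (at t)) (at t)"
    "k2 \<in> borel_measurable borel"
    "k2 = (\<lambda>t. indicator ({0..1} - S2) t * norm (vector_derivative g2 (at t)))"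
    "curve_length g2 = (\<integral>\<^sup>+t. ennreal (k2 t) \<partial>lborel)"
    using valid_path_speed[OF assms(2)] by blast
  define N where "N = (\<lambda>s. s/2) ` S1 \<union> (\<lambda>s. (s+1)/2) ` S2 \<union> {1/2}"
  have N: "finite N" using S1(1) S2(1) by (simp add: N_def)
  \<comment> \<open>Both cut-off speeds are nonnegative, so their sum bounds the speed on either
    half. The arguments keep the shape \<open>t + c * x\<close> of the affine substitution applied
    below.\<close>
  have *: "indicator {0..1} t * ennreal (norm (vector_derivative (g1 +++ g2) (at t)))
       \<le> 2 * ennreal (k1 (0 + 2 * t)) + 2 * ennreal (k2 (-1 + 2 * t))" if t: "t \<notin> N" for t
  proof (cases "t \<in> {0..1}")
    case True
    consider "t < 1/2" | "t > 1/2" using t by (fastforce simp: N_def)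
    then show ?thesis
    proof cases
      case 1
      have "2 * t \<notin> S1"
      proof
        assume "2 * t \<in> S1"
        then have "(2 * t) / 2 \<in> N" unfolding N_def by blast
        with t show False by simp
      qed
      then have "(g1 has_vector_derivative vector_derivative g1 (at (2*t))) (at (2*t))"
        using S1(2)[of "2*t"] True 1 by auto
      then have "((g1 \<circ> (\<lambda>t. 2*t)) has_vector_derivative 2 *\<^sub>R vector_derivative g1 (at (2*t))) (at t)"
        by (intro vector_diff_chain_at) (auto intro!: derivative_eq_intros simp: has_vector_derivative_def)
      then have "((g1 +++ g2) has_vector_derivative 2 *\<^sub>R vector_derivative g1 (at (2*t))) (at t)"
        by (rule has_vector_derivative_transform_within_open[where S="{..<1/2}"])
           (use 1 in \<open>auto simp: joinpaths_def\<close>)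
      then have "norm (vector_derivative (g1 +++ g2) (at t)) = 2 * k1 (2 * t)"
        using \<open>2 * t \<notin> S1\<close> True 1 by (simp add: vector_derivative_at S1(4))
      then show ?thesis using True by (simp add: ennreal_mult' S1(4))
    next
      case 2
      have "-1 + 2 * t \<notin> S2"
      proof
        assume "-1 + 2 * t \<in> S2"
        then have "((-1 + 2*t) + 1)/2 \<in> N" unfolding N_def by blast
        with t show False by simp
      qed
      then have "(g2 has_vector_derivative vector_derivative g2 (at (-1+2*t))) (at (-1+2*t))"
        using S2(2)[of "-1+2*t"] True 2 by auto
      then have "((g2 \<circ> (\<lambda>t. -1+2*t)) has_vector_derivative 2 *\<^sub>R vector_derivative g2 (at (-1+2*t))) (at t)"
        by (intro vector_diff_chain_at) (auto intro!: derivative_eq_intros simp: has_vector_derivative_def)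
      then have "((g1 +++ g2) has_vector_derivative 2 *\<^sub>R vector_derivative g2 (at (-1+2*t))) (at t)"
        by (rule has_vector_derivative_transform_within_open[where S="{1/2<..}"])
           (use 2 in \<open>auto simp: joinpaths_def algebra_simps\<close>)
      then have "norm (vector_derivative (g1 +++ g2) (at t)) = 2 * k2 (-1 + 2 * t)"
        using \<open>-1 + 2 * t \<notin> S2\<close> True 2 by (simp add: vector_derivative_at S2(4))
      then show ?thesis using True by (simp add: ennreal_mult' S2(4))
    qed
  qed simp
  have "AE t in lborel. t \<notin> N"
    using N by (intro AE_not_in) (simp add: finite_imp_null_set_lborel)
  then have "curve_length (g1 +++ g2)
      \<le> (\<integral>\<^sup>+t. 2 * ennreal (k1 (0 + 2 * t)) + 2 * ennreal (k2 (-1 + 2 * t)) \<partial>lborel)"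
    unfolding curve_length_def
    by (intro nn_integral_mono_AE, eventually_elim) (use * in \<open>simp add: mult.commute\<close>)
  also have "\<dots> = 2 * (\<integral>\<^sup>+t. ennreal (k1 (0 + 2 * t)) \<partial>lborel) + 2 * (\<integral>\<^sup>+t. ennreal (k2 (-1 + 2 * t)) \<partial>lborel)"
    using S1(3) S2(3) by (simp add: nn_integral_add nn_integral_cmult)
  also have "2 * (\<integral>\<^sup>+t. ennreal (k1 (0 + 2 * t)) \<partial>lborel) = curve_length g1"
    unfolding S1(5) using S1(3) by (subst (2) nn_integral_real_affine[where c=2 and t=0]) auto
  also have "2 * (\<integral>\<^sup>+t. ennreal (k2 (-1 + 2 * t)) \<partial>lborel) = curve_length g2"
    unfolding S2(5) using S2(3) by (subst (2) nn_integral_real_affine[where c=2 and t="-1"]) auto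
  finally show ?thesis .
qed

lemma intrinsic_dist_le_curve_length:
  assumes "valid_path g" "path_image g \<subseteq> X"
  shows "intrinsic_dist X (pathstart g) (pathfinish g) \<le> curve_length g"
  unfolding intrinsic_dist_def using assms by (intro INF_lower) auto

lemma intrinsic_dist_lessE:
  assumes "intrinsic_dist X x y < c"
  obtains g where "valid_path g" "path_image g \<subseteq> X" "pathstart g = x" "pathfinish g = y"
    "curve_length g < c"
  using assms unfolding intrinsic_dist_def INF_less_iff by auto

lemma intrinsic_dist_mono: "X \<subseteq> Y \<Longrightarrow> intrinsic_dist Y x y \<le> intrinsic_dist X x y"
  unfolding intrinsic_dist_def by (rule INF_superset_mono) auto

text \<open>The infima may be infinite or not attained. A strict gap between the two sides is
  therefore divided between the two legs, each of which then has a path strictly shorter than its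
  share.\<close>

lemma intrinsic_dist_triangle:
  fixes x :: "'a::euclidean_space"
  shows "intrinsic_dist X x z \<le> intrinsic_dist X x y + intrinsic_dist X y z"
proof (rule ccontr)
  assume "\<not> ?thesis"
  then have less: "intrinsic_dist X x y + intrinsic_dist X y z < intrinsic_dist X x z" by simp
  then have fin: "intrinsic_dist X x y < \<infinity>" "intrinsic_dist X y z < \<infinity>"
    by (auto simp: less_top[symmetric] top_unique)
  obtain a where a: "intrinsic_dist X x y + intrinsic_dist X y z < a" "a < intrinsic_dist X x z"
    using less dense by blast
  obtain b where b: "intrinsic_dist X x y < b" "b + intrinsic_dist X y z < a"
  proof -
    have "intrinsic_dist X x y < a - intrinsic_dist X y z"
      using a(1) fin by (simp add: less_diff_eq_ennreal)
    then obtain b where "intrinsic_dist X x y < b" "b < a - intrinsic_dist X y z"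
      using dense by blast
    then show ?thesis using fin by (intro that[of b]) (simp_all add: less_diff_eq_ennreal)
  qed
  obtain g1 where g1: "valid_path g1" "path_image g1 \<subseteq> X" "pathstart g1 = x" "pathfinish g1 = y"
    "curve_length g1 < b" by (rule intrinsic_dist_lessE[OF b(1)])
  have bfin: "b < \<infinity>" using b(2) by (auto simp: less_top[symmetric] top_unique)
  have "intrinsic_dist X y z < a - b"
    using b(2) bfin by (simp add: less_diff_eq_ennreal add.commute)
  then obtain g2 where g2: "valid_path g2" "path_image g2 \<subseteq> X" "pathstart g2 = y" "pathfinish g2 = z"
    "curve_length g2 < a - b" by (rule intrinsic_dist_lessE)
  have "intrinsic_dist X x z \<le> curve_length (g1 +++ g2)"
    using intrinsic_dist_le_curve_length[of "g1 +++ g2" X] g1 g2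
    by (simp add: valid_path_join path_image_join)
  also have "\<dots> \<le> curve_length g1 + curve_length g2" using g1 g2 by (intro curve_length_join)
  also have "\<dots> \<le> b + (a - b)" using g1(5) g2(5) by (intro add_mono) auto
  also have "\<dots> = a" using b(2) by (intro add_diff_inverse_ennreal) (metis add.commute add_increasing2 le_less_trans less_imp_le zero_le order_refl)
  finally show False using a(2) by simp
qed

lemma curve_length_initial_subpath:
  fixes g :: "real \<Rightarrow> 'a::euclidean_space"
  assumes "valid_path g" "0 \<le> \<tau>" "\<tau> \<le> 1"
  shows "curve_length (subpath 0 \<tau> g) \<le> curve_length g"
proof (cases "\<tau> = 0")
  case True
  have "subpath 0 \<tau> g = (\<lambda>_. g 0)" by (auto simp: subpath_def True)
  then show ?thesis by (simp add: curve_length_def)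
next
  case False
  obtain S k where S: "finite S"
    "\<And>t. t \<in> {0..1} - S \<Longrightarrow> (g has_vector_derivative vector_derivative g (at t)) (at t)"
    "k \<in> borel_measurable borel"
    "k = (\<lambda>t. indicator ({0..1} - S) t * norm (vector_derivative g (at t)))"
    "curve_length g = (\<integral>\<^sup>+t. ennreal (k t) \<partial>lborel)"
    using valid_path_speed[OF assms(1)] by blast
  define N where "N = (\<lambda>s. s/\<tau>) ` S"
  have N: "finite N" using S(1) by (simp add: N_def)
  have *: "indicator {0..1} t * ennreal (norm (vector_derivative (subpath 0 \<tau> g) (at t)))
       \<le> ennreal \<tau> * ennreal (k (0 + \<tau> * t))" if t: "t \<notin> N" for t
  proof (cases "t \<in> {0..1}")
    case True
    have "\<tau> * t \<notin> S"
    proof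
      assume "\<tau> * t \<in> S"
      then have "(\<tau> * t) / \<tau> \<in> N" unfolding N_def by blast
      with t False show False by simp
    qed
    moreover have "\<tau> * t \<in> {0..1}" using True assms by (auto intro: mult_le_one)
    ultimately have "(g has_vector_derivative vector_derivative g (at (\<tau>*t))) (at (\<tau>*t))"
      using S(2) by auto
    then have "((g \<circ> (\<lambda>t. \<tau>*t)) has_vector_derivative \<tau> *\<^sub>R vector_derivative g (at (\<tau>*t))) (at t)"
      by (intro vector_diff_chain_at) (auto intro!: derivative_eq_intros simp: has_vector_derivative_def)
    then have "((subpath 0 \<tau> g) has_vector_derivative \<tau> *\<^sub>R vector_derivative g (at (\<tau>*t))) (at t)"
      by (simp add: subpath_def o_def)
    then have "norm (vector_derivative (subpath 0 \<tau> g) (at t)) = \<tau> * k (\<tau> * t)"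
      using \<open>\<tau> * t \<notin> S\<close> \<open>\<tau> * t \<in> {0..1}\<close> assms by (simp add: vector_derivative_at S(4))
    then show ?thesis using True assms by (simp add: ennreal_mult' S(4))
  qed simp
  have "AE t in lborel. t \<notin> N"
    using N by (intro AE_not_in) (simp add: finite_imp_null_set_lborel)
  then have "curve_length (subpath 0 \<tau> g) \<le> (\<integral>\<^sup>+t. ennreal \<tau> * ennreal (k (0 + \<tau> * t)) \<partial>lborel)"
    unfolding curve_length_def
    by (intro nn_integral_mono_AE, eventually_elim) (use * in \<open>simp add: mult.commute\<close>)
  also have "\<dots> = ennreal \<tau> * (\<integral>\<^sup>+t. ennreal (k (0 + \<tau> * t)) \<partial>lborel)"
    using S(3) by (simp add: nn_integral_cmult)
  also have "\<dots> = curve_length g"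
    unfolding S(5) using S(3) False assms by (subst (2) nn_integral_real_affine[where c=\<tau> and t=0]) auto
  finally show ?thesis .
qed

text \<open>The lift \<gamma> is only known to be continuous and differentiable off a finite set.
  The fundamental theorem for the gauge integral applies in this situation and yields the
  integrability of the derivative by itself. Stopping at \<tau> allows the constant m to hold only
  up to a first exit time.\<close>

lemma curve_length_lower_bound:
  fixes g :: "real \<Rightarrow> 'a::euclidean_space" and \<gamma> :: "real \<Rightarrow> 'b::euclidean_space"
  assumes g: "valid_path g" and \<tau>: "0 \<le> \<tau>" "\<tau> \<le> 1" and m: "m > 0"
    and cont: "continuous_on {0..\<tau>} \<gamma>"
    and der: "\<And>t v. \<lbrakk>0 < t; t < \<tau>; (g has_vector_derivative v) (at t)\<rbrakk> \<Longrightarrow>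
      \<exists>w. (\<gamma> has_vector_derivative w) (at t) \<and> m * norm w \<le> norm v"
  shows "ennreal (m * norm (\<gamma> \<tau> - \<gamma> 0)) \<le> curve_length g"
proof (cases "curve_length g = \<infinity>")
  case False
  obtain S k where S: "finite S"
    "\<And>t. t \<in> {0..1} - S \<Longrightarrow> (g has_vector_derivative vector_derivative g (at t)) (at t)"
    "k \<in> borel_measurable borel"
    "k = (\<lambda>t. indicator ({0..1} - S) t * norm (vector_derivative g (at t)))"
    "curve_length g = (\<integral>\<^sup>+t. ennreal (k t) \<partial>lborel)"
    using valid_path_speed[OF g] by blast
  have k0: "k t \<ge> 0" for t by (simp add: S(4))
  have int: "integrable lborel k"
    using S(3) False k0 by (intro integrableI_nonneg) (auto simp: S(5) less_top)
  have hk: "(k has_integral integral\<^sup>L lborel k) UNIV" by (rule has_integral_integral_lborel[OF int])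
  have len: "curve_length g = ennreal (integral\<^sup>L lborel k)"
    unfolding S(5) using int k0 by (intro nn_integral_eq_integral) auto
  have kint: "k integrable_on {0..\<tau>}"
    using hk by (meson has_integral_integrable integrable_on_subinterval subset_UNIV cbox_interval integrable_on_subcbox box_real)
  define E where "E = S \<union> {0, \<tau>}"
  \<comment> \<open>The value 0 at exceptional parameters makes the bound by \<open>k t / m\<close>
    hold everywhere.\<close>
  define w where "w = (\<lambda>t. if t \<in> {0<..<\<tau>} - S then SOME w. (\<gamma> has_vector_derivative w) (at t) \<and> m * norm w \<le> norm (vector_derivative g (at t)) else 0)"
  have w: "(\<gamma> has_vector_derivative w t) (at t) \<and> m * norm (w t) \<le> norm (vector_derivative g (at t))"
    if t: "t \<in> {0<..<\<tau>} - S" for t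
  proof -
    have "\<exists>w. (\<gamma> has_vector_derivative w) (at t) \<and> m * norm w \<le> norm (vector_derivative g (at t))"
      using t \<tau> by (intro der S(2)) auto
    from someI_ex[OF this] show ?thesis using t by (simp add: w_def)
  qed
  have wi: "(w has_integral (\<gamma> \<tau> - \<gamma> 0)) {0..\<tau>}"
    using w cont \<tau> by (intro fundamental_theorem_of_calculus_interior_strong[OF S(1)]) auto
  have "norm (w t) \<le> k t / m" for t
  proof (cases "t \<in> {0<..<\<tau>} - S")
    case True
    then have "k t = norm (vector_derivative g (at t))" using \<tau> by (simp add: S(4))
    then show ?thesis using w[OF True] m by (simp add: field_simps)
  qed (use m k0 in \<open>auto simp: w_def\<close>)
  then have "norm (integral {0..\<tau>} w) \<le> integral {0..\<tau>} (\<lambda>t. k t / m)"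
    using wi kint by (intro integral_norm_bound_integral) (auto intro: integrable_on_divide)
  also have "\<dots> = integral {0..\<tau>} k / m" by simp
  also have "integral {0..\<tau>} k \<le> integral UNIV k"
    using hk kint k0 by (intro integral_subset_le) auto
  then have "integral {0..\<tau>} k / m \<le> integral\<^sup>L lborel k / m"
    using hk m by (simp add: divide_right_mono integral_unique)
  finally have "m * norm (\<gamma> \<tau> - \<gamma> 0) \<le> integral\<^sup>L lborel k"
    using wi m by (simp add: integral_unique field_simps)
  then show ?thesis unfolding len by (rule ennreal_leI)
qed simp

section \<open>Conformal charts\<close>

text \<open>An injective immersion of an open set need not be a homeomorphism onto its image.
  Continuity of the inverse is therefore part of the notion: it is what lifts paths of the surface
  to paths in the plane.\<close>

locale conformal_chart =
  fixes \<Phi> :: "complex \<Rightarrow> 'a::euclidean_space" and \<Phi>' :: "complex \<Rightarrow> complex \<Rightarrow> 'a"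
    and D :: "complex set" and \<rho> :: "complex \<Rightarrow> real"
  assumes open_D: "open D"
    and inj: "inj_on \<Phi> D"
    and cont_inv: "continuous_on (\<Phi> ` D) (inv_into D \<Phi>)"
    and deriv: "z \<in> D \<Longrightarrow> (\<Phi> has_derivative \<Phi>' z) (at z)"
    and conformal: "z \<in> D \<Longrightarrow> norm (\<Phi>' z w) = \<rho> z * norm w"
    and \<rho>_pos: "z \<in> D \<Longrightarrow> 0 < \<rho> z"
    and cont_deriv: "continuous_on D (\<lambda>z. \<Phi>' z w)"
begin

text \<open>The target has higher dimension, so no inverse function is available. Since the
  derivative is bounded below, \<gamma> is first seen to be Lipschitz at t; a linear left inverse B
  of the derivative then turns the expansion of g into one of \<gamma>.\<close>

lemma lift_derivative:
  assumes T: "open T" "t \<in> T" and \<gamma>: "\<And>s. s \<in> T \<Longrightarrow> \<gamma> s \<in> D \<and> g s = \<Phi> (\<gamma> s)"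
    and cont: "isCont \<gamma> t" and g: "(g has_vector_derivative v) (at t)"
  shows "\<exists>w. (\<gamma> has_vector_derivative w) (at t) \<and> \<rho> (\<gamma> t) * norm w = norm v"
proof -
  let ?A = "\<Phi>' (\<gamma> t)"
  have D: "\<gamma> t \<in> D" using \<gamma> T(2) by blast
  define l where "l = \<rho> (\<gamma> t)"
  have l: "l > 0" "norm (?A w) = l * norm w" for w
    using \<rho>_pos[OF D] conformal[OF D] by (auto simp: l_def)
  have bl: "bounded_linear ?A" using deriv[OF D] by (rule has_derivative_bounded_linear)
  have "inj ?A"
  proof (rule injI)
    fix a b assume "?A a = ?A b"
    then have "?A (a - b) = 0" using bl by (simp add: bounded_linear.linear linear_diff)
    then show "a = b" using l(2)[of "a - b"] l(1) by simp
  qed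
  then obtain B where B: "linear B" "B \<circ> ?A = id"
    using linear_injective_left_inverse bl bounded_linear.linear by blast
  have BA: "B (?A w) = w" for w using B(2) by (metis comp_apply id_apply)
  obtain \<beta> where \<beta>: "\<beta> > 0" "\<And>x. norm (B x) \<le> \<beta> * norm x"
    using linear_bounded_pos[OF B(1)] by (metis mult.commute)
  define w where "w = B v"
  have gder: "(g has_derivative (\<lambda>h. h *\<^sub>R v)) (at t)" using g by (simp add: has_vector_derivative_def)
  define K where "K = 2 / l * (norm v + 1)"
  have K: "K > 0" using l(1) by (simp add: K_def add_nonneg_pos)
  have "(\<gamma> has_derivative (\<lambda>h. h *\<^sub>R w)) (at t)"
    unfolding has_derivative_at_alt
  proof (intro conjI allI impI)
    show "bounded_linear (\<lambda>h. h *\<^sub>R w)" by (rule bounded_linear_scaleR_left)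
    fix e :: real assume e: "e > 0"
    \<comment> \<open>\<open>l / 2\<close> lets the linearization error be absorbed by the lower
      bound \<open>l * norm \<Delta>\<close>. The other entry, together with \<open>e2\<close>,
      makes each of the two errors contribute at most \<open>e / 2\<close> after B, of norm at most
      \<beta>, is applied.\<close>
    define e1 where "e1 = min (l / 2) (e / (2 * \<beta> * K))"
    define e2 where "e2 = min 1 (e / (2 * \<beta>))"
    have e12: "e1 > 0" "e2 > 0" using e l(1) \<beta>(1) K by (auto simp: e1_def e2_def)
    obtain d1 where d1: "d1 > 0" "\<And>y. norm (y - \<gamma> t) < d1 \<Longrightarrow>
        norm (\<Phi> y - \<Phi> (\<gamma> t) - ?A (y - \<gamma> t)) \<le> e1 * norm (y - \<gamma> t)"
      using deriv[OF D] e12(1) unfolding has_derivative_at_alt by blast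
    obtain d2 where d2: "d2 > 0" "\<And>s. norm (s - t) < d2 \<Longrightarrow>
        norm (g s - g t - (s - t) *\<^sub>R v) \<le> e2 * norm (s - t)"
      using gder e12(2) unfolding has_derivative_at_alt by blast
    obtain d3 where d3: "d3 > 0" "\<And>s. norm (s - t) < d3 \<Longrightarrow> norm (\<gamma> s - \<gamma> t) < d1"
      using cont d1(1) unfolding continuous_at_eps_delta by (metis dist_norm)
    obtain d4 where d4: "d4 > 0" "ball t d4 \<subseteq> T" using T openE by blast
    show "\<exists>d>0. \<forall>y. norm (y - t) < d \<longrightarrow> norm (\<gamma> y - \<gamma> t - (y - t) *\<^sub>R w) \<le> e * norm (y - t)"
    proof (intro exI[of _ "min d2 (min d3 d4)"] conjI allI impI)
      show "0 < min d2 (min d3 d4)" using d2 d3 d4 by simp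
      fix s assume s: "norm (s - t) < min d2 (min d3 d4)"
      have sT: "s \<in> T" using d4(2) s by (auto simp: dist_norm abs_minus_commute)
      define \<Delta> where "\<Delta> = \<gamma> s - \<gamma> t"
      have 1: "norm (g s - g t - ?A \<Delta>) \<le> e1 * norm \<Delta>"
        using d1(2)[of "\<gamma> s"] d3(2)[of s] s \<gamma>[OF sT] \<gamma>[OF T(2)] by (simp add: \<Delta>_def)
      have 2: "norm (g s - g t - (s - t) *\<^sub>R v) \<le> e2 * norm (s - t)"
        using d2(2)[of s] s by simp
      have "l * norm \<Delta> = norm (?A \<Delta>)" by (simp add: l(2))
      also have "\<dots> \<le> norm (g s - g t - ?A \<Delta>) + norm (g s - g t - (s - t) *\<^sub>R v) + norm ((s - t) *\<^sub>R v)"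
      proof -
        have "?A \<Delta> = - (g s - g t - ?A \<Delta>) + (g s - g t - (s - t) *\<^sub>R v) + (s - t) *\<^sub>R v" by simp
        then show ?thesis by (metis norm_triangle_mono norm_minus_cancel norm_triangle_ineq order_refl)
      qed
      also have "\<dots> \<le> l / 2 * norm \<Delta> + 1 * norm (s - t) + norm (s - t) * norm v"
      proof (intro add_mono)
        show "norm (g s - g t - ?A \<Delta>) \<le> l / 2 * norm \<Delta>"
          using 1 by (rule order_trans) (intro mult_right_mono, auto simp: e1_def)
        show "norm (g s - g t - (s - t) *\<^sub>R v) \<le> 1 * norm (s - t)"
          using 2 by (rule order_trans) (intro mult_right_mono, auto simp: e2_def)
      qed simp
      finally have "l / 2 * norm \<Delta> \<le> norm (s - t) * (norm v + 1)" by (simp add: algebra_simps)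
      then have \<Delta>: "norm \<Delta> \<le> K * norm (s - t)" using l(1) by (simp add: K_def field_simps)
      have "norm (\<Delta> - (s - t) *\<^sub>R w) = norm (B (?A \<Delta> - (s - t) *\<^sub>R v))"
        using B(1) by (simp add: BA w_def linear_diff linear_scale)
      also have "\<dots> \<le> \<beta> * norm (?A \<Delta> - (s - t) *\<^sub>R v)" by (rule \<beta>(2))
      also have "norm (?A \<Delta> - (s - t) *\<^sub>R v) \<le> e1 * norm \<Delta> + e2 * norm (s - t)"
      proof -
        have "?A \<Delta> - (s - t) *\<^sub>R v = (g s - g t - (s - t) *\<^sub>R v) - (g s - g t - ?A \<Delta>)" by simp
        then have "norm (?A \<Delta> - (s - t) *\<^sub>R v)
            \<le> norm (g s - g t - (s - t) *\<^sub>R v) + norm (g s - g t - ?A \<Delta>)"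
          by (metis norm_triangle_ineq4)
        with 1 2 show ?thesis by linarith
      qed
      also have "\<dots> \<le> e / (2 * \<beta> * K) * (K * norm (s - t)) + e / (2 * \<beta>) * norm (s - t)"
        using \<Delta> e \<beta>(1) K by (intro add_mono mult_mono) (auto simp: e1_def e2_def)
      also have "\<dots> = e / \<beta> * norm (s - t)" using K \<beta>(1) by (simp add: field_simps)
      finally have "norm (\<Delta> - (s - t) *\<^sub>R w) \<le> \<beta> * (e / \<beta> * norm (s - t))" using \<beta>(1) by simp
      then show "norm (\<gamma> s - \<gamma> t - (s - t) *\<^sub>R w) \<le> e * norm (s - t)"
        using \<beta>(1) by (simp add: \<Delta>_def)
    qed
  qed
  then have w: "(\<gamma> has_vector_derivative w) (at t)" by (simp add: has_vector_derivative_def)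
  have "(\<Phi> \<circ> \<gamma> has_derivative ?A \<circ> (\<lambda>h. h *\<^sub>R w)) (at t)"
    using w deriv[OF D] unfolding has_vector_derivative_def by (intro diff_chain_at)
  moreover have "?A \<circ> (\<lambda>h. h *\<^sub>R w) = (\<lambda>h. h *\<^sub>R ?A w)"
    using bl by (auto simp: bounded_linear.linear linear_scale)
  ultimately have "(\<Phi> \<circ> \<gamma> has_vector_derivative ?A w) (at t)" by (simp add: has_vector_derivative_def)
  then have "(g has_vector_derivative ?A w) (at t)"
    by (rule has_vector_derivative_transform_within_open[OF _ T]) (use \<gamma> in auto)
  then have "v = ?A w" using g vector_derivative_unique_at by blast
  with w l(2) show ?thesis by (auto simp: l_def)
qed

text \<open>A path leaving the disk of radius r has already paid \<open>m * r\<close> at its first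
  exit, so control of the conformal factor inside this disk is enough.\<close>

lemma intrinsic_dist_lower_bound:
  assumes "z \<in> D" "w \<in> D" and m: "m > 0"
    and \<rho>: "\<And>y. \<lbrakk>y \<in> D; dist z y < r\<rbrakk> \<Longrightarrow> m \<le> \<rho> y"
  shows "ennreal (m * min r (dist z w)) \<le> intrinsic_dist (\<Phi> ` D) (\<Phi> z) (\<Phi> w)"
  unfolding intrinsic_dist_def
proof (rule INF_greatest, clarify)
  fix g assume g: "valid_path g" "path_image g \<subseteq> \<Phi> ` D" "pathstart g = \<Phi> z" "pathfinish g = \<Phi> w"
  define \<gamma> where "\<gamma> = inv_into D \<Phi> \<circ> g"
  have gin: "g t \<in> \<Phi> ` D" if "t \<in> {0..1}" for t using g(2) that by (auto simp: path_image_def)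
  have \<gamma>: "\<gamma> t \<in> D \<and> g t = \<Phi> (\<gamma> t)" if "t \<in> {0..1}" for t
    using gin[OF that] by (auto simp: \<gamma>_def inv_into_into f_inv_into_f)
  have contg: "continuous_on {0..1} g" using g(1) valid_path_imp_path path_def by blast
  have cont: "continuous_on {0..1} \<gamma>"
    unfolding \<gamma>_def by (rule continuous_on_compose[OF contg])
      (rule continuous_on_subset[OF cont_inv], use gin in blast)
  have ends: "\<gamma> 0 = z" "\<gamma> 1 = w"
    using g(3,4) assms(1,2) inj by (auto simp: \<gamma>_def pathstart_def pathfinish_def)
  have main: "ennreal (m * dist z (\<gamma> \<tau>)) \<le> curve_length g"
    if \<tau>: "0 \<le> \<tau>" "\<tau> \<le> 1" and near: "\<And>t. \<lbrakk>0 \<le> t; t < \<tau>\<rbrakk> \<Longrightarrow> dist z (\<gamma> t) < r" for \<tau>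
  proof -
    have "ennreal (m * norm (\<gamma> \<tau> - \<gamma> 0)) \<le> curve_length g"
    proof (rule curve_length_lower_bound[OF g(1) \<tau> m])
      show "continuous_on {0..\<tau>} \<gamma>" using cont \<tau> by (auto elim: continuous_on_subset)
      fix t v assume t: "0 < t" "t < \<tau>" and v: "(g has_vector_derivative v) (at t)"
      have "isCont \<gamma> t" using cont t \<tau> by (intro continuous_on_interior) auto
      then obtain u where u: "(\<gamma> has_vector_derivative u) (at t)" "\<rho> (\<gamma> t) * norm u = norm v"
        using lift_derivative[of "{0<..<1}" t \<gamma> g v] \<gamma> t \<tau> v by auto
      have "m \<le> \<rho> (\<gamma> t)" using \<gamma>[of t] near[of t] t \<tau> by (intro \<rho>) auto
      then have "m * norm u \<le> norm v" using u(2) mult_right_mono[of m "\<rho> (\<gamma> t)" "norm u"] by simp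
      with u(1) show "\<exists>w. (\<gamma> has_vector_derivative w) (at t) \<and> m * norm w \<le> norm v" by blast
    qed
    then show ?thesis by (simp add: ends dist_norm norm_minus_commute)
  qed
  show "ennreal (m * min r (dist z w)) \<le> curve_length g"
  proof (cases "\<forall>t\<in>{0..1}. dist z (\<gamma> t) < r")
    case True
    have "ennreal (m * min r (dist z w)) \<le> ennreal (m * dist z (\<gamma> 1))"
      using m ends by (intro ennreal_leI mult_left_mono) auto
    also have "\<dots> \<le> curve_length g" using True by (intro main) auto
    finally show ?thesis .
  next
    case False
    \<comment> \<open>T is closed, so its infimum is attained: it is the first exit time.\<close>
    define T where "T = {t \<in> {0..1}. dist z (\<gamma> t) \<in> {r..}}"
    have "closed ({0..1} \<inter> (\<lambda>t. dist z (\<gamma> t)) -` {r..})"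
      by (rule continuous_closed_preimage) (auto intro!: continuous_intros cont)
    then have "closed T" by (simp add: T_def vimage_def Int_def)
    moreover have "T \<noteq> {}" using False by (auto simp: T_def not_less)
    moreover have bb: "bdd_below T" by (auto simp: T_def intro!: bdd_belowI[of _ 0])
    ultimately have Inf: "Inf T \<in> T" by (rule closed_contains_Inf[rotated 2])
    have before: "dist z (\<gamma> t) < r" if "0 \<le> t" "t < Inf T" for t
    proof (rule ccontr)
      assume "\<not> ?thesis"
      then have "t \<in> T" using that Inf by (auto simp: T_def)
      then show False using that(2) cInf_lower[OF _ bb] by fastforce
    qed
    have "ennreal (m * min r (dist z w)) \<le> ennreal (m * dist z (\<gamma> (Inf T)))"
      using m Inf by (intro ennreal_leI mult_left_mono) (auto simp: T_def)
    also have "\<dots> \<le> curve_length g" using Inf before by (intro main) (auto simp: T_def)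
    finally show ?thesis .
  qed
qed

lemma intrinsic_dist_ge_planar_dist:
  assumes "z \<in> D" "w \<in> D" "\<And>y. y \<in> D \<Longrightarrow> 1 \<le> \<rho> y"
  shows "ennreal (dist z w) \<le> intrinsic_dist (\<Phi> ` D) (\<Phi> z) (\<Phi> w)"
proof -
  have "ennreal (1 * min (dist z w) (dist z w)) \<le> intrinsic_dist (\<Phi> ` D) (\<Phi> z) (\<Phi> w)"
    by (rule intrinsic_dist_lower_bound) (use assms in auto)
  then show ?thesis by simp
qed

lemma
  assumes "closed_segment z w \<subseteq> D"
  shows valid_path_segment: "valid_path (\<Phi> \<circ> linepath z w)"
    and vector_derivative_segment:
      "t \<in> {0..1} \<Longrightarrow> vector_derivative (\<Phi> \<circ> linepath z w) (at t) = \<Phi>' (linepath z w t) (w - z)"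
proof -
  have inD: "linepath z w t \<in> D" if "t \<in> {0..1}" for t
    using assms that by (blast intro: linepath_in_path)
  have der: "(\<Phi> \<circ> linepath z w has_vector_derivative \<Phi>' (linepath z w t) (w - z)) (at t)"
    if t: "t \<in> {0..1}" for t
  proof -
    have "(linepath z w has_vector_derivative (w - z)) (at t)"
      by (rule has_vector_derivative_linepath_within)
    then have "(\<Phi> \<circ> linepath z w has_derivative \<Phi>' (linepath z w t) \<circ> (\<lambda>h. h *\<^sub>R (w - z))) (at t)"
      using deriv[OF inD[OF t]] unfolding has_vector_derivative_def by (intro diff_chain_at)
    moreover have "\<Phi>' (linepath z w t) \<circ> (\<lambda>h. h *\<^sub>R (w - z)) = (\<lambda>h. h *\<^sub>R \<Phi>' (linepath z w t) (w - z))"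
      using has_derivative_linear[OF deriv[OF inD[OF t]]] by (auto simp: linear_scale)
    ultimately show ?thesis by (simp add: has_vector_derivative_def)
  qed
  show "t \<in> {0..1} \<Longrightarrow> vector_derivative (\<Phi> \<circ> linepath z w) (at t) = \<Phi>' (linepath z w t) (w - z)"
    using der by (intro vector_derivative_at)
  have "continuous_on {0..1} (\<lambda>t. \<Phi>' (linepath z w t) (w - z))"
    by (rule continuous_on_compose2[OF cont_deriv]) (use inD in \<open>auto intro: continuous_on_linepath\<close>)
  then have "(\<Phi> \<circ> linepath z w) C1_differentiable_on {0..1}"
    unfolding C1_differentiable_on_def
    by (intro exI[of _ "\<lambda>t. \<Phi>' (linepath z w t) (w - z)"] conjI ballI der)
  then show "valid_path (\<Phi> \<circ> linepath z w)"
    by (simp add: C1_differentiable_imp_piecewise valid_path_def)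
qed

lemma intrinsic_dist_segment_le:
  assumes seg: "closed_segment z w \<subseteq> D"
    and k: "\<And>t. t \<in> {0..1} \<Longrightarrow> \<rho> (linepath z w t) * dist z w \<le> k t"
    and G: "\<And>t. t \<in> {0..1} \<Longrightarrow> (G has_real_derivative k t) (at t)" and mk: "k \<in> borel_measurable borel"
  shows "intrinsic_dist (\<Phi> ` D) (\<Phi> z) (\<Phi> w) \<le> ennreal (G 1 - G 0)"
proof -
  have inD: "linepath z w t \<in> D" if "t \<in> {0..1}" for t
    using seg that by (blast intro: linepath_in_path)
  have "intrinsic_dist (\<Phi> ` D) (\<Phi> z) (\<Phi> w) \<le> curve_length (\<Phi> \<circ> linepath z w)"
    using intrinsic_dist_le_curve_length[OF valid_path_segment[OF seg], of "\<Phi> ` D"] inD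
    by (auto simp: path_image_compose pathstart_compose pathfinish_compose seg image_mono)
  also have "\<dots> \<le> (\<integral>\<^sup>+t. ennreal (k t) * indicator {0..1} t \<partial>lborel)"
    unfolding curve_length_def
    by (intro nn_integral_mono)
       (use k inD in \<open>auto simp: vector_derivative_segment[OF seg] conformal dist_norm norm_minus_commute
          indicator_def intro!: ennreal_leI\<close>)
  also have "\<dots> = G 1 - G 0"
  proof (rule nn_integral_FTC_Icc)
    show "(G has_real_derivative k x) (at x)" if "x \<in> {0..1}" for x using G[OF that] .
    show "0 \<le> k x" if "x \<in> {0..1}" for x
    proof -
      have "0 \<le> \<rho> (linepath z w x) * dist z w" using \<rho>_pos[OF inD[of x]] that by auto
      then show ?thesis using k[of x] that by auto
    qed
  qed (use mk in auto)
  finally show ?thesis .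
qed

lemma intrinsic_dist_segment_le_const:
  assumes "closed_segment z w \<subseteq> D" "\<And>y. y \<in> closed_segment z w \<Longrightarrow> \<rho> y \<le> M"
  shows "intrinsic_dist (\<Phi> ` D) (\<Phi> z) (\<Phi> w) \<le> ennreal (M * dist z w)"
proof -
  have "intrinsic_dist (\<Phi> ` D) (\<Phi> z) (\<Phi> w) \<le> ennreal ((\<lambda>t. M * dist z w * t) 1 - (\<lambda>t. M * dist z w * t) 0)"
  proof (rule intrinsic_dist_segment_le[where k = "\<lambda>_. M * dist z w"])
    fix t :: real assume "t \<in> {0..1}"
    then show "\<rho> (linepath z w t) * dist z w \<le> M * dist z w"
      using assms(2) by (intro mult_right_mono) (blast intro: linepath_in_path, simp)
    show "((\<lambda>t. M * dist z w * t) has_real_derivative M * dist z w) (at t)"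
      by (auto intro!: derivative_eq_intros)
  qed (use assms in auto)
  then show ?thesis by simp
qed

text \<open>The conformal factor grows exponentially along a vertical segment. Integrating cosh to
  sinh, instead of multiplying its maximum by the length, avoids a logarithmic loss in the distances
  of order \<open>N * p\<close> that \<open>pitch_bound\<close> compares.\<close>

lemma intrinsic_dist_vertical_le:
  fixes x a b k p d :: real
  assumes seg: "\<And>y. y \<in> closed_segment a b \<Longrightarrow> Complex x y \<in> D \<and> \<rho> (Complex x y) \<le> k * cosh (y / p + d)"
    and kp: "k > 0" "p > 0"
  shows "intrinsic_dist (\<Phi> ` D) (\<Phi> (Complex x a)) (\<Phi> (Complex x b))
    \<le> ennreal (k * p * \<bar>sinh (b / p + d) - sinh (a / p + d)\<bar>)"
proof -
  \<comment> \<open>The sign makes the primitive increasing whether the segment runs upwards or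
    downwards.\<close>
  define s where "s = sgn (b - a)"
  have lin: "linepath (Complex x a) (Complex x b) t = Complex x (linepath a b t)" for t
    by (simp add: linepath_def complex_eq_iff algebra_simps)
  have mem: "linepath a b t \<in> closed_segment a b" if "t \<in> {0..1}" for t
    using that by (rule linepath_in_path)
  define G where "G = (\<lambda>t. s * k * p * sinh (linepath a b t / p + d))"
  define g where "g = (\<lambda>t. k * cosh (linepath a b t / p + d) * \<bar>b - a\<bar>)"
  have dist: "dist (Complex x a) (Complex x b) = \<bar>b - a\<bar>" by (simp add: dist_norm cmod_def abs_minus_commute)
  have "intrinsic_dist (\<Phi> ` D) (\<Phi> (Complex x a)) (\<Phi> (Complex x b)) \<le> ennreal (G 1 - G 0)"
  proof (rule intrinsic_dist_segment_le[where k = g])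
    show "closed_segment (Complex x a) (Complex x b) \<subseteq> D"
      using seg mem lin unfolding path_image_linepath[symmetric] path_image_def by auto
    fix t :: real assume t: "t \<in> {0..1}"
    show "\<rho> (linepath (Complex x a) (Complex x b) t) * dist (Complex x a) (Complex x b) \<le> g t"
      using seg[OF mem[OF t]] unfolding lin dist g_def by (intro mult_right_mono) auto
    have "((\<lambda>t. linepath a b t) has_real_derivative (b - a)) (at t)"
      unfolding linepath_def by (auto intro!: derivative_eq_intros)
    then show "(G has_real_derivative g t) (at t)"
      unfolding G_def g_def s_def using kp
      by (auto intro!: derivative_eq_intros simp: abs_sgn field_simps)
  next
    have "continuous_on UNIV g" unfolding g_def linepath_def by (intro continuous_intros) (use kp in auto)
    then show "g \<in> borel_measurable borel" by (rule borel_measurable_continuous_onI)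
  qed
  also have "G 1 - G 0 = k * p * (s * (sinh (b / p + d) - sinh (a / p + d)))"
    by (simp add: G_def linepath_def algebra_simps)
  also have "s * (sinh (b / p + d) - sinh (a / p + d)) \<le> \<bar>sinh (b / p + d) - sinh (a / p + d)\<bar>"
    unfolding s_def by (auto simp: sgn_if)
  finally show ?thesis using kp by (simp add: mult_left_mono ennreal_leI)
qed

end

section \<open>Packing of points in planar disks, at all scales at once\<close>

definition crowded :: "nat \<Rightarrow> real \<Rightarrow> bool" where
  "crowded N \<kappa> \<longleftrightarrow> (\<forall>r>0. \<forall>c. \<forall>z :: nat \<Rightarrow> complex. (\<forall>j<N. z j \<in> cball c r) \<longrightarrow>
     (\<exists>i<N. \<exists>j<N. i \<noteq> j \<and> dist (z i) (z j) < \<kappa> * r))"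

lemma crowdedD:
  fixes z :: "nat \<Rightarrow> complex"
  assumes "crowded N \<kappa>" "r > 0" "\<And>j. j < N \<Longrightarrow> z j \<in> cball c r"
  shows "\<exists>i<N. \<exists>j<N. i \<noteq> j \<and> dist (z i) (z j) < \<kappa> * r"
  using assms unfolding crowded_def by blast

lemma crowded_mono:
  assumes "crowded N \<kappa>" "N \<le> N'"
  shows "crowded N' \<kappa>"
  unfolding crowded_def
proof (intro allI impI)
  fix r c and z :: "nat \<Rightarrow> complex"
  assume r: "r > 0" "\<forall>j<N'. z j \<in> cball c r"
  then obtain i j where "i < N" "j < N" "i \<noteq> j" "dist (z i) (z j) < \<kappa> * r"
    using crowdedD[OF assms(1), of r z c] assms(2) by auto
  with assms(2) show "\<exists>i<N'. \<exists>j<N'. i \<noteq> j \<and> dist (z i) (z j) < \<kappa> * r" by (meson less_le_trans)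
qed

text \<open>Pigeonhole: the unit disk is covered by finitely many balls of radius
  \<open>\<kappa> / 2\<close>, and one more point than balls puts two into the same ball. Rescaling
  carries this to every disk.\<close>

lemma ex_crowded:
  assumes "\<kappa> > 0"
  shows "\<exists>N>0. crowded N \<kappa>"
proof -
  have "compact (cball (0::complex) 1)" by simp
  then obtain k where k: "finite k" "cball (0::complex) 1 \<subseteq> (\<Union>x\<in>k. ball x (\<kappa>/2))"
    unfolding compact_eq_totally_bounded using assms by (metis half_gt_zero)
  have "crowded (card k + 1) \<kappa>"
    unfolding crowded_def
  proof (intro allI impI)
    fix r c and z :: "nat \<Rightarrow> complex"
    assume r: "r > 0" and z: "\<forall>j<card k + 1. z j \<in> cball c r"
    define y where "y j = (z j - c) /\<^sub>R r" for j
    have "\<exists>x\<in>k. y j \<in> ball x (\<kappa>/2)" if "j < card k + 1" for j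
    proof -
      have "y j \<in> cball 0 1" using z that r
        by (simp add: y_def dist_norm norm_minus_commute divide_simps)
      then show ?thesis using k(2) by blast
    qed
    then obtain X where X: "\<And>j. j < card k + 1 \<Longrightarrow> X j \<in> k \<and> y j \<in> ball (X j) (\<kappa>/2)" by metis
    have "\<not> inj_on X {..<card k + 1}"
    proof
      assume "inj_on X {..<card k + 1}"
      then have "card {..<card k + 1} \<le> card k" using X k(1) by (intro card_inj_on_le[of X]) auto
      then show False by simp
    qed
    then obtain i j where ij: "i < card k + 1" "j < card k + 1" "i \<noteq> j" "X i = X j"
      by (auto simp: inj_on_def)
    have "dist (y i) (y j) < \<kappa>" using X[OF ij(1)] X[OF ij(2)] ij(4)
      by (metis dist_triangle_half_r mem_ball)
    moreover have "dist (z i) (z j) = r * dist (y i) (y j)"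
    proof -
      have "z i - z j = r *\<^sub>R (y i - y j)" using r by (simp add: y_def algebra_simps)
      then show ?thesis using r by (simp add: dist_norm)
    qed
    ultimately have "dist (z i) (z j) < \<kappa> * r" using r by (simp add: mult.commute)
    then show "\<exists>i<card k + 1. \<exists>j<card k + 1. i \<noteq> j \<and> dist (z i) (z j) < \<kappa> * r" using ij by blast
  qed
  then show ?thesis by (intro exI[of _ "card k + 1"]) simp
qed

section \<open>Maps from a surface to a helicoid\<close>

lemma exp_three_halves_le: "exp (3 / 2 :: real) \<le> 15 / 2"
proof -
  have "exp (3 / 2 :: real) = exp 1 * exp (1/2)" by (simp flip: exp_add)
  also have "\<dots> \<le> 3 * 2" by (intro mult_mono exp_le exp_half_le2) auto
  finally show ?thesis by simp
qed

lemma cosh_one_le: "cosh (1::real) \<le> 2"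
proof -
  have "exp 1 + exp (- 1) \<le> (3 + 1 :: real)" by (intro add_mono exp_le) simp
  then show ?thesis by (simp add: cosh_def)
qed

text \<open>A Harnack inequality: the logarithm of cosh has slope at most 1. Hence the conformal
  factor of a helicoid changes by a factor of at most e within unit distance in the parameter
  plane.\<close>

lemma cosh_le_exp_dist_mult_cosh: "cosh (a::real) \<le> exp \<bar>a - b\<bar> * cosh b"
proof -
  have "exp a \<le> exp (\<bar>a - b\<bar> + b)" unfolding exp_le_cancel_iff by linarith
  moreover have "exp (-a) \<le> exp (\<bar>a - b\<bar> - b)" unfolding exp_le_cancel_iff by linarith
  ultimately have "exp a + exp (-a) \<le> exp \<bar>a - b\<bar> * (exp b + exp (-b))"
    by (simp add: exp_add exp_diff exp_minus algebra_simps divide_inverse)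
  then show ?thesis by (simp add: cosh_def)
qed

lemma abs_sinh_less_cosh: "\<bar>sinh (x::real)\<bar> < cosh x"
  using sinh_less_cosh_real[of x] sinh_less_cosh_real[of "-x"] by (simp add: abs_if)

text \<open>The two distances are those of the surface and of the piece \<Gamma>. Passing from
  \<Gamma> to the whole helicoid can only shorten distances (\<open>dH_le\<close>); upper bounds
  found in the helicoid are brought back to \<Gamma> by \<open>ball_contained\<close>.\<close>

locale chart_map =
  X: conformal_chart \<Phi> \<Phi>' D "\<lambda>z. cosh (v z)" + H: conformal_chart \<Psi> \<Psi>' UNIV "\<lambda>z. c * cosh (Im z)"
  for \<Phi> :: "complex \<Rightarrow> 'a::euclidean_space" and \<Phi>' D v
    and \<Psi> :: "complex \<Rightarrow> 'b::euclidean_space" and \<Psi>' c +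
  fixes \<Gamma> :: "'b set" and f :: "'a \<Rightarrow> 'b"
  assumes \<Gamma>: "\<Gamma> \<subseteq> range \<Psi>" and bij: "bij_betw f (\<Phi> ` D) \<Gamma>"
    and contf: "continuous_on (\<Phi> ` D) f" and contf': "continuous_on \<Gamma> (inv_into (\<Phi> ` D) f)"
    and lip: "\<lbrakk>x \<in> \<Phi> ` D; y \<in> \<Phi> ` D\<rbrakk> \<Longrightarrow> intrinsic_dist \<Gamma> (f x) (f y) \<le> 2 * intrinsic_dist (\<Phi> ` D) x y"
    and lip': "\<lbrakk>x \<in> \<Phi> ` D; y \<in> \<Phi> ` D\<rbrakk> \<Longrightarrow> intrinsic_dist (\<Phi> ` D) x y \<le> 2 * intrinsic_dist \<Gamma> (f x) (f y)"
begin

abbreviation "dX \<equiv> intrinsic_dist (\<Phi> ` D)"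
abbreviation "dH \<equiv> intrinsic_dist (range \<Psi>)"
abbreviation "d\<Gamma> \<equiv> intrinsic_dist \<Gamma>"

lemma c_pos: "c > 0" using H.\<rho>_pos[of 0] by simp

lemma dH_le: "dH x y \<le> d\<Gamma> x y" by (rule intrinsic_dist_mono[OF \<Gamma>])

lemma dX_ge: "\<lbrakk>z \<in> D; w \<in> D\<rbrakk> \<Longrightarrow> ennreal (dist z w) \<le> dX (\<Phi> z) (\<Phi> w)"
  by (rule X.intrinsic_dist_ge_planar_dist) (auto simp: cosh_real_ge_1)

text \<open>Invariance of domain: chart, map and inverse chart compose to a continuous injection
  from D into the plane. So \<Gamma> is relatively open in the helicoid although it is given as an
  arbitrary subset.\<close>

lemma open_preimage: "open (inv \<Psi> ` \<Gamma>)"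
proof -
  have "inv \<Psi> ` \<Gamma> = (inv \<Psi> \<circ> f \<circ> \<Phi>) ` D"
    using bij by (auto simp: bij_betw_def image_comp)
  moreover have "open ((inv \<Psi> \<circ> f \<circ> \<Phi>) ` D)"
  proof (rule invariance_of_domain)
    have "continuous_on D \<Phi>" by (meson X.deriv continuous_at_imp_continuous_on has_derivative_continuous)
    moreover have "f ` (\<Phi> ` D) \<subseteq> range \<Psi>" using bij \<Gamma> by (auto simp: bij_betw_def)
    ultimately show "continuous_on D (inv \<Psi> \<circ> f \<circ> \<Phi>)"
      using contf H.cont_inv by (intro continuous_on_compose) (auto elim: continuous_on_subset simp: image_comp)
    have "inj_on (inv \<Psi>) \<Gamma>" using \<Gamma> by (meson inj_on_inv_into)
    then show "inj_on (inv \<Psi> \<circ> f \<circ> \<Phi>) D"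
      using bij X.inj by (auto intro!: comp_inj_on simp: bij_betw_def image_comp)
  qed (rule X.open_D)
  ultimately show ?thesis by simp
qed

text \<open>A path of the helicoid can only leave \<open>\<Gamma>\<close> at a point whose preimages run off to the boundary of
  the surface, and the Lipschitz bound on the inverse keeps these preimages in a compact set.\<close>

lemma ball_contained:
  assumes z: "z \<in> D" and l: "l > 0" and cb: "cball z (2 * l) \<subseteq> D" and b: "dH (f (\<Phi> z)) b < ennreal l"
  shows "b \<in> \<Gamma>" "d\<Gamma> (f (\<Phi> z)) b < ennreal l"
proof -
  obtain g where g: "valid_path g" "path_image g \<subseteq> range \<Psi>" "pathstart g = f (\<Phi> z)" "pathfinish g = b"
    "curve_length g < ennreal l" by (rule intrinsic_dist_lessE[OF b])
  have contg: "continuous_on {0..1} g" using g(1) valid_path_imp_path path_def by blast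
  have gin: "g t \<in> range \<Psi>" if "t \<in> {0..1}" for t using g(2) that by (auto simp: path_image_def)
  have mem: "g t \<in> \<Gamma> \<longleftrightarrow> inv \<Psi> (g t) \<in> inv \<Psi> ` \<Gamma>" if "t \<in> {0..1}" for t
  proof
    assume "inv \<Psi> (g t) \<in> inv \<Psi> ` \<Gamma>"
    then obtain y where "y \<in> \<Gamma>" "inv \<Psi> (g t) = inv \<Psi> y" by auto
    then show "g t \<in> \<Gamma>" using gin[OF that] \<Gamma> by (metis f_inv_into_f subsetD)
  qed auto
  have len: "d\<Gamma> (f (\<Phi> z)) (g t) < ennreal l"
    if t: "t \<in> {0..1}" and sub: "\<And>s. s \<in> {0..t} \<Longrightarrow> g s \<in> \<Gamma>" for t
  proof -
    have "path_image (subpath 0 t g) \<subseteq> \<Gamma>"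
      using t sub by (auto simp: path_image_subpath closed_segment_eq_real_ivl)
    then have "d\<Gamma> (pathstart (subpath 0 t g)) (pathfinish (subpath 0 t g)) \<le> curve_length (subpath 0 t g)"
      using t g(1) by (intro intrinsic_dist_le_curve_length valid_path_subpath) auto
    also have "\<dots> \<le> curve_length g" using t g(1) by (intro curve_length_initial_subpath) auto
    also have "\<dots> < ennreal l" by (rule g(5))
    finally show ?thesis unfolding pathstart_subpath pathfinish_subpath using g(3) by (simp add: pathstart_def)
  qed
  define T where "T = {0..1} \<inter> (\<lambda>t. inv \<Psi> (g t)) -` (- (inv \<Psi> ` \<Gamma>))"
  have T: "t \<in> T \<longleftrightarrow> t \<in> {0..1} \<and> g t \<notin> \<Gamma>" for t using mem[of t] by (auto simp: T_def)
  have "T = {}"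
  proof (rule ccontr)
    assume ne: "T \<noteq> {}"
    have "continuous_on {0..1} (\<lambda>t. inv \<Psi> (g t))"
      by (rule continuous_on_compose2[OF H.cont_inv contg]) (use gin in auto)
    then have "closed T" unfolding T_def
      using open_preimage by (intro continuous_closed_preimage) auto
    moreover have bb: "bdd_below T" by (auto simp: T_def intro!: bdd_belowI[of _ 0])
    ultimately have Inf: "Inf T \<in> T" using closed_contains_Inf ne by blast
    \<comment> \<open>By \<open>open_preimage\<close> the exit times form a closed set, so the first
      one is itself outside \<Gamma>. The contradiction comes from the compact set K, which contains
      all earlier points of the path and hence also the limit at \<tau>.\<close>
    define \<tau> where "\<tau> = Inf T"
    have before: "g t \<in> \<Gamma>" if "0 \<le> t" "t < \<tau>" for t
    proof (rule ccontr)
      assume "\<not> ?thesis"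
      then have "t \<in> T" using that Inf T by (auto simp: \<tau>_def)
      then show False using that(2) cInf_lower[OF _ bb] \<tau>_def by fastforce
    qed
    define K where "K = f ` \<Phi> ` cball z (2 * l)"
    have inK: "g t \<in> K" if t: "0 \<le> t" "t < \<tau>" for t
    proof -
      have "g t \<in> \<Gamma>" using before[OF t] .
      then obtain w where w: "w \<in> D" "g t = f (\<Phi> w)" using bij by (auto simp: bij_betw_def)
      have "ennreal (dist z w) \<le> dX (\<Phi> z) (\<Phi> w)" using z w(1) by (rule dX_ge)
      also have "\<dots> \<le> 2 * d\<Gamma> (f (\<Phi> z)) (g t)" using lip'[of "\<Phi> z" "\<Phi> w"] z w by auto
      also have "\<dots> \<le> 2 * ennreal l"
        using len[of t] before t Inf T by (intro mult_left_mono less_imp_le) (auto simp: \<tau>_def)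
      also have "\<dots> = ennreal (2 * l)" using l by (simp add: ennreal_mult')
      finally have "dist z w \<le> 2 * l" using l by (simp add: ennreal_le_iff)
      then show ?thesis using w by (auto simp: K_def)
    qed
    have "compact K" unfolding K_def
    proof (intro compact_continuous_image)
      show "continuous_on (cball z (2 * l)) \<Phi>"
        using cb by (meson X.deriv continuous_at_imp_continuous_on has_derivative_continuous subsetD)
      show "continuous_on (\<Phi> ` cball z (2 * l)) f" using contf cb by (rule continuous_on_subset[OF _ image_mono])
    qed simp
    then have "closed K" by (rule compact_imp_closed)
    have KG: "K \<subseteq> \<Gamma>" using bij cb by (auto simp: K_def bij_betw_def)
    have "g 0 \<in> \<Gamma>" using g(3) z bij by (auto simp: pathstart_def bij_betw_def)
    then have \<tau>: "0 < \<tau>" "\<tau> \<le> 1" using Inf T[of 0] T[of \<tau>] by (auto simp: \<tau>_def less_le)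
    have "(g \<longlongrightarrow> g \<tau>) (at \<tau> within {0..1})" using contg \<tau> by (auto simp: continuous_on_def)
    then have "(g \<longlongrightarrow> g \<tau>) (at \<tau> within {0..<\<tau>})" by (rule tendsto_within_subset) (use \<tau> in auto)
    moreover have "eventually (\<lambda>t. g t \<in> K) (at \<tau> within {0..<\<tau>})"
      using inK by (auto simp: eventually_at_filter)
    moreover have "at \<tau> within {0..<\<tau>} \<noteq> bot"
    proof -
      have "\<tau> \<in> closure {0..<\<tau>}" using \<tau> by simp
      then show ?thesis unfolding trivial_limit_within islimpt_in_closure using \<tau> by simp
    qed
    ultimately have "g \<tau> \<in> K" using Lim_in_closed_set[OF \<open>closed K\<close>] by blast
    then show False using KG Inf T by (auto simp: \<tau>_def)
  qed
  then have all: "g t \<in> \<Gamma>" if "t \<in> {0..1}" for t using T that by blast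
  from len[of 1] all g(4) show "d\<Gamma> (f (\<Phi> z)) b < ennreal l" by (auto simp: pathfinish_def)
  from all[of 1] g(4) show "b \<in> \<Gamma>" by (auto simp: pathfinish_def)
qed

text \<open>The points \<open>Complex (q + j * p) (p * ln N)\<close>, \<open>j < N\<close>, lie on different sheets of the surface over
  the axis point \<open>q\<close>. If the conformal factor \<open>c * cosh\<close> were large at the image of \<open>q\<close>, the
  helicoid would be nearly flat at this scale and could not accommodate them.\<close>

lemma pitch_bound:
  fixes N :: nat and p q :: real
  assumes N: "crowded N (1 / 5000)"
    and N5: "N \<ge> 5" and p: "p > 0"
    and near: "\<And>z. dist (of_real q) z \<le> 4 * N * p \<Longrightarrow> z \<in> D \<and> \<bar>v z - Im z / p\<bar> \<le> 1"
  shows "c * cosh (Im (inv \<Psi> (f (\<Phi> (of_real q))))) \<le> 24 * N * p"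
proof (rule ccontr)
  assume contra: "\<not> ?thesis"
  define b where "b = inv \<Psi> (f (\<Phi> (of_real q)))"
  define \<rho> where "\<rho> = c * cosh (Im b)"
  have \<rho>: "24 * N * p < \<rho>" using contra by (simp add: b_def \<rho>_def)
  have Np: "real N * p > 0" using N5 p by simp
  have \<rho>0: "\<rho> > 0" using \<rho> Np by linarith
  \<comment> \<open>At a height of \<open>ln N\<close> pitches the conformal factor is of order N.
    Both the distances from q and the mutual distances of the chosen points are therefore comparable
    to \<open>N * p\<close>.\<close>
  define V where "V = ln (real N)"
  have eV: "exp V = N" using N5 by (simp add: V_def)
  have V: "V \<ge> 3/2"
  proof -
    have "exp (3/2::real) \<le> 5"
    proof -
      have "exp (3/2::real) ^ 2 = exp 1 ^ 3" by (simp flip: exp_of_nat_mult)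
      also have "\<dots> \<le> (14/5::real) ^ 3"
        by (intro power_mono) (use e_less_272 in auto)
      also have "\<dots> \<le> 5 ^ 2" by (simp add: power3_eq_cube power2_eq_square)
      finally show ?thesis by (rule power2_le_imp_le) simp
    qed
    then have "exp (3/2) \<le> exp V" using N5 eV by linarith
    then show ?thesis by simp
  qed
  have VN: "V + 1 \<le> N" using ln_le_minus_one[of N] N5 by (simp add: V_def)
  define z where "z = (\<lambda>j::nat. Complex (q + j * p) (p * V))"
  have z_near: "dist (of_real q) w \<le> 4 * N * p" if "j < N" "\<bar>Re w - (q + j * p)\<bar> \<le> p" "\<bar>Im w\<bar> \<le> p * V + p" for j w
  proof -
    have "dist (of_real q) w \<le> \<bar>Re w - q\<bar> + \<bar>Im w\<bar>"
      using cmod_le[of "w - of_real q"] by (simp add: dist_norm norm_minus_commute)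
    also have "\<dots> \<le> p + j * p + (p * V + p)"
    proof -
      have "0 \<le> j * p" using p by simp
      with that show ?thesis by linarith
    qed
    also have "\<dots> = p * (real j + (V + 1) + 1)" by (simp add: algebra_simps)
    also have "\<dots> \<le> p * (N + N + N)"
      using that(1) VN N5 p by (intro mult_left_mono add_mono) auto
    also have "\<dots> \<le> 4 * N * p" using p by (simp add: algebra_simps)
    finally show ?thesis .
  qed
  have zD: "z j \<in> D" if "j < N" for j
    using near z_near[OF that, of "z j"] p V by (auto simp: z_def abs_mult)
  have qD: "of_real q \<in> D" using near[of "of_real q"] p by simp
  \<comment> \<open>Along the axis, where the factor is at most 2, and then vertically:
    \<open>2 * N * p\<close> plus \<open>3 / 2 * N * p\<close>.\<close>
  have dq: "dX (\<Phi> (of_real q)) (\<Phi> (z j)) \<le> ennreal (4 * N * p)" if j: "j < N" for j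
  proof -
    define y where "y = complex_of_real (q + j * p)"
    have seg: "w \<in> D \<and> cosh (v w) \<le> 2" if w: "w \<in> closed_segment (of_real q) y" for w
    proof -
      have "Im w = 0" using w by (auto simp: in_segment y_def)
      moreover have "dist (of_real q) w \<le> dist (of_real q) y"
        using w by (metis dist_in_closed_segment dist_commute)
      moreover have "dist (of_real q) y \<le> 4 * N * p"
        using z_near[OF j, of y] p V by (simp add: y_def)
      ultimately have w: "w \<in> D" "\<bar>v w\<bar> \<le> 1" using near[of w] by auto
      have "cosh (v w) \<le> cosh 1" using w(2) by (metis cosh_real_abs cosh_real_nonneg_le_iff abs_ge_zero zero_le_one)
      also have "\<dots> \<le> 2" by (rule cosh_one_le)
      finally show ?thesis using w by simp
    qed
    have "dX (\<Phi> (of_real q)) (\<Phi> y) \<le> ennreal (2 * dist (of_real q) y)"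
      using seg by (intro X.intrinsic_dist_segment_le_const) auto
    also have "dist (of_real q) y = j * p"
    proof -
      have "of_real q - y = - of_real (j * p)" by (simp add: y_def)
      then show ?thesis using p unfolding dist_norm by (simp only: norm_minus_cancel norm_of_real) simp
    qed
    finally have 1: "dX (\<Phi> (of_real q)) (\<Phi> y) \<le> ennreal (2 * (j * p))" .
    have "dX (\<Phi> (Complex (q + j * p) 0)) (\<Phi> (Complex (q + j * p) (p * V)))
       \<le> ennreal (1 * p * \<bar>sinh ((p * V) / p + 1) - sinh (0 / p + 1)\<bar>)"
    proof (rule X.intrinsic_dist_vertical_le)
      fix t assume "t \<in> closed_segment 0 (p * V)"
      then have t: "0 \<le> t" "t \<le> p * V" using p V by (auto simp: closed_segment_eq_real_ivl split: if_splits)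
      let ?w = "Complex (q + j * p) t"
      have "dist (of_real q) ?w \<le> 4 * N * p" using t p by (intro z_near[OF j]) auto
      then have w: "?w \<in> D" "\<bar>v ?w - t / p\<bar> \<le> 1" using near[of ?w] by auto
      have "\<bar>v ?w\<bar> \<le> t / p + 1" using w(2) t p by (simp add: abs_le_iff)
         (smt (verit) divide_nonneg_pos)
      then have "cosh (v ?w) \<le> cosh (t / p + 1)"
        by (metis cosh_real_abs cosh_real_nonneg_le_iff abs_ge_zero order_trans)
      then show "?w \<in> D \<and> cosh (v ?w) \<le> 1 * cosh (t / p + 1)" using w by simp
    qed (use p in auto)
    also have "(p * V) / p = V" using p by simp
    also have "\<bar>sinh (V + 1) - sinh (0 / p + 1)\<bar> \<le> 3 / 2 * N"
    proof -
      have "sinh (V + 1) \<le> exp (V + 1) / 2" by (simp add: sinh_def)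
      also have "exp (V + 1) = exp 1 * N" by (simp add: exp_add eV)
      also have "exp 1 * real N \<le> 3 * real N" using exp_le by (intro mult_right_mono) auto
      finally have "sinh (V + 1) \<le> 3 / 2 * N" by simp
      moreover have "sinh (0 / p + 1) \<le> sinh (V + 1)" "0 \<le> sinh (0 / p + 1)" using V by auto
      ultimately show ?thesis by linarith
    qed
    finally have 2: "dX (\<Phi> y) (\<Phi> (z j)) \<le> ennreal (p * (3 / 2 * N))"
      using p by (simp add: y_def z_def complex_of_real_def mult_left_mono ennreal_leI)
    have "dX (\<Phi> (of_real q)) (\<Phi> (z j)) \<le> ennreal (2 * (j * p)) + ennreal (p * (3 / 2 * N))"
      using intrinsic_dist_triangle add_mono[OF 1 2] by (rule order_trans)
    also have "\<dots> = ennreal (2 * (j * p) + p * (3 / 2 * N))" using p by simp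
    also have "2 * (j * p) + p * (3 / 2 * N) \<le> 2 * (N * p) + p * (3 / 2 * N)"
      using j p by (intro add_mono mult_left_mono mult_right_mono) auto
    also have "\<dots> \<le> 4 * N * p" using Np by (simp add: algebra_simps)
    finally show ?thesis by (simp add: ennreal_leI)
  qed
  have sep: "ennreal (N * p / 30) \<le> dX (\<Phi> (z i)) (\<Phi> (z j))" if ij: "i < N" "j < N" "i \<noteq> j" for i j
  proof -
    \<comment> \<open>Within \<open>p / 2\<close> of a chosen point, \<open>Im / p\<close> is at
      least \<open>V - 1/2\<close>, and \<open>v\<close> differs from it by at most 1. With
      \<open>exp (3/2)\<close> at most \<open>15/2\<close> this gives \<open>N \<le> 15 * m\<close>,
      so the separation \<open>m * (p / 2)\<close> is at least \<open>N * p / 30\<close>.\<close>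
    define m where "m = exp (V - 3/2) / 2"
    have "ennreal (m * min (p / 2) (dist (z i) (z j))) \<le> dX (\<Phi> (z i)) (\<Phi> (z j))"
    proof (rule X.intrinsic_dist_lower_bound)
      fix w assume w: "w \<in> D" "dist (z i) w < p / 2"
      have "\<bar>Re (z i - w)\<bar> \<le> dist (z i) w" "\<bar>Im (z i - w)\<bar> \<le> dist (z i) w"
        unfolding dist_norm by (rule abs_Re_le_cmod, rule abs_Im_le_cmod)
      then have c: "\<bar>q + i * p - Re w\<bar> < p / 2" "\<bar>p * V - Im w\<bar> < p / 2"
        using w(2) by (auto simp: z_def)
      have "dist (of_real q) w \<le> 4 * N * p"
      proof (rule z_near[OF ij(1)])
        have "0 \<le> p * V" using p V by simp
        then show "\<bar>Im w\<bar> \<le> p * V + p" using c(2) p by linarith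
      qed (use c(1) p in linarith)
      then have "\<bar>v w - Im w / p\<bar> \<le> 1" using near by blast
      moreover have "Im w / p \<ge> V - 1/2" 
      proof -
        have "p * V - p / 2 \<le> Im w" using c(2) by linarith
        then have "p * (V - 1/2) \<le> Im w" by (simp add: algebra_simps)
        then show ?thesis using p by (simp add: pos_le_divide_eq mult.commute)
      qed
      ultimately have "v w \<ge> V - 3/2" by linarith
      then have "exp (V - 3/2) \<le> exp (v w)" by simp
      moreover have "exp (- v w) \<ge> 0" by simp
      ultimately have "exp (V - 3/2) \<le> exp (v w) + exp (- v w)" by linarith
      then show "m \<le> cosh (v w)" unfolding m_def cosh_field_def by simp
    qed (use zD ij in \<open>auto simp: m_def\<close>)
    moreover have "p / 2 \<le> dist (z i) (z j)"
    proof -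
      have "p * 1 \<le> p * \<bar>real i - real j\<bar>" using ij(3) p by (intro mult_left_mono) auto
      also have "\<dots> = \<bar>Re (z i - z j)\<bar>" using p by (simp add: z_def abs_mult flip: left_diff_distrib)
      also have "\<dots> \<le> dist (z i) (z j)" unfolding dist_norm by (rule abs_Re_le_cmod)
      finally show ?thesis using p by simp
    qed
    moreover have "N * p / 30 \<le> m * (p / 2)"
    proof -
      have "real N = exp (V - 3/2) * exp (3/2)" by (simp add: eV flip: exp_add)
      also have "\<dots> \<le> exp (V - 3/2) * (15/2)" by (intro mult_left_mono exp_three_halves_le) simp
      finally have "N \<le> m * 15" by (simp add: m_def)
      then show ?thesis using p by (simp add: field_simps)
    qed
    ultimately show ?thesis using ennreal_leI[of "N * p / 30" "m * (p / 2)"] by (simp add: min_absorb1)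
  qed
  define b' where "b' = (\<lambda>j. inv \<Psi> (f (\<Phi> (z j))))"
  have fin: "f (\<Phi> w) \<in> \<Gamma>" if "w \<in> D" for w using that bij by (auto simp: bij_betw_def)
  have inv: "\<Psi> (inv \<Psi> (f (\<Phi> w))) = f (\<Phi> w)" if "w \<in> D" for w
    using fin[OF that] \<Gamma> by (auto simp: f_inv_into_f)
  have \<Psi>b: "\<Psi> b = f (\<Phi> (of_real q))" "j < N \<Longrightarrow> \<Psi> (b' j) = f (\<Phi> (z j))" for j
    using inv[OF qD] inv[OF zD[of j]] by (auto simp: b_def b'_def)
  \<comment> \<open>The images are within \<open>8 * N * p\<close> of the image of q, and the
    helicoid factor stays above \<open>\<rho> / 3\<close> on the unit disk around b. This confines
    their parameters to radius \<open>3 * (8 * N * p) / \<rho>\<close>, which is below 1 by the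
    assumption to be refuted.\<close>
  define r where "r = 24 * N * p / \<rho>"
  have r: "0 < r" "r < 1" using Np p N5 \<rho>0 \<rho> by (auto simp: r_def)
  have b'_near: "b' j \<in> cball b r" if j: "j < N" for j
  proof -
    have "ennreal (\<rho> / 3 * min 1 (dist b (b' j))) \<le> dH (\<Psi> b) (\<Psi> (b' j))"
    proof (rule H.intrinsic_dist_lower_bound)
      fix y assume "dist b y < 1"
      then have "\<bar>Im b - Im y\<bar> \<le> 1" using abs_Im_le_cmod[of "b - y"] by (simp add: dist_norm)
      then have "exp \<bar>Im b - Im y\<bar> \<le> exp 1" by simp
      with exp_le have "exp \<bar>Im b - Im y\<bar> \<le> 3" by linarith
      then have "exp \<bar>Im b - Im y\<bar> * cosh (Im y) \<le> 3 * cosh (Im y)" by (intro mult_right_mono) auto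
      then have "cosh (Im b) \<le> 3 * cosh (Im y)"
        using cosh_le_exp_dist_mult_cosh[of "Im b" "Im y"] by linarith
      then show "\<rho> / 3 \<le> c * cosh (Im y)" using c_pos by (simp add: \<rho>_def)
    qed (use \<rho>0 in auto)
    also have "\<dots> \<le> 2 * ennreal (4 * N * p)"
      unfolding \<Psi>b(1) \<Psi>b(2)[OF j]
      by (rule order_trans[OF dH_le order_trans[OF lip mult_left_mono[OF dq[OF j]]]]) (use qD zD j in auto)
    also have "\<dots> = ennreal (8 * N * p)" using p by (simp flip: ennreal_mult' ennreal_numeral)
    finally have "\<rho> / 3 * min 1 (dist b (b' j)) \<le> 8 * N * p"
      using p by (simp add: ennreal_le_iff)
    then have "min 1 (dist b (b' j)) \<le> r" using \<rho>0 by (simp add: r_def field_simps)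
    then show ?thesis using r by (simp add: min_def split: if_splits)
  qed
  \<comment> \<open>The value 1/5000 is chosen for the following estimate: with the factor at most
    \<open>3 * \<rho>\<close>, the two images are closer than \<open>72 / 5000 * N * p\<close>,
    hence than \<open>N * p / 60\<close>. Half of the separation is needed because the inverse map
    may double distances.\<close>
  obtain i j where ij: "i < N" "j < N" "i \<noteq> j" "dist (b' i) (b' j) < 1 / 5000 * r"
    using crowdedD[where z = b', OF N r(1) b'_near] by blast
  note bb = b'_near[OF ij(1)] b'_near[OF ij(2)]
  have "dH (\<Psi> (b' i)) (\<Psi> (b' j)) \<le> ennreal (3 * \<rho> * dist (b' i) (b' j))"
  proof (rule H.intrinsic_dist_segment_le_const)
    fix y assume "y \<in> closed_segment (b' i) (b' j)"
    then have "y \<in> cball b r" using bb by (meson closed_segment_subset convex_cball subsetD)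
    then have "\<bar>Im y - Im b\<bar> \<le> 1" using r abs_Im_le_cmod[of "b - y"] by (simp add: dist_norm)
    then have "exp \<bar>Im y - Im b\<bar> \<le> exp 1" by simp
    with exp_le have "exp \<bar>Im y - Im b\<bar> \<le> 3" by linarith
    then have "exp \<bar>Im y - Im b\<bar> * cosh (Im b) \<le> 3 * cosh (Im b)" by (intro mult_right_mono) auto
    then have "cosh (Im y) \<le> 3 * cosh (Im b)"
      using cosh_le_exp_dist_mult_cosh[of "Im y" "Im b"] by linarith
    then show "c * cosh (Im y) \<le> 3 * \<rho>" using c_pos by (simp add: \<rho>_def)
  qed simp
  also have "\<dots> < ennreal (N * p / 60)"
  proof (rule ennreal_lessI)
    have "3 * \<rho> * dist (b' i) (b' j) < 3 * \<rho> * (1 / 5000 * r)" using ij(4) \<rho>0 by simp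
    also have "\<dots> = 72 / 5000 * (N * p)" using \<rho>0 by (simp add: r_def)
    finally show "3 * \<rho> * dist (b' i) (b' j) < N * p / 60" using Np by linarith
  qed (use Np in simp)
  finally have close: "dH (f (\<Phi> (z i))) (f (\<Phi> (z j))) < ennreal (N * p / 60)"
    using \<Psi>b(2) ij by simp
  \<comment> \<open>\<open>ball_contained\<close> requires a disk of twice the radius in the
    surface; the points lie within \<open>3 * N * p\<close> of q, which leaves ample room in the
    assumed disk.\<close>
  have "cball (z i) (2 * (N * p / 60)) \<subseteq> D"
  proof
    fix w assume "w \<in> cball (z i) (2 * (N * p / 60))"
    then have w: "dist (z i) w \<le> N * p / 30" unfolding mem_cball by linarith
    have "dist (of_real q) (z i) \<le> 3 * N * p"
    proof -
      have "dist (of_real q) (z i) \<le> \<bar>Re (z i) - q\<bar> + \<bar>Im (z i)\<bar>"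
        using cmod_le[of "z i - of_real q"] by (simp add: dist_norm norm_minus_commute)
      also have "\<dots> = p * (i + V)" using p V by (simp add: z_def algebra_simps)
      also have "\<dots> \<le> p * (N + N)" using ij(1) VN p by (intro mult_left_mono add_mono) auto
      also have "\<dots> \<le> 3 * N * p" using Np by (simp add: algebra_simps)
      finally show ?thesis .
    qed
    with w have "dist (of_real q) w \<le> 4 * N * p"
      using dist_triangle[of "of_real q" w "z i"] Np by linarith
    then show "w \<in> D" using near by blast
  qed
  then have "d\<Gamma> (f (\<Phi> (z i))) (f (\<Phi> (z j))) < ennreal (N * p / 60)"
    using ball_contained(2)[OF zD[OF ij(1)] _ _ close] Np by simp
  then have "2 * d\<Gamma> (f (\<Phi> (z i))) (f (\<Phi> (z j))) < 2 * ennreal (N * p / 60)"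
    by (intro ennreal_mult_strict_left_mono) auto
  also have "2 * ennreal (N * p / 60) = ennreal (2 * (N * p / 60))"
    using ennreal_mult'[of 2 "N * p / 60"] by simp
  also have "2 * (N * p / 60) = N * p / 30" by simp
  finally have "dX (\<Phi> (z i)) (\<Phi> (z j)) < ennreal (N * p / 30)"
    using lip'[of "\<Phi> (z i)" "\<Phi> (z j)"] zD ij by (meson imageI le_less_trans)
  with sep[OF ij(1-3)] show False by simp
qed


text \<open>By \<open>pitch_bound\<close>, \<open>c\<close> is at most of order \<open>p1\<close> and the image of \<open>q2\<close> has conformal factor at most of
  order \<open>p2\<close>. Around it the helicoid contains about \<open>p2 / p1\<close> points separated at the scale \<open>p2\<close>, too
  many for the disk of radius \<open>144 * N * p2\<close> around \<open>q2\<close>, where the surface is comparable to the plane.\<close>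

lemma no_two_pitches:
  fixes N M :: nat and p1 p2 q1 q2 :: real
  assumes N: "crowded N (1 / 5000)"
    and M: "crowded M (1 / (48 * cosh (144 * N + 1)))"
    and N5: "N \<ge> 5" and p: "p1 > 0" "p2 > 0" "M * p1 < p2"
    and near1: "\<And>z. dist (of_real q1) z \<le> 144 * N * p1 \<Longrightarrow> z \<in> D \<and> \<bar>v z - Im z / p1\<bar> \<le> 1"
    and near2: "\<And>z. dist (of_real q2) z \<le> 144 * N * p2 \<Longrightarrow> z \<in> D \<and> \<bar>v z - Im z / p2\<bar> \<le> 1"
  shows False
proof -
  define K where "K = 24 * N * p2"
  define b where "b = inv \<Psi> (f (\<Phi> (of_real q2)))"
  have K: "K > 0" using N5 p by (simp add: K_def)
  have mono: "4 * N * p \<le> 144 * N * p" if "p > 0" for p :: real using that by simp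
  have "c * cosh (Im (inv \<Psi> (f (\<Phi> (of_real q1))))) \<le> 24 * N * p1"
    by (rule pitch_bound[OF N N5 p(1) near1[OF order_trans[OF _ mono[OF p(1)]]]])
  moreover have "c * 1 \<le> c * cosh (Im (inv \<Psi> (f (\<Phi> (of_real q1)))))"
    using c_pos cosh_real_ge_1 by (intro mult_left_mono) auto
  ultimately have c1: "c \<le> 24 * N * p1" by linarith
  have cb: "c * cosh (Im b) \<le> K"
    unfolding b_def K_def
    by (rule pitch_bound[OF N N5 p(2) near2[OF order_trans[OF _ mono[OF p(2)]]]])
  have cM: "c * M < K"
  proof -
    have "c * M \<le> (24 * N * p1) * M" using c1 by (intro mult_right_mono) auto
    also have "\<dots> = 24 * N * (M * p1)" by simp
    also have "\<dots> < 24 * N * p2" using p(3) N5 by (intro mult_strict_left_mono) auto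
    finally show ?thesis by (simp add: K_def)
  qed
  have qD: "of_real q2 \<in> D" using near2[of "of_real q2"] p by simp
  have fq: "f (\<Phi> (of_real q2)) \<in> \<Gamma>" using qD bij by (auto simp: bij_betw_def)
  then have \<Psi>b: "\<Psi> b = f (\<Phi> (of_real q2))" using \<Gamma> by (auto simp: b_def f_inv_into_f)
  have "1 \<le> K / c"
  proof -
    have "c * 1 \<le> c * cosh (Im b)" using c_pos cosh_real_ge_1 by (intro mult_left_mono) auto
    with cb have "c * 1 \<le> K" by linarith
    with c_pos show ?thesis by (simp add: pos_le_divide_eq)
  qed
  \<comment> \<open>At this height the helicoid factor is exactly K. The points \<open>w j\<close>
    stand there one parameter unit apart, and each is reached from b by going down to the axis,
    along it and up again; every leg is shorter than K, the middle one because
    \<open>c * M < K\<close>.\<close>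
  define y1 where "y1 = arcosh (K / c)"
  have y1: "c * cosh y1 = K" using \<open>1 \<le> K / c\<close> c_pos by (simp add: y1_def cosh_arcosh_real)
  define w where "w = (\<lambda>j::nat. Complex (Re b + j) y1)"
  have dw: "dH (\<Psi> b) (\<Psi> (w j)) < ennreal (3 * K)" if j: "j < M" for j
  proof -
    let ?x = "Re b + j"
    have 1: "dH (\<Psi> (Complex (Re b) (Im b))) (\<Psi> (Complex (Re b) 0))
       \<le> ennreal (c * 1 * \<bar>sinh (0 / 1 + 0) - sinh (Im b / 1 + 0)\<bar>)"
      by (rule H.intrinsic_dist_vertical_le) (use c_pos in auto)
    have 2: "dH (\<Psi> (Complex (Re b) 0)) (\<Psi> (Complex ?x 0)) \<le> ennreal (c * dist (Complex (Re b) 0) (Complex ?x 0))"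
    proof (rule H.intrinsic_dist_segment_le_const)
      fix y assume "y \<in> closed_segment (Complex (Re b) 0) (Complex ?x 0)"
      then have "Im y = 0" by (auto simp: in_segment)
      then show "c * cosh (Im y) \<le> c" by simp
    qed simp
    have 3: "dH (\<Psi> (Complex ?x 0)) (\<Psi> (Complex ?x y1))
       \<le> ennreal (c * 1 * \<bar>sinh (y1 / 1 + 0) - sinh (0 / 1 + 0)\<bar>)"
      by (rule H.intrinsic_dist_vertical_le) (use c_pos in auto)
    have "dH (\<Psi> b) (\<Psi> (w j)) \<le> dH (\<Psi> b) (\<Psi> (Complex (Re b) 0)) + dH (\<Psi> (Complex (Re b) 0)) (\<Psi> (w j))"
      by (rule intrinsic_dist_triangle)
    also have "\<dots> \<le> dH (\<Psi> b) (\<Psi> (Complex (Re b) 0)) +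
        (dH (\<Psi> (Complex (Re b) 0)) (\<Psi> (Complex ?x 0)) + dH (\<Psi> (Complex ?x 0)) (\<Psi> (w j)))"
      by (intro add_left_mono intrinsic_dist_triangle)
    also have "\<dots> \<le> ennreal (c * \<bar>sinh (Im b)\<bar>) + (ennreal (c * j) + ennreal (c * \<bar>sinh y1\<bar>))"
      using 1 2 3 by (intro add_mono) (simp_all add: w_def dist_norm cmod_def)
    also have "\<dots> = ennreal (c * \<bar>sinh (Im b)\<bar> + (c * j + c * \<bar>sinh y1\<bar>))"
      using c_pos by simp
    also have "\<dots> < ennreal (3 * K)"
    proof (rule ennreal_lessI)
      have "c * \<bar>sinh (Im b)\<bar> < c * cosh (Im b)" "c * \<bar>sinh y1\<bar> < c * cosh y1"
        using c_pos abs_sinh_less_cosh by simp_all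
      moreover have "c * j \<le> c * M" using j c_pos by simp
      ultimately show "c * \<bar>sinh (Im b)\<bar> + (c * j + c * \<bar>sinh y1\<bar>) < 3 * K"
        using cb cM y1 by linarith
    qed (use K in simp)
    finally show ?thesis .
  qed
  \<comment> \<open>Within distance 1/2 the factor drops at most by \<open>exp (1/2)\<close>, hence
    stays above \<open>K / 2\<close>; multiplied by the radius 1/2 this is
    \<open>K / 4\<close>.\<close>
  have sepH: "ennreal (K / 4) \<le> dH (\<Psi> (w i)) (\<Psi> (w j))" if ij: "i \<noteq> j" for i j
  proof -
    have "ennreal (K / 2 * min (1/2) (dist (w i) (w j))) \<le> dH (\<Psi> (w i)) (\<Psi> (w j))"
    proof (rule H.intrinsic_dist_lower_bound)
      fix y assume "dist (w i) y < 1/2"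
      then have "\<bar>y1 - Im y\<bar> \<le> 1/2" using abs_Im_le_cmod[of "w i - y"] by (simp add: dist_norm w_def)
      then have "exp \<bar>y1 - Im y\<bar> \<le> exp (1/2)" by simp
      with exp_half_le2 have "exp \<bar>y1 - Im y\<bar> \<le> 2" by linarith
      then have "exp \<bar>y1 - Im y\<bar> * cosh (Im y) \<le> 2 * cosh (Im y)" by (intro mult_right_mono) auto
      then have "cosh y1 \<le> 2 * cosh (Im y)"
        using cosh_le_exp_dist_mult_cosh[of "y1" "Im y"] by linarith
      then have "c * cosh y1 \<le> c * (2 * cosh (Im y))" using c_pos by (intro mult_left_mono) auto
      then show "K / 2 \<le> c * cosh (Im y)" using y1 by simp
    qed (use K in auto)
    moreover have "1/2 \<le> dist (w i) (w j)"
    proof -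
      have "1/2 \<le> \<bar>real i - real j\<bar>" using ij by linarith
      also have "\<dots> = \<bar>Re (w i - w j)\<bar>" by (simp add: w_def)
      also have "\<dots> \<le> dist (w i) (w j)" unfolding dist_norm by (rule abs_Re_le_cmod)
      finally show ?thesis .
    qed
    ultimately show ?thesis by (simp add: min_absorb1)
  qed
  \<comment> \<open>This is the origin of 144: the points lie within \<open>3 * K\<close> in the
    helicoid, the inverse map doubles this, and \<open>6 * K = 144 * N * p2\<close>.\<close>
  have cb2: "cball (of_real q2) (2 * (3 * K)) \<subseteq> D"
    using near2 by (auto simp: K_def)
  have w\<Gamma>: "\<Psi> (w j) \<in> \<Gamma>" "d\<Gamma> (f (\<Phi> (of_real q2))) (\<Psi> (w j)) < ennreal (3 * K)" if "j < M" for j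
    using ball_contained[OF qD _ cb2] dw[OF that] K by (auto simp: \<Psi>b)
  define z where "z = (\<lambda>j. inv_into D \<Phi> (inv_into (\<Phi> ` D) f (\<Psi> (w j))))"
  have z: "z j \<in> D" "f (\<Phi> (z j)) = \<Psi> (w j)" if "j < M" for j
  proof -
    have "inv_into (\<Phi> ` D) f (\<Psi> (w j)) \<in> \<Phi> ` D"
      using w\<Gamma>(1)[OF that] bij by (intro inv_into_into) (auto simp: bij_betw_def)
    then show "z j \<in> D" "f (\<Phi> (z j)) = \<Psi> (w j)"
      using w\<Gamma>(1)[OF that] bij by (auto simp: z_def inv_into_into f_inv_into_f bij_betw_def)
  qed
  have zb: "z j \<in> cball (of_real q2) (6 * K)" if "j < M" for j
  proof -
    have "ennreal (dist (of_real q2) (z j)) \<le> dX (\<Phi> (of_real q2)) (\<Phi> (z j))"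
      using qD z(1)[OF that] by (rule dX_ge)
    also have "\<dots> \<le> 2 * d\<Gamma> (f (\<Phi> (of_real q2))) (\<Psi> (w j))"
      using lip'[of "\<Phi> (of_real q2)" "\<Phi> (z j)"] qD z[OF that] by auto
    also have "\<dots> \<le> 2 * ennreal (3 * K)" using w\<Gamma>(2)[OF that] by (intro mult_left_mono) auto
    also have "\<dots> = ennreal (6 * K)" using ennreal_mult'[of 2 "3 * K"] by simp
    finally show ?thesis using K by (simp add: ennreal_le_iff)
  qed
  define \<Lambda> where "\<Lambda> = cosh (144 * N + 1 :: real)"
  have \<Lambda>: "\<Lambda> > 0" by (simp add: \<Lambda>_def)
  \<comment> \<open>On the disk of radius \<open>6 * K\<close> the surface factor is at most
    \<Lambda>. The crowding constant makes the surface distance of two preimages less than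
    \<open>K / 8\<close>, so their images are closer than \<open>K / 4\<close>, against
    \<open>sepH\<close>.\<close>
  obtain i j where ij: "i < M" "j < M" "i \<noteq> j" "dist (z i) (z j) < 1 / (48 * \<Lambda>) * (6 * K)"
    using crowdedD[where z = z, OF M _ zb] K unfolding \<Lambda>_def by auto
  have "dX (\<Phi> (z i)) (\<Phi> (z j)) \<le> ennreal (\<Lambda> * dist (z i) (z j))"
  proof (rule X.intrinsic_dist_segment_le_const)
    have sub: "closed_segment (z i) (z j) \<subseteq> cball (of_real q2) (6 * K)"
      using zb ij by (intro closed_segment_subset) auto
    then show "closed_segment (z i) (z j) \<subseteq> D" using cb2 by auto
    fix y assume "y \<in> closed_segment (z i) (z j)"
    then have y: "dist (of_real q2) y \<le> 144 * N * p2" using sub by (auto simp: K_def)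
    have "\<bar>Im y\<bar> \<le> dist (of_real q2) y" using abs_Im_le_cmod[of "of_real q2 - y"] by (simp add: dist_norm)
    with y have "\<bar>Im y / p2\<bar> \<le> 144 * N" using p(2) by (simp add: field_simps)
    moreover have "\<bar>v y - Im y / p2\<bar> \<le> 1" using near2[OF y] by blast
    ultimately have "\<bar>v y\<bar> \<le> 144 * N + 1" by linarith
    then show "cosh (v y) \<le> \<Lambda>" unfolding \<Lambda>_def
      by (metis cosh_real_abs cosh_real_nonneg_le_iff abs_ge_zero order_trans)
  qed
  also have "\<dots> < ennreal (K / 8)"
  proof (rule ennreal_lessI)
    have "\<Lambda> * dist (z i) (z j) < \<Lambda> * (1 / (48 * \<Lambda>) * (6 * K))" by (rule mult_strict_left_mono[OF ij(4) \<Lambda>])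
    also have "\<dots> = K / 8" using \<Lambda> by simp
    finally show "\<Lambda> * dist (z i) (z j) < K / 8" .
  qed (use K in simp)
  finally have close: "dX (\<Phi> (z i)) (\<Phi> (z j)) < ennreal (K / 8)" .
  have "ennreal (K / 4) \<le> dH (\<Psi> (w i)) (\<Psi> (w j))" by (rule sepH[OF ij(3)])
  also have "\<dots> \<le> d\<Gamma> (f (\<Phi> (z i))) (f (\<Phi> (z j)))" using z(2) ij by (simp add: dH_le)
  also have "\<dots> \<le> 2 * dX (\<Phi> (z i)) (\<Phi> (z j))" using z(1) ij by (intro lip) auto
  also have "\<dots> < 2 * ennreal (K / 8)" using close by (intro ennreal_mult_strict_left_mono) auto
  also have "\<dots> = ennreal (K / 4)" using ennreal_mult'[of 2 "K / 8"] by simp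
  finally show False by simp
qed

end

section \<open>The helicoid as a conformal surface\<close>

definition space_vec :: "complex \<Rightarrow> real \<Rightarrow> real^3" where
  "space_vec w h = vector [Re w, Im w, h]"

lemma space_vec_nth [simp]:
  "space_vec w h $ 1 = Re w" "space_vec w h $ 2 = Im w" "space_vec w h $ 3 = h"
  by (simp_all add: space_vec_def)

lemma space_vec_eq_sum:
  "space_vec w h = Re w *\<^sub>R axis 1 1 + Im w *\<^sub>R axis 2 1 + h *\<^sub>R axis 3 1"
  by (simp add: vec_eq_iff forall_3 axis_def)

lemma space_vec_eq_iff: "space_vec w h = space_vec w' h' \<longleftrightarrow> w = w' \<and> h = h'"
  by (auto simp: vec_eq_iff forall_3 complex_eq_iff)

lemma inner_space_vec: "space_vec w h \<bullet> space_vec w' h' = w \<bullet> w' + h * h'"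
  by (simp add: inner_vec_def sum_3 inner_complex_def)

lemma norm_space_vec: "norm (space_vec w h) = sqrt ((cmod w)\<^sup>2 + h\<^sup>2)"
  unfolding norm_eq_sqrt_inner[of "space_vec w h"] inner_space_vec power2_norm_eq_inner
  by (simp add: power2_eq_square)

lemma has_derivative_space_vec:
  assumes "(W has_derivative W') F" "(h has_derivative h') F"
  shows "((\<lambda>z. space_vec (W z) (h z)) has_derivative (\<lambda>w. space_vec (W' w) (h' w))) F"
  unfolding space_vec_eq_sum by (intro derivative_intros assms bounded_linear.has_derivative[OF bounded_linear_Re]
      bounded_linear.has_derivative[OF bounded_linear_Im])

lemma continuous_on_space_vec:
  assumes "continuous_on S W" "continuous_on S h"
  shows "continuous_on S (\<lambda>z. space_vec (W z) (h z))"
  unfolding space_vec_eq_sum by (intro continuous_intros assms)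

lemma has_derivative_cis: "(cis has_derivative (\<lambda>h. h *\<^sub>R (\<i> * cis t))) (at t)"
proof -
  have "((\<lambda>z. exp (\<i> * z)) has_field_derivative \<i> * cis t) (at (of_real t))"
    by (auto intro!: derivative_eq_intros simp: cis_conv_exp)
  then have "((\<lambda>x. exp (\<i> * of_real x)) has_vector_derivative \<i> * cis t) (at t)"
    by (rule has_vector_derivative_real_field)
  then show ?thesis by (simp add: has_vector_derivative_def cis_conv_exp[abs_def])
qed

text \<open>The substitution t = sinh (Im z) in the ruled parametrization makes it conformal, with
  factor cosh (Im z).\<close>

definition helicoid_map :: "complex \<Rightarrow> real^3" where
  "helicoid_map z = space_vec (of_real (sinh (Im z)) * cis (Re z)) (Re z)"

definition helicoid_deriv :: "complex \<Rightarrow> complex \<Rightarrow> real^3" where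
  "helicoid_deriv z w =
     space_vec (cis (Re z) * Complex (cosh (Im z) * Im w) (sinh (Im z) * Re w)) (Re w)"

lemma standard_helicoid_eq: "standard_helicoid = range helicoid_map"
proof (intro equalityI subsetI)
  fix x assume "x \<in> standard_helicoid"
  then obtain t \<phi> where "x = vector [t * cos \<phi>, t * sin \<phi>, \<phi>]" by (auto simp: standard_helicoid_def)
  then have "x = helicoid_map (Complex \<phi> (arsinh t))"
    by (simp add: helicoid_map_def vec_eq_iff forall_3 sinh_arsinh_real)
  then show "x \<in> range helicoid_map" by blast
next
  fix x assume "x \<in> range helicoid_map"
  then obtain z where "x = helicoid_map z" by blast
  then have "x = vector [sinh (Im z) * cos (Re z), sinh (Im z) * sin (Re z), Re z]"
    by (simp add: helicoid_map_def vec_eq_iff forall_3)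
  then show "x \<in> standard_helicoid" unfolding standard_helicoid_def by blast
qed

lemma has_derivative_helicoid_map: "(helicoid_map has_derivative helicoid_deriv z) (at z)"
proof -
  have re: "(Re has_derivative Re) (at z)" by (rule bounded_linear_imp_has_derivative[OF bounded_linear_Re])
  have im: "(Im has_derivative Im) (at z)" by (rule bounded_linear_imp_has_derivative[OF bounded_linear_Im])
  have s: "((\<lambda>z. sinh (Im z)) has_derivative (\<lambda>w. cosh (Im z) * Im w)) (at z)"
  proof (rule has_derivative_compose[OF im])
    have "(sinh has_field_derivative cosh (Im z)) (at (Im z))" by (auto intro!: derivative_eq_intros)
    then show "(sinh has_derivative (*) (cosh (Im z))) (at (Im z))" by (simp add: has_field_derivative_def)
  qed
  have c: "((\<lambda>z. cis (Re z)) has_derivative (\<lambda>w. Re w *\<^sub>R (\<i> * cis (Re z)))) (at z)"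
    by (rule has_derivative_compose[OF re has_derivative_cis])
  have "((\<lambda>z. sinh (Im z) *\<^sub>R cis (Re z)) has_derivative
      (\<lambda>w. sinh (Im z) *\<^sub>R (Re w *\<^sub>R (\<i> * cis (Re z))) + (cosh (Im z) * Im w) *\<^sub>R cis (Re z))) (at z)"
    by (rule has_derivative_scaleR[OF s c])
  then have "((\<lambda>z. space_vec (sinh (Im z) *\<^sub>R cis (Re z)) (Re z)) has_derivative
      (\<lambda>w. space_vec (sinh (Im z) *\<^sub>R (Re w *\<^sub>R (\<i> * cis (Re z))) + (cosh (Im z) * Im w) *\<^sub>R cis (Re z)) (Re w))) (at z)"
    using re by (rule has_derivative_space_vec)
  moreover have "(\<lambda>w. space_vec (sinh (Im z) *\<^sub>R (Re w *\<^sub>R (\<i> * cis (Re z))) + (cosh (Im z) * Im w) *\<^sub>R cis (Re z)) (Re w))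
      = helicoid_deriv z"
    by (auto simp: helicoid_deriv_def fun_eq_iff vec_eq_iff forall_3 algebra_simps)
  moreover have "(\<lambda>z. space_vec (sinh (Im z) *\<^sub>R cis (Re z)) (Re z)) = helicoid_map"
    by (auto simp: helicoid_map_def scaleR_conv_of_real)
  ultimately show ?thesis by simp
qed

lemma norm_helicoid_deriv: "norm (helicoid_deriv z w) = cosh (Im z) * norm w"
proof -
  have "(cosh (Im z) * Im w)\<^sup>2 + (sinh (Im z) * Re w)\<^sup>2 + (Re w)\<^sup>2 = (cosh (Im z))\<^sup>2 * ((Re w)\<^sup>2 + (Im w)\<^sup>2)"
    by (simp add: sinh_square_eq algebra_simps power_mult_distrib)
  then show ?thesis
    by (simp add: helicoid_deriv_def norm_space_vec norm_mult cmod_power2 real_sqrt_mult cmod_def[of w])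
qed

lemma conformal_chart_helicoid:
  assumes c: "c > 0" and T: "orthogonal_transformation (T :: real^3 \<Rightarrow> real^3)"
  shows "conformal_chart (\<lambda>z. a + c *\<^sub>R T (helicoid_map z)) (\<lambda>z w. c *\<^sub>R T (helicoid_deriv z w))
     UNIV (\<lambda>z. c * cosh (Im z))"
proof -
  let ?\<Psi> = "\<lambda>z. a + c *\<^sub>R T (helicoid_map z)"
  have lin: "linear T" using T by (rule orthogonal_transformation_linear)
  then have bl: "bounded_linear T" by (simp add: linear_conv_bounded_linear)
  have injT: "inj T" using T by (rule orthogonal_transformation_inj)
  define U where "U = inv T"
  have UT: "U (T x) = x" for x using injT by (simp add: U_def)
  have "linear U" using T by (simp add: U_def orthogonal_transformation_inv orthogonal_transformation_linear)
  then have contU: "continuous_on S U" for S by (simp add: linear_continuous_on linear_conv_bounded_linear)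
  define y where "y = (\<lambda>p. U ((p - a) /\<^sub>R c))"
  have y: "y (?\<Psi> z) = helicoid_map z" for z using c by (simp add: y_def UT)
  \<comment> \<open>An explicit continuous inverse: the height gives the angle, rotating back by
    this angle leaves the signed distance from the axis, and arsinh recovers the imaginary
    part.\<close>
  define k where "k = (\<lambda>p. Complex (y p $ 3) (arsinh (cos (y p $ 3) * y p $ 1 + sin (y p $ 3) * y p $ 2)))"
  have k: "k (?\<Psi> z) = z" for z
  proof -
    have "cos (Re z) * (sinh (Im z) * cos (Re z)) + sin (Re z) * (sinh (Im z) * sin (Re z))
        = sinh (Im z) * ((cos (Re z))\<^sup>2 + (sin (Re z))\<^sup>2)"
      by (simp only: power2_eq_square distrib_left mult_ac)
    then show ?thesis unfolding k_def y
      by (simp add: helicoid_map_def arsinh_sinh_real complex_eq_iff)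
  qed
  have inj: "inj ?\<Psi>" using k by (rule inj_on_inverseI)
  have contk: "continuous_on S k" for S
  proof -
    have "continuous_on S y" unfolding y_def
      by (rule continuous_on_compose2[OF contU[of UNIV]]) (auto intro!: continuous_intros)
    then have yi: "continuous_on S (\<lambda>p. y p $ i)" for i by (intro continuous_intros)
    have "continuous_on UNIV (arsinh :: real \<Rightarrow> real)" by (intro continuous_intros)
    then have as: "continuous_on S (\<lambda>p. arsinh (cos (y p $ 3) * y p $ 1 + sin (y p $ 3) * y p $ 2))"
      by (rule continuous_on_compose2) (intro continuous_intros yi, simp)
    show ?thesis unfolding k_def Complex_eq by (intro continuous_intros yi as)
  qed
  show ?thesis
  proof
    show "inj_on ?\<Psi> UNIV" by (rule inj)
    have "continuous_on (range ?\<Psi>) (inv ?\<Psi>) \<longleftrightarrow> continuous_on (range ?\<Psi>) k"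
    proof (rule continuous_on_cong[OF refl])
      show "inv ?\<Psi> x = k x" if "x \<in> range ?\<Psi>" for x
        using that k inv_f_f[OF inj] by auto
    qed
    with contk show "continuous_on (range ?\<Psi>) (inv ?\<Psi>)" by blast
    show "(?\<Psi> has_derivative (\<lambda>w. c *\<^sub>R T (helicoid_deriv z w))) (at z)" for z
    proof -
      have "((\<lambda>z. T (helicoid_map z)) has_derivative (\<lambda>w. T (helicoid_deriv z w))) (at z)"
        by (rule bounded_linear.has_derivative[OF bl has_derivative_helicoid_map])
      then show ?thesis by (auto intro!: derivative_eq_intros)
    qed
    show "norm (c *\<^sub>R T (helicoid_deriv z w)) = c * cosh (Im z) * norm w" for z w
      using c T by (simp add: orthogonal_transformation_norm norm_helicoid_deriv)
    show "continuous_on UNIV (\<lambda>z. c *\<^sub>R T (helicoid_deriv z w))" for w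
    proof -
      have "continuous_on UNIV (\<lambda>z. helicoid_deriv z w)"
        unfolding helicoid_deriv_def by (intro continuous_on_space_vec continuous_intros)
      then have "continuous_on UNIV (\<lambda>z. T (helicoid_deriv z w))"
        by (rule bounded_linear.continuous_on[OF bl])
      then show ?thesis by (intro continuous_intros)
    qed
  qed (insert c, simp_all)
qed

lemma smooth_map_on_imp_continuous_on: "smooth_map_on X f \<Longrightarrow> continuous_on X f"
  unfolding continuous_on_eq_continuous_within
proof
  fix x assume f: "smooth_map_on X f" and x: "x \<in> X"
  then obtain V g where V: "x \<in> V" "smooth_on_open V g" "\<forall>z\<in>V \<inter> X. g z = f z"
    unfolding smooth_map_on_def by blast
  have o: "open V" and c: "continuous_on V g"
    using V(2) unfolding smooth_on_open_def by (auto dest!: spec[of _ 0])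
  have "continuous (at x) g" using o c V(1) by (simp add: continuous_on_eq_continuous_at)
  then have "(g \<longlongrightarrow> f x) (at x within X)"
    using V x by (auto simp: continuous_at dest: tendsto_within_subset)
  moreover have "eventually (\<lambda>z. g z = f z) (at x within X)"
    using o V unfolding eventually_at_topological by blast
  ultimately show "continuous (at x within X) f"
    unfolding continuous_within by (rule Lim_transform_eventually)
qed

lemma not_bilipschitz_to_helicoid_piece:
  fixes N M :: nat and p1 p2 q1 q2 :: real
  assumes chart: "conformal_chart \<Phi> \<Phi>' D (\<lambda>z. cosh (v z))"
    and N: "crowded N (1 / 5000)"
    and M: "crowded M (1 / (48 * cosh (144 * N + 1)))"
    and N5: "N \<ge> 5" and p: "p1 > 0" "p2 > 0" "M * p1 < p2"
    and near1: "\<And>z. dist (of_real q1) z \<le> 144 * N * p1 \<Longrightarrow> z \<in> D \<and> \<bar>v z - Im z / p1\<bar> \<le> 1"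
    and near2: "\<And>z. dist (of_real q2) z \<le> 144 * N * p2 \<Longrightarrow> z \<in> D \<and> \<bar>v z - Im z / p2\<bar> \<le> 1"
    and \<alpha>: "\<alpha> \<le> 2"
  shows "\<not> bilipschitz_to_helicoid_piece \<alpha> (\<Phi> ` D)"
proof
  assume "bilipschitz_to_helicoid_piece \<alpha> (\<Phi> ` D)"
  then obtain H \<Gamma> f where H: "helicoid H" "\<Gamma> \<subseteq> H" and f: "diffeomorphism_between (\<Phi> ` D) \<Gamma> f"
    and lip: "intrinsic_lipschitz_less \<alpha> (\<Phi> ` D) \<Gamma> f"
    and lip': "intrinsic_lipschitz_less \<alpha> \<Gamma> (\<Phi> ` D) (inv_into (\<Phi> ` D) f)"
    unfolding bilipschitz_to_helicoid_piece_def by blast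
  obtain a c T where T: "c > 0" "orthogonal_transformation T" "H = (\<lambda>x. a + c *\<^sub>R T x) ` standard_helicoid"
    using H(1) unfolding helicoid_def by blast
  have bij: "bij_betw f (\<Phi> ` D) \<Gamma>" using f by (simp add: diffeomorphism_between_def)
  have weaken: "d \<le> 2 * e" if "d \<le> ennreal L * e" "L < \<alpha>" for d e L
  proof -
    have "ennreal L \<le> 2" using that(2) \<alpha> ennreal_leI[of L 2] by simp
    then have "ennreal L * e \<le> 2 * e" by (rule mult_right_mono) simp
    with that(1) show ?thesis by (rule order_trans)
  qed
  interpret X: conformal_chart \<Phi> \<Phi>' D "\<lambda>z. cosh (v z)" by (rule chart)
  interpret H: conformal_chart "\<lambda>z. a + c *\<^sub>R T (helicoid_map z)" "\<lambda>z w. c *\<^sub>R T (helicoid_deriv z w)"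
     UNIV "\<lambda>z. c * cosh (Im z)" by (rule conformal_chart_helicoid[OF T(1,2)])
  interpret chart_map \<Phi> \<Phi>' D v "\<lambda>z. a + c *\<^sub>R T (helicoid_map z)" "\<lambda>z w. c *\<^sub>R T (helicoid_deriv z w)" c \<Gamma> f
  proof
    show "\<Gamma> \<subseteq> range (\<lambda>z. a + c *\<^sub>R T (helicoid_map z))"
      using H(2) T(3) by (auto simp: standard_helicoid_eq)
    show "continuous_on (\<Phi> ` D) f" "continuous_on \<Gamma> (inv_into (\<Phi> ` D) f)"
      using f by (auto simp: diffeomorphism_between_def intro: smooth_map_on_imp_continuous_on)
    show "intrinsic_dist \<Gamma> (f x) (f y) \<le> 2 * intrinsic_dist (\<Phi> ` D) x y"
      if xy: "x \<in> \<Phi> ` D" "y \<in> \<Phi> ` D" for x y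
    proof -
      obtain L where L: "L < \<alpha>" "\<forall>x\<in>\<Phi> ` D. \<forall>y\<in>\<Phi> ` D.
          intrinsic_dist \<Gamma> (f x) (f y) \<le> ennreal L * intrinsic_dist (\<Phi> ` D) x y"
        using lip unfolding intrinsic_lipschitz_less_def by auto
      show ?thesis by (rule weaken[OF _ L(1)]) (use L(2) xy in blast)
    qed
    show "intrinsic_dist (\<Phi> ` D) x y \<le> 2 * intrinsic_dist \<Gamma> (f x) (f y)"
      if xy: "x \<in> \<Phi> ` D" "y \<in> \<Phi> ` D" for x y
    proof -
      obtain L where L: "L < \<alpha>" "\<forall>x\<in>\<Gamma>. \<forall>y\<in>\<Gamma>.
          intrinsic_dist (\<Phi> ` D) (inv_into (\<Phi> ` D) f x) (inv_into (\<Phi> ` D) f y) \<le> ennreal L * intrinsic_dist \<Gamma> x y"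
        using lip' unfolding intrinsic_lipschitz_less_def by auto
      have inv: "inv_into (\<Phi> ` D) f (f x) = x" "inv_into (\<Phi> ` D) f (f y) = y" "f x \<in> \<Gamma>" "f y \<in> \<Gamma>"
        using bij xy by (auto simp: bij_betw_def)
      have "intrinsic_dist (\<Phi> ` D) x y \<le> ennreal L * intrinsic_dist \<Gamma> (f x) (f y)"
        using L(2)[rule_format, OF inv(3,4)] by (simp only: inv)
      then show ?thesis using L(1) by (rule weaken)
    qed
  qed (rule bij)
  show False by (rule no_two_pitches[OF N M N5 p near1 near2])
qed

section \<open>Calculus of smooth maps\<close>

lemma Ck_on_cong:
  assumes "open U" "\<And>x. x \<in> U \<Longrightarrow> f x = g x" "Ck_on k U f"
  shows "Ck_on k U g"
  using assms(2,3)
proof (induction k arbitrary: f g)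
  case 0
  then show ?case by (auto cong: continuous_on_cong)
next
  case (Suc k)
  have der: "(g has_derivative D) (at x) \<longleftrightarrow> (f has_derivative D) (at x)" if x: "x \<in> U" for x D
  proof
    assume "(g has_derivative D) (at x)"
    then show "(f has_derivative D) (at x)"
      by (rule has_derivative_transform_within_open[OF _ assms(1) x]) (simp add: Suc.prems(1))
  next
    assume "(f has_derivative D) (at x)"
    then show "(g has_derivative D) (at x)"
      by (rule has_derivative_transform_within_open[OF _ assms(1) x]) (simp add: Suc.prems(1))
  qed
  have "Ck_on k U (\<lambda>x. frechet_derivative g (at x) v)" for v
  proof (rule Suc.IH)
    show "Ck_on k U (\<lambda>x. frechet_derivative f (at x) v)" using Suc.prems(2) by simp
    show "frechet_derivative f (at x) v = frechet_derivative g (at x) v" if "x \<in> U" for x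
      unfolding frechet_derivative_def der[OF that] ..
  qed
  moreover have "g differentiable (at x)" if "x \<in> U" for x
    using Suc.prems(2) that der[OF that] by (auto simp: differentiable_def)
  ultimately show ?case by simp
qed

lemma Ck_on_SucI:
  assumes "open U" "\<And>x. x \<in> U \<Longrightarrow> (f has_derivative f' x) (at x)" "\<And>v. Ck_on k U (\<lambda>x. f' x v)"
  shows "Ck_on (Suc k) U f"
proof -
  have "Ck_on k U (\<lambda>x. frechet_derivative f (at x) v)" for v
  proof (rule Ck_on_cong[OF assms(1) _ assms(3)])
    show "f' x v = frechet_derivative f (at x) v" if "x \<in> U" for x
      using frechet_derivative_at[OF assms(2)[OF that]] by simp
  qed
  with assms(2) show ?thesis by (auto simp: differentiable_def)
qed

lemma Ck_on_has_derivative: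
  assumes "Ck_on (Suc k) U f" "x \<in> U"
  shows "(f has_derivative frechet_derivative f (at x)) (at x)"
  using assms frechet_derivative_works by auto

lemma Ck_on_frechet_derivative: "Ck_on (Suc k) U f \<Longrightarrow> Ck_on k U (\<lambda>x. frechet_derivative f (at x) v)"
  by simp

lemma Ck_on_Suc_imp: "Ck_on (Suc k) U f \<Longrightarrow> Ck_on k U f"
proof (induction k arbitrary: f)
  case 0
  then show ?case
    by (auto intro!: continuous_at_imp_continuous_on differentiable_imp_continuous_within)
qed auto

lemma Ck_on_subset: "Ck_on k U f \<Longrightarrow> V \<subseteq> U \<Longrightarrow> Ck_on k V f"
  by (induction k arbitrary: f) (auto elim: continuous_on_subset)

lemma Ck_on_const: "open U \<Longrightarrow> Ck_on k U (\<lambda>_. c)"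
proof (induction k arbitrary: c)
  case (Suc k)
  show ?case by (rule Ck_on_SucI[where f' = "\<lambda>_ _. 0"]) (use Suc in auto)
qed simp

lemma Ck_on_bounded_linear:
  assumes L: "bounded_linear L" and U: "open U" and f: "Ck_on k U f"
  shows "Ck_on k U (\<lambda>x. L (f x))"
  using f
proof (induction k arbitrary: f)
  case 0
  then show ?case by (simp add: bounded_linear.continuous_on[OF L])
next
  case (Suc k)
  show ?case
  proof (rule Ck_on_SucI[OF U])
    show "((\<lambda>x. L (f x)) has_derivative (\<lambda>v. L (frechet_derivative f (at x) v))) (at x)" if "x \<in> U" for x
      by (rule bounded_linear.has_derivative[OF L Ck_on_has_derivative[OF Suc.prems that]])
    show "Ck_on k U (\<lambda>x. L (frechet_derivative f (at x) v))" for v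
      by (rule Suc.IH) (use Suc.prems in simp)
  qed
qed

lemma Ck_on_linear: "bounded_linear L \<Longrightarrow> open U \<Longrightarrow> Ck_on k U L"
proof (cases k)
  case (Suc n)
  assume L: "bounded_linear L" and U: "open U"
  show ?thesis unfolding Suc
    by (rule Ck_on_SucI[OF U bounded_linear_imp_has_derivative[OF L] Ck_on_const[OF U]])
qed (simp add: linear_continuous_on)

lemma Ck_on_add:
  assumes U: "open U"
  shows "Ck_on k U f \<Longrightarrow> Ck_on k U g \<Longrightarrow> Ck_on k U (\<lambda>x. f x + g x)"
proof (induction k arbitrary: f g)
  case (Suc k)
  show ?case
  proof (rule Ck_on_SucI[OF U])
    show "((\<lambda>x. f x + g x) has_derivative
        (\<lambda>v. frechet_derivative f (at x) v + frechet_derivative g (at x) v)) (at x)" if "x \<in> U" for x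
      by (intro has_derivative_add Ck_on_has_derivative[OF Suc.prems(1) that] Ck_on_has_derivative[OF Suc.prems(2) that])
    show "Ck_on k U (\<lambda>x. frechet_derivative f (at x) v + frechet_derivative g (at x) v)" for v
      by (rule Suc.IH) (use Suc.prems in simp_all)
  qed
qed (auto intro: continuous_on_add)

lemma Ck_on_sum:
  assumes "open U" "finite I" "\<And>i. i \<in> I \<Longrightarrow> Ck_on k U (f i)"
  shows "Ck_on k U (\<lambda>x. \<Sum>i\<in>I. f i x)"
  using assms(2,3) by (induction I) (auto intro: Ck_on_const Ck_on_add assms(1))

lemma Ck_on_bounded_bilinear:
  assumes P: "bounded_bilinear P" and U: "open U"
  shows "Ck_on k U f \<Longrightarrow> Ck_on k U g \<Longrightarrow> Ck_on k U (\<lambda>x. P (f x) (g x))"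
proof (induction k arbitrary: f g)
  case 0
  then show ?case by (auto intro: bounded_bilinear.continuous_on[OF P])
next
  case (Suc k)
  show ?case
  proof (rule Ck_on_SucI[OF U])
    show "((\<lambda>x. P (f x) (g x)) has_derivative
        (\<lambda>v. P (f x) (frechet_derivative g (at x) v) + P (frechet_derivative f (at x) v) (g x))) (at x)"
      if "x \<in> U" for x
      by (intro bounded_bilinear.FDERIV[OF P] Ck_on_has_derivative[OF Suc.prems(1) that] Ck_on_has_derivative[OF Suc.prems(2) that])
    show "Ck_on k U (\<lambda>x. P (f x) (frechet_derivative g (at x) v) + P (frechet_derivative f (at x) v) (g x))" for v
      by (intro Ck_on_add[OF U] Suc.IH Ck_on_frechet_derivative Suc.prems Ck_on_Suc_imp)
  qed
qed

lemmas Ck_on_mult = Ck_on_bounded_bilinear[OF bounded_bilinear_mult]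
lemmas Ck_on_scaleR = Ck_on_bounded_bilinear[OF bounded_bilinear_scaleR]

text \<open>The chain rule puts a moving direction into the derivative of f, whereas the induction
  hypothesis speaks of a fixed one. Expanding the direction in a basis leaves products of functions
  to which it applies.\<close>

lemma Ck_on_compose:
  assumes U: "open U" and V: "open V"
  shows "Ck_on k V f \<Longrightarrow> Ck_on k U g \<Longrightarrow> g ` U \<subseteq> V \<Longrightarrow> Ck_on k U (\<lambda>x. f (g x))"
proof (induction k arbitrary: f g)
  case 0
  then show ?case by (auto intro: continuous_on_compose2)
next
  case (Suc k)
  show ?case
  proof (rule Ck_on_SucI[OF U])
    fix x assume x: "x \<in> U"
    have f: "(f has_derivative frechet_derivative f (at (g x))) (at (g x))"
      using Suc.prems x by (intro Ck_on_has_derivative) auto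
    have "((\<lambda>x. f (g x)) has_derivative (\<lambda>v. frechet_derivative f (at (g x)) (frechet_derivative g (at x) v))) (at x)"
      by (rule has_derivative_compose[OF Ck_on_has_derivative[OF Suc.prems(2) x] f])
    moreover have "frechet_derivative f (at (g x)) w
        = (\<Sum>b\<in>Basis. (w \<bullet> b) *\<^sub>R frechet_derivative f (at (g x)) b)" for w
    proof -
      have "linear (frechet_derivative f (at (g x)))" using f by (rule has_derivative_linear)
      then show ?thesis by (subst euclidean_representation[of w, symmetric]) (simp add: linear_sum linear_scale)
    qed
    ultimately show "((\<lambda>x. f (g x)) has_derivative (\<lambda>v. \<Sum>b\<in>Basis. (frechet_derivative g (at x) v \<bullet> b) *\<^sub>R
        frechet_derivative f (at (g x)) b)) (at x)" by (rule has_derivative_eq_rhs[OF _ ext])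
  next
    fix v
    show "Ck_on k U (\<lambda>x. \<Sum>b\<in>Basis. (frechet_derivative g (at x) v \<bullet> b) *\<^sub>R frechet_derivative f (at (g x)) b)"
    proof (intro Ck_on_sum U finite_Basis Ck_on_scaleR)
      fix b
      show "Ck_on k U (\<lambda>x. frechet_derivative g (at x) v \<bullet> b)"
        by (rule Ck_on_bounded_linear[OF bounded_linear_inner_left U]) (use Suc.prems in simp)
      show "Ck_on k U (\<lambda>x. frechet_derivative f (at (g x)) b)"
        by (rule Suc.IH[OF Ck_on_frechet_derivative[OF Suc.prems(1)] Ck_on_Suc_imp[OF Suc.prems(2)] Suc.prems(3)])
    qed
  qed
qed

text \<open>The induction has to vary the exponent, which differentiation lowers by one. The
  exponents used later are -1 and 1/2, for reciprocals and square roots.\<close>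

lemma Ck_on_powr:
  fixes f :: "'a::euclidean_space \<Rightarrow> real"
  assumes U: "open U" and pos: "\<And>x. x \<in> U \<Longrightarrow> f x > 0" and f: "\<And>k. Ck_on k U f"
  shows "Ck_on k U (\<lambda>x. f x powr a)"
proof (induction k arbitrary: a)
  case 0
  have "continuous_on U f" using f[of 0] by simp
  then show ?case using pos by (auto intro!: continuous_on_powr simp: less_imp_neq[symmetric])
next
  case (Suc k)
  show ?case
  proof (rule Ck_on_SucI[OF U])
    fix x assume x: "x \<in> U"
    have "((\<lambda>y. y powr a) has_derivative (*) (a * f x powr (a - 1))) (at (f x))"
      using has_real_derivative_powr[OF pos[OF x]] by (simp add: has_field_derivative_def)
    from has_derivative_compose[OF Ck_on_has_derivative[OF f x] this]
    show "((\<lambda>x. f x powr a) has_derivative (\<lambda>v. a * f x powr (a - 1) * frechet_derivative f (at x) v)) (at x)" .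
  next
    show "Ck_on k U (\<lambda>x. a * f x powr (a - 1) * frechet_derivative f (at x) v)" for v
      by (intro Ck_on_mult[OF U] Suc.IH Ck_on_const[OF U] Ck_on_frechet_derivative f)
  qed
qed

text \<open>Hadamard's quotient: applied to \<open>deriv f\<close> with n = 0, this integral is the
  difference \<open>f z - f (cnj z)\<close> divided by \<open>\<i> * Im z\<close>, in a form that
  makes sense and is smooth on the real axis. The powers of t close the family under
  differentiation.\<close>

definition vertical_moment :: "nat \<Rightarrow> (complex \<Rightarrow> complex) \<Rightarrow> complex \<Rightarrow> complex" where
  "vertical_moment n f z = integral (cbox (-1) 1) (\<lambda>t. of_real (t ^ n) * f (Complex (Re z) (t * Im z)))"

lemma has_derivative_vertical_moment:
  assumes f: "f holomorphic_on UNIV"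
  shows "(vertical_moment n f has_derivative (\<lambda>w. Re w *\<^sub>R vertical_moment n (deriv f) z
     + Im w *\<^sub>R (\<i> * vertical_moment (Suc n) (deriv f) z))) (at z)"
proof -
  have f': "deriv f holomorphic_on UNIV" using f by (intro holomorphic_deriv) auto
  have contf: "continuous_on S f" and contf': "continuous_on S (deriv f)" for S
    using holomorphic_on_imp_continuous_on[OF f] holomorphic_on_imp_continuous_on[OF f']
    by (auto elim: continuous_on_subset)
  have cont: "continuous_on S (\<lambda>p. k (Complex (Re (a p)) (b p * Im (a p))))"
    if "continuous_on UNIV k" "continuous_on S a" "continuous_on S b"
    for S :: "'q::topological_space set" and a b and k :: "complex \<Rightarrow> complex"
    unfolding Complex_eq
    by (rule continuous_on_compose2[OF that(1)]) (intro continuous_intros that, simp)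
  have int: "(\<lambda>t. of_real (t ^ m) * k (Complex (Re z) (t * Im z))) integrable_on cbox (-1) 1"
    if "continuous_on UNIV k" for m z and k :: "complex \<Rightarrow> complex"
    by (intro integrable_continuous continuous_intros cont that)
  \<comment> \<open>The derivative of the integrand is written with values in the space of bounded
    linear maps, as the Leibniz rule requires; \<open>A + t *\<^sub>R B\<close> is the differential
    of the point \<open>Complex (Re z) (t * Im z)\<close>.\<close>
  define A where "A = Blinfun (\<lambda>w. complex_of_real (Re w))"
  define B where "B = Blinfun (\<lambda>w. \<i> * complex_of_real (Im w))"
  have A: "blinfun_apply A w = Re w" for w
    unfolding A_def by (subst bounded_linear_Blinfun_apply)
      (auto intro!: bounded_linear_compose[OF bounded_linear_of_real bounded_linear_Re])
  have B: "blinfun_apply B w = \<i> * Im w" for w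
    unfolding B_def by (subst bounded_linear_Blinfun_apply)
      (auto intro!: bounded_linear_compose[OF bounded_linear_mult_right]
        bounded_linear_compose[OF bounded_linear_of_real bounded_linear_Im])
  define F where "F = (\<lambda>z t. blinfun_compose
      (blinfun_mult_left (of_real (t ^ n) * deriv f (Complex (Re z) (t * Im z)))) (A + t *\<^sub>R B))"
  have F: "blinfun_apply (F z t) w = of_real (t ^ n) * deriv f (Complex (Re z) (t * Im z)) * (Re w + \<i> * (t * Im w))" for z t w
    by (simp add: F_def A B blinfun.add_left blinfun.scaleR_left scaleR_conv_of_real algebra_simps)
  have "((\<lambda>z. integral (cbox (-1) 1) (\<lambda>t. of_real (t ^ n) * f (Complex (Re z) (t * Im z))))
      has_derivative integral (cbox (-1) 1) (F z)) (at z within UNIV)"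
  proof (rule leibniz_rule)
    fix z and t :: real
    have "((\<lambda>z. complex_of_real (Re z) + \<i> * of_real (t * Im z)) has_derivative (\<lambda>w. Re w + \<i> * of_real (t * Im w))) (at z)"
      by (auto intro!: derivative_eq_intros simp: fun_eq_iff)
    then have "((\<lambda>z. Complex (Re z) (t * Im z)) has_derivative (\<lambda>w. Re w + \<i> * of_real (t * Im w))) (at z)"
      by (simp add: Complex_eq)
    moreover have "(f has_derivative (*) (deriv f (Complex (Re z) (t * Im z)))) (at (Complex (Re z) (t * Im z)))"
      using holomorphic_derivI[OF f open_UNIV] by (simp add: has_field_derivative_def)
    ultimately have "((\<lambda>z. f (Complex (Re z) (t * Im z))) has_derivative
       (\<lambda>w. deriv f (Complex (Re z) (t * Im z)) * (Re w + \<i> * of_real (t * Im w)))) (at z)"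
      by (rule has_derivative_compose)
    then have "((\<lambda>z. of_real (t ^ n) * f (Complex (Re z) (t * Im z))) has_derivative
       (\<lambda>w. of_real (t ^ n) * (deriv f (Complex (Re z) (t * Im z)) * (Re w + \<i> * of_real (t * Im w))))) (at z)"
      by (rule has_derivative_mult_right)
    then show "((\<lambda>z. of_real (t ^ n) * f (Complex (Re z) (t * Im z))) has_derivative blinfun_apply (F z t)) (at z within UNIV)"
      unfolding F[abs_def] by (simp add: mult.assoc)
  next
    show "(\<lambda>t. of_real (t ^ n) * f (Complex (Re z) (t * Im z))) integrable_on cbox (-1) 1" for z
      by (rule int[OF contf])
    have "continuous_on (UNIV \<times> cbox (-1) 1) (\<lambda>p. F (fst p) (snd p))"
      unfolding F_def
      by (intro bounded_bilinear.continuous_on[OF bounded_bilinear_blinfun_compose]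
          bounded_linear.continuous_on[OF bounded_linear_blinfun_mult_left] continuous_intros cont contf')
    then show "continuous_on (UNIV \<times> cbox (-1) 1) (\<lambda>(z, t). F z t)" by (simp add: case_prod_beta)
  qed auto
  moreover have "blinfun_apply (integral (cbox (-1) 1) (F z)) w = Re w *\<^sub>R vertical_moment n (deriv f) z
     + Im w *\<^sub>R (\<i> * vertical_moment (Suc n) (deriv f) z)" for w
  proof -
    have "continuous_on (cbox (-1) 1) (F z)"
      unfolding F_def
      by (intro bounded_bilinear.continuous_on[OF bounded_bilinear_blinfun_compose]
          bounded_linear.continuous_on[OF bounded_linear_blinfun_mult_left] continuous_intros cont contf')
    then have "F z integrable_on cbox (-1) 1" by (rule integrable_continuous)
    then have "blinfun_apply (integral (cbox (-1) 1) (F z)) w = integral (cbox (-1) 1) (\<lambda>t. blinfun_apply (F z t) w)"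
      by (rule blinfun_apply_integral)
    also have "\<dots> = integral (cbox (-1) 1) (\<lambda>t. Re w *\<^sub>R (of_real (t ^ n) * deriv f (Complex (Re z) (t * Im z)))
        + Im w *\<^sub>R (\<i> * (of_real (t ^ Suc n) * deriv f (Complex (Re z) (t * Im z)))))"
      by (intro integral_cong) (simp add: F scaleR_conv_of_real algebra_simps)
    also have "\<dots> = Re w *\<^sub>R vertical_moment n (deriv f) z + Im w *\<^sub>R (\<i> * vertical_moment (Suc n) (deriv f) z)"
      unfolding vertical_moment_def
      by (subst integral_add) (intro integrable_cmul integrable_on_mult_right int contf', intro integrable_cmul integrable_on_mult_right int contf', simp)
    finally show ?thesis .
  qed
  ultimately show ?thesis unfolding vertical_moment_def[of n f, abs_def]
    by (rule has_derivative_eq_rhs[OF _ ext])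
qed

lemma Ck_on_vertical_moment: "f holomorphic_on UNIV \<Longrightarrow> Ck_on k UNIV (vertical_moment n f)"
proof (induction k arbitrary: f n)
  case 0
  have "continuous (at z) (vertical_moment n f)" for z
    using has_derivative_vertical_moment[OF 0] has_derivative_continuous by blast
  then show ?case by (simp add: continuous_at_imp_continuous_on)
next
  case (Suc k)
  have f': "deriv f holomorphic_on UNIV" using Suc.prems by (intro holomorphic_deriv) auto
  show ?case
    by (rule Ck_on_SucI[OF open_UNIV has_derivative_vertical_moment[OF Suc.prems]])
       (intro Ck_on_add Ck_on_scaleR Ck_on_const Ck_on_mult Suc.IH f' open_UNIV)
qed

text \<open>The fundamental theorem of calculus along the vertical segment from \<open>cnj z\<close>
  to \<open>z\<close>.\<close>

lemma vertical_moment_deriv: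
  assumes f: "f holomorphic_on UNIV"
  shows "\<i> * Im z * vertical_moment 0 (deriv f) z = f z - f (cnj z)"
proof -
  have "((\<lambda>t. \<i> * Im z * deriv f (Complex (Re z) (t * Im z))) has_integral
      f (Complex (Re z) (1 * Im z)) - f (Complex (Re z) ((-1) * Im z))) {-1..1}"
  proof (rule fundamental_theorem_of_calculus)
    fix t :: real
    have "((\<lambda>t. complex_of_real (Re z) + \<i> * of_real (t * Im z)) has_vector_derivative \<i> * Im z) (at t within {-1..1})"
      by (auto intro!: derivative_eq_intros)
    then have "((\<lambda>t. Complex (Re z) (t * Im z)) has_vector_derivative \<i> * Im z) (at t within {-1..1})"
      by (simp add: Complex_eq)
    moreover have "(f has_field_derivative deriv f (Complex (Re z) (t * Im z))) (at (Complex (Re z) (t * Im z)) within (\<lambda>t. Complex (Re z) (t * Im z)) ` {-1..1})"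
      using holomorphic_derivI[OF f open_UNIV] by (simp add: has_field_derivative_at_within)
    ultimately have "(f \<circ> (\<lambda>t. Complex (Re z) (t * Im z)) has_vector_derivative
        (\<i> * Im z) * deriv f (Complex (Re z) (t * Im z))) (at t within {-1..1})"
      by (rule field_vector_diff_chain_within)
    then show "((\<lambda>t. f (Complex (Re z) (t * Im z))) has_vector_derivative \<i> * Im z * deriv f (Complex (Re z) (t * Im z))) (at t within {-1..1})"
      by (simp add: o_def)
  qed simp
  moreover have "Complex (Re z) (1 * Im z) = z" "Complex (Re z) ((-1) * Im z) = cnj z"
    by (simp_all add: complex_eq_iff)
  ultimately have "integral {-1..1} (\<lambda>t. \<i> * Im z * deriv f (Complex (Re z) (t * Im z))) = f z - f (cnj z)"
    by (metis integral_unique)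
  then show ?thesis by (simp add: vertical_moment_def)
qed

text \<open>G preserves vertical lines, so its Jacobian is s2 and the inverse derivative is
  explicit. Injectivity makes the inverse global and invariance of domain makes its domain open.
  Smoothness bootstraps: the derivative of the inverse is built from s1 and s2 composed with the
  inverse, so each order of regularity yields the next.\<close>

lemma fibred_inverse:
  fixes \<sigma> s1 s2 :: "complex \<Rightarrow> real" and U
  defines "G \<equiv> \<lambda>z. Complex (Re z) (\<sigma> z)"
  assumes U: "open U" and inj: "inj_on G U"
    and der: "\<And>z. z \<in> U \<Longrightarrow> (\<sigma> has_derivative (\<lambda>w. Re w * s1 z + Im w * s2 z)) (at z)"
    and s: "\<And>k. Ck_on k U s1" "\<And>k. Ck_on k U s2" and pos: "\<And>z. z \<in> U \<Longrightarrow> s2 z > 0"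
  shows "open (G ` U)"
    and "p \<in> G ` U \<Longrightarrow> (inv_into U G has_derivative (\<lambda>w. Complex (Re w)
        ((Im w - s1 (inv_into U G p) * Re w) / s2 (inv_into U G p)))) (at p)"
    and "Ck_on k (G ` U) (inv_into U G)"
proof -
  define \<psi> where "\<psi> = inv_into U G"
  have \<psi>G: "\<psi> (G z) = z" if "z \<in> U" for z using inj that by (simp add: \<psi>_def)
  have \<psi>U: "\<psi> p \<in> U" "G (\<psi> p) = p" if "p \<in> G ` U" for p
    using that by (auto simp: \<psi>_def inv_into_into f_inv_into_f)
  have derG: "(G has_derivative (\<lambda>w. Complex (Re w) (Re w * s1 z + Im w * s2 z))) (at z)" if "z \<in> U" for z
  proof -
    have "((\<lambda>z. complex_of_real (Re z) + \<i> * of_real (\<sigma> z)) has_derivative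
        (\<lambda>w. of_real (Re w) + \<i> * of_real (Re w * s1 z + Im w * s2 z))) (at z)"
      by (intro derivative_intros bounded_linear.has_derivative[OF bounded_linear_Re]
          bounded_linear.has_derivative[OF bounded_linear_of_real] der that)
    then show ?thesis by (simp add: G_def Complex_eq)
  qed
  have contG: "continuous_on U G"
    using derG has_derivative_continuous continuous_at_imp_continuous_on by blast
  show op: "open (G ` U)" by (rule invariance_of_domain[OF contG U inj])
  have der\<psi>: "(\<psi> has_derivative (\<lambda>w. Complex (Re w) ((Im w - s1 (\<psi> p) * Re w) / s2 (\<psi> p)))) (at p)"
    if p: "p \<in> G ` U" for p
  proof (rule has_derivative_inverse_strong_x[OF U \<psi>U(1)[OF p] contG \<psi>G derG[OF \<psi>U(1)[OF p]] _ \<psi>U(2)[OF p]])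
    show "(\<lambda>w. Complex (Re w) (Re w * s1 (\<psi> p) + Im w * s2 (\<psi> p))) \<circ>
      (\<lambda>w. Complex (Re w) ((Im w - s1 (\<psi> p) * Re w) / s2 (\<psi> p))) = id"
      using pos[OF \<psi>U(1)[OF p]] by (auto simp: fun_eq_iff complex_eq_iff)
  qed
  then show "p \<in> G ` U \<Longrightarrow> (inv_into U G has_derivative (\<lambda>w. Complex (Re w)
        ((Im w - s1 (inv_into U G p) * Re w) / s2 (inv_into U G p)))) (at p)"
    unfolding \<psi>_def by blast
  have "Ck_on k (G ` U) \<psi>"
  proof (induction k)
    case 0
    have "continuous_on (G ` U) \<psi>"
      by (intro continuous_at_imp_continuous_on ballI has_derivative_continuous[OF der\<psi>])
    then show ?case by simp
  next
    case (Suc k)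
    have sub: "\<psi> ` (G ` U) \<subseteq> U" using \<psi>U by blast
    have c1: "Ck_on k (G ` U) (\<lambda>p. s1 (\<psi> p))" by (rule Ck_on_compose[OF op U s(1) Suc sub])
    have c2: "Ck_on k (G ` U) (\<lambda>p. s2 (\<psi> p) powr (-1))"
      by (rule Ck_on_compose[OF op U Ck_on_powr[OF U pos s(2)] Suc sub])
    show ?case
    proof (rule Ck_on_SucI[OF op der\<psi>])
      fix w
      have "Ck_on k (G ` U) (\<lambda>p. Re w *\<^sub>R 1 + ((Im w + (- Re w) * s1 (\<psi> p)) * s2 (\<psi> p) powr (-1)) *\<^sub>R \<i>)"
        by (intro Ck_on_add Ck_on_scaleR Ck_on_mult Ck_on_const op c1 c2)
      then show "Ck_on k (G ` U) (\<lambda>p. Complex (Re w) ((Im w - s1 (\<psi> p) * Re w) / s2 (\<psi> p)))"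
      proof (rule Ck_on_cong[OF op, rotated])
        fix p assume "p \<in> G ` U"
        then have "s2 (\<psi> p) > 0" using pos \<psi>U by blast
        then show "Re w *\<^sub>R 1 + ((Im w + (- Re w) * s1 (\<psi> p)) * s2 (\<psi> p) powr (-1)) *\<^sub>R \<i>
            = Complex (Re w) ((Im w - s1 (\<psi> p) * Re w) / s2 (\<psi> p))"
          by (simp add: complex_eq_iff powr_minus divide_inverse mult.commute)
      qed
    qed
  qed
  then show "Ck_on k (G ` U) (inv_into U G)" by (simp add: \<psi>_def)
qed

section \<open>A helicoid with modulated pitch\<close>

lemma cosh_le_one_plus_square:
  assumes "\<bar>y::real\<bar> \<le> 1"
  shows "cosh y \<le> 1 + y\<^sup>2"
proof -
  have c2: "cosh t \<le> 2" if "0 \<le> t" "t \<le> 1" for t :: real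
  proof -
    have "cosh t \<le> cosh 1" using that by (simp add: cosh_real_nonneg_le_iff)
    also have "\<dots> \<le> 2" by (rule cosh_one_le)
    finally show ?thesis .
  qed
  have s: "sinh t \<le> 2 * t" if "0 \<le> t" "t \<le> 1" for t :: real
  proof -
    have "2 * 0 - sinh 0 \<le> 2 * t - sinh t"
    proof (rule DERIV_nonneg_imp_nondecreasing[OF that(1)])
      fix x :: real assume "0 \<le> x" "x \<le> t"
      then show "\<exists>d. ((\<lambda>t. 2 * t - sinh t) has_real_derivative d) (at x) \<and> 0 \<le> d"
        using c2[of x] that by (intro exI[of _ "2 - cosh x"]) (auto intro!: derivative_eq_intros)
    qed
    then show ?thesis by simp
  qed
  have main: "cosh t \<le> 1 + t\<^sup>2" if "0 \<le> t" "t \<le> 1" for t :: real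
  proof -
    have "1 + 0\<^sup>2 - cosh 0 \<le> 1 + t\<^sup>2 - cosh t"
    proof (rule DERIV_nonneg_imp_nondecreasing[OF that(1)])
      fix x :: real assume "0 \<le> x" "x \<le> t"
      then show "\<exists>d. ((\<lambda>t. 1 + t\<^sup>2 - cosh t) has_real_derivative d) (at x) \<and> 0 \<le> d"
        using s[of x] that by (intro exI[of _ "2 * x - sinh x"]) (auto intro!: derivative_eq_intros)
    qed
    then show ?thesis by simp
  qed
  show ?thesis using main[of "\<bar>y\<bar>"] assms by simp
qed

lemma sinh_le_cubic:
  assumes "0 \<le> y" "y \<le> (1::real)"
  shows "sinh y \<le> y + y ^ 3"
proof -
  have "0 + 0 ^ 3 - sinh 0 \<le> y + y ^ 3 - sinh y"
  proof (rule DERIV_nonneg_imp_nondecreasing[OF assms(1)])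
    fix x :: real assume x: "0 \<le> x" "x \<le> y"
    have "0 \<le> 1 + 3 * x\<^sup>2 - cosh x"
    proof -
      have "\<bar>x\<bar> \<le> 1" using x assms by simp
      from cosh_le_one_plus_square[OF this] zero_le_power2[of x] show ?thesis by linarith
    qed
    then show "\<exists>d. ((\<lambda>t. t + t ^ 3 - sinh t) has_real_derivative d) (at x) \<and> 0 \<le> d"
      by (intro exI[of _ "1 + 3 * x\<^sup>2 - cosh x"]) (auto intro!: derivative_eq_intros)
  qed
  then show ?thesis by simp
qed

lemma half_le_cos:
  assumes "\<bar>x::real\<bar> \<le> 1"
  shows "1 / 2 \<le> cos x"
proof -
  have "(sin (x / 2))\<^sup>2 \<le> (1 / 2)\<^sup>2"
    using abs_sin_x_le_abs_x[of "x / 2"] assms by (intro power2_le_iff_abs_le[THEN iffD2]) auto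
  moreover have "cos x = 1 - 2 * (sin (x / 2))\<^sup>2" using cos_double_sin[of "x / 2"] by simp
  ultimately show ?thesis by (simp add: power2_eq_square)
qed

lemma inner_cis_mult: "(cis t * a) \<bullet> (cis t * b) = a \<bullet> b"
proof -
  have "(cis t * a) \<bullet> (cis t * b) = ((cos t)\<^sup>2 + (sin t)\<^sup>2) * (a \<bullet> b)"
    unfolding inner_complex_def times_complex.sel cis.sel inner_real_def power2_eq_square
    by (simp only: algebra_simps)
  then show ?thesis by simp
qed

text \<open>On the real axis h' takes values between \<open>B * \<mu>\<close> and
  \<open>B * (2 + \<mu>)\<close>, the reciprocals of the extreme pitches. The condition on
  \<open>B * \<mu>\<close> keeps the strip narrow enough for the slowest rotation
  (\<open>v_lower\<close>).\<close>

locale modulated_helicoid =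
  fixes B \<mu> :: real and Q :: "complex \<Rightarrow> complex"
  assumes \<mu>: "0 < \<mu>" "\<mu> \<le> 1" and B\<mu>: "1 \<le> B * \<mu>"
    and Q: "(Q has_field_derivative exp (\<i> * (of_real B * (of_real (1 + \<mu>) * z + sin z)))) (at z)"
begin

definition h :: "complex \<Rightarrow> complex" where "h z = of_real B * (of_real (1 + \<mu>) * z + sin z)"
definition h' :: "complex \<Rightarrow> complex" where "h' z = of_real B * (of_real (1 + \<mu>) + cos z)"
definition u :: "complex \<Rightarrow> real" where "u z = Re (h z)"
definition v :: "complex \<Rightarrow> real" where "v z = Im (h z)"
definition W :: "complex \<Rightarrow> complex" where "W z = (Q (cnj z) - Q z) / 2"
definition W' :: "complex \<Rightarrow> complex \<Rightarrow> complex" where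
  "W' z w = cis (u z) * Complex (sinh (v z) * Re w) (- cosh (v z) * Im w)"
definition \<Phi> :: "complex \<Rightarrow> real^3" where "\<Phi> z = space_vec (W z) (Re z)"
definition \<Phi>' :: "complex \<Rightarrow> complex \<Rightarrow> real^3" where "\<Phi>' z w = space_vec (W' z w) (Re w)"

text \<open>\<open>\<Phi>\<close> is the Weierstrass immersion with $g = e^{ih}$: its horizontal part is half the difference of
  the conjugate of $\int e^{-ih}$ and $\int e^{ih}$, and the former is \<open>Q (cnj z)\<close> because $h$ is real on
  the real axis.\<close>

lemma B: "B \<ge> 1"
proof -
  have "B > 0" using B\<mu> \<mu> by (metis less_le_trans zero_less_mult_pos2 zero_less_one)
  then have "B * \<mu> \<le> B * 1" using \<mu> by (intro mult_left_mono) auto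
  then show ?thesis using B\<mu> by simp
qed

lemma u_eq: "u z = B * ((1 + \<mu>) * Re z + sin (Re z) * cosh (Im z))"
  by (simp add: u_def h_def Re_sin cosh_def)

lemma v_eq: "v z = B * ((1 + \<mu>) * Im z + cos (Re z) * sinh (Im z))"
  by (simp add: v_def h_def Im_sin sinh_def)

lemma u_cnj: "u (cnj z) = u z" and v_cnj: "v (cnj z) = - v z"
  by (simp_all add: u_eq v_eq algebra_simps)

lemma h_deriv: "(h has_field_derivative h' z) (at z)"
  unfolding h_def h'_def by (auto intro!: derivative_eq_intros)

lemma exp_ih: "exp (\<i> * h z) = of_real (exp (- v z)) * cis (u z)"
  by (simp add: exp_eq_polar u_def v_def)

lemma Q_deriv: "(Q has_field_derivative exp (\<i> * h z)) (at z)"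
  using Q by (simp add: h_def)

lemma Q_holomorphic: "Q holomorphic_on UNIV"
  using Q_deriv field_differentiable_at_within field_differentiable_def by (intro holomorphic_onI) blast

lemma deriv_Q: "deriv Q z = exp (\<i> * h z)"
  using Q_deriv by (rule DERIV_imp_deriv)

lemma has_derivative_W: "(W has_derivative W' z) (at z)"
proof -
  have "(Q has_derivative (*) (exp (\<i> * h (cnj z)))) (at (cnj z))" "(Q has_derivative (*) (exp (\<i> * h z))) (at z)"
    using Q_deriv by (simp_all add: has_field_derivative_def)
  moreover have "(cnj has_derivative cnj) (at z)"
    by (rule bounded_linear_imp_has_derivative[OF bounded_linear_cnj])
  ultimately have "((\<lambda>z. Q (cnj z) - Q z) has_derivative
      (\<lambda>w. exp (\<i> * h (cnj z)) * cnj w - exp (\<i> * h z) * w)) (at z)"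
    using has_derivative_diff[OF has_derivative_compose[of cnj cnj z UNIV Q]] by blast
  then have "((\<lambda>z. (Q (cnj z) - Q z) / 2) has_derivative
      (\<lambda>w. (exp (\<i> * h (cnj z)) * cnj w - exp (\<i> * h z) * w) / 2)) (at z)"
    by (rule bounded_linear.has_derivative[OF bounded_linear_divide])
  then have "(W has_derivative (\<lambda>w. (exp (\<i> * h (cnj z)) * cnj w - exp (\<i> * h z) * w) / 2)) (at z)"
    unfolding W_def[abs_def] .
  then show ?thesis
  proof (rule has_derivative_eq_rhs, intro ext)
    fix w
    have "(exp (\<i> * h (cnj z)) * cnj w - exp (\<i> * h z) * w) / 2 =
        cis (u z) * ((of_real (exp (v z)) * cnj w - of_real (exp (- v z)) * w) / 2)"
      unfolding exp_ih u_cnj v_cnj minus_minus by (simp add: algebra_simps diff_divide_distrib)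
    also have "(of_real (exp (v z)) * cnj w - of_real (exp (- v z)) * w) / 2 =
        Complex (sinh (v z) * Re w) (- cosh (v z) * Im w)"
      by (simp add: complex_eq_iff sinh_field_def cosh_field_def algebra_simps diff_divide_distrib add_divide_distrib)
    finally show "(exp (\<i> * h (cnj z)) * cnj w - exp (\<i> * h z) * w) / 2 = W' z w" by (simp add: W'_def)
  qed
qed

lemma has_derivative_\<Phi>: "(\<Phi> has_derivative \<Phi>' z) (at z)"
  unfolding \<Phi>_def[abs_def] \<Phi>'_def[abs_def]
  by (intro has_derivative_space_vec has_derivative_W bounded_linear_imp_has_derivative bounded_linear_Re)

lemma linear_\<Phi>': "linear (\<Phi>' z)"
  using has_derivative_\<Phi> by (rule has_derivative_linear)

text \<open>The horizontal part stretches by sinh in the real direction and by cosh in the imaginary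
  one, orthogonally; the height adds 1 to the first square, and \<open>sinh^2 + 1 = cosh^2\<close>
  makes the two equal.\<close>

lemma inner_\<Phi>': "\<Phi>' z a \<bullet> \<Phi>' z b = (cosh (v z))\<^sup>2 * (a \<bullet> b)"
proof -
  have "\<Phi>' z a \<bullet> \<Phi>' z b = (sinh (v z) * Re a) * (sinh (v z) * Re b) + (cosh (v z) * Im a) * (cosh (v z) * Im b) + Re a * Re b"
    by (simp add: \<Phi>'_def W'_def inner_space_vec inner_cis_mult) (simp add: inner_complex_def)
  also have "\<dots> = ((sinh (v z))\<^sup>2 + 1) * (Re a * Re b) + (cosh (v z))\<^sup>2 * (Im a * Im b)"
    by (simp add: power2_eq_square algebra_simps)
  also have "(sinh (v z))\<^sup>2 + 1 = (cosh (v z))\<^sup>2" by (simp add: sinh_square_eq)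
  finally show ?thesis by (simp add: inner_complex_def algebra_simps)
qed

lemma norm_\<Phi>': "norm (\<Phi>' z w) = cosh (v z) * norm w"
  unfolding norm_eq_sqrt_inner inner_\<Phi>' by (simp add: real_sqrt_mult)

lemma continuous_u: "continuous_on S u"
  unfolding u_eq[abs_def] by (intro continuous_intros)

lemma continuous_v: "continuous_on S v"
  unfolding v_eq[abs_def] by (intro continuous_intros)

lemma continuous_\<Phi>': "continuous_on S (\<lambda>z. \<Phi>' z w)"
  unfolding \<Phi>'_def W'_def Complex_eq
  by (intro continuous_on_space_vec continuous_intros continuous_u continuous_v)

text \<open>The Gauss map: inverse stereographic projection of g = exp (i h), whose modulus is exp
  (-v) and whose argument is u.\<close>

definition N :: "complex \<Rightarrow> real^3" where
  "N z = space_vec (of_real (1 / cosh (v z)) * cis (u z)) (- tanh (v z))"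

lemma inner_\<Phi>'_N: "\<Phi>' z w \<bullet> N z = 0"
proof -
  have "W' z w \<bullet> (of_real (1 / cosh (v z)) * cis (u z)) = sinh (v z) * Re w / cosh (v z)"
    unfolding W'_def by (subst mult.commute[of "of_real _"], subst inner_cis_mult) (simp add: inner_complex_def)
  then show ?thesis by (simp add: \<Phi>'_def N_def inner_space_vec tanh_def)
qed

lemma norm_N: "norm (N z) = 1"
proof -
  have "(1 / cosh (v z))\<^sup>2 + (tanh (v z))\<^sup>2 = (1 + (sinh (v z))\<^sup>2) / (cosh (v z))\<^sup>2"
    by (simp add: tanh_def power_divide add_divide_distrib)
  also have "\<dots> = 1" by (simp add: sinh_square_eq)
  finally show ?thesis by (simp add: N_def norm_space_vec norm_mult norm_divide)
qed

lemma has_derivative_uv: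
  "(u has_derivative (\<lambda>w. Re (h' z * w))) (at z)" "(v has_derivative (\<lambda>w. Im (h' z * w))) (at z)"
  using h_deriv bounded_linear.has_derivative[OF bounded_linear_Re, of h "(*) (h' z)" "at z"]
    bounded_linear.has_derivative[OF bounded_linear_Im, of h "(*) (h' z)" "at z"]
  by (simp_all add: has_field_derivative_def u_def[abs_def] v_def[abs_def])

text \<open>The differential of the normal is expressed through that of \<Phi>, which exhibits the
  shape operator. It is antilinear in w, because of the conjugation, and an antilinear map of the
  plane has trace zero; this is minimality.\<close>

lemma has_derivative_N:
  "(N has_derivative (\<lambda>w. (- 1 / (cosh (v z))\<^sup>2) *\<^sub>R \<Phi>' z (\<i> * cnj (h' z * w)))) (at z)"
proof -
  have c: "((\<lambda>z. cis (u z)) has_derivative (\<lambda>w. Re (h' z * w) *\<^sub>R (\<i> * cis (u z)))) (at z)"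
    by (rule has_derivative_compose[OF has_derivative_uv(1) has_derivative_cis])
  have i: "((\<lambda>z. 1 / cosh (v z)) has_derivative (\<lambda>w. (- sinh (v z) / (cosh (v z))\<^sup>2) * Im (h' z * w))) (at z)"
  proof (rule has_derivative_compose[OF has_derivative_uv(2)])
    have "((\<lambda>x. 1 / cosh x) has_field_derivative - sinh (v z) / (cosh (v z))\<^sup>2) (at (v z))"
      by (auto intro!: derivative_eq_intros simp: power2_eq_square)
    then show "((\<lambda>x. 1 / cosh x) has_derivative (*) (- sinh (v z) / (cosh (v z))\<^sup>2)) (at (v z))"
      by (simp add: has_field_derivative_def)
  qed
  have t: "((\<lambda>z. - tanh (v z)) has_derivative (\<lambda>w. (- 1 / (cosh (v z))\<^sup>2) * Im (h' z * w))) (at z)"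
  proof (rule has_derivative_compose[OF has_derivative_uv(2)])
    have "1 - (tanh (v z))\<^sup>2 = ((cosh (v z))\<^sup>2 - (sinh (v z))\<^sup>2) / (cosh (v z))\<^sup>2"
      by (simp add: tanh_def power_divide diff_divide_distrib)
    also have "\<dots> = 1 / (cosh (v z))\<^sup>2" by (simp add: sinh_square_eq)
    finally have "((\<lambda>x. - tanh x) has_field_derivative - 1 / (cosh (v z))\<^sup>2) (at (v z))"
      by (auto intro!: derivative_eq_intros)
    then show "((\<lambda>x. - tanh x) has_derivative (*) (- 1 / (cosh (v z))\<^sup>2)) (at (v z))"
      by (simp add: has_field_derivative_def)
  qed
  have "((\<lambda>z. (1 / cosh (v z)) *\<^sub>R cis (u z)) has_derivative (\<lambda>w. (1 / cosh (v z)) *\<^sub>R (Re (h' z * w) *\<^sub>R (\<i> * cis (u z)))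
      + ((- sinh (v z) / (cosh (v z))\<^sup>2) * Im (h' z * w)) *\<^sub>R cis (u z))) (at z)"
    by (rule has_derivative_scaleR[OF i c])
  from has_derivative_space_vec[OF this t]
  have "((\<lambda>z. space_vec ((1 / cosh (v z)) *\<^sub>R cis (u z)) (- tanh (v z))) has_derivative
     (\<lambda>w. space_vec ((1 / cosh (v z)) *\<^sub>R (Re (h' z * w) *\<^sub>R (\<i> * cis (u z)))
      + ((- sinh (v z) / (cosh (v z))\<^sup>2) * Im (h' z * w)) *\<^sub>R cis (u z)) ((- 1 / (cosh (v z))\<^sup>2) * Im (h' z * w)))) (at z)" .
  moreover have "(\<lambda>z. space_vec ((1 / cosh (v z)) *\<^sub>R cis (u z)) (- tanh (v z))) = N"
    by (auto simp: N_def scaleR_conv_of_real)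
  moreover have "space_vec ((1 / cosh (v z)) *\<^sub>R (Re (h' z * w) *\<^sub>R (\<i> * cis (u z)))
      + ((- sinh (v z) / (cosh (v z))\<^sup>2) * Im (h' z * w)) *\<^sub>R cis (u z)) ((- 1 / (cosh (v z))\<^sup>2) * Im (h' z * w))
      = (- 1 / (cosh (v z))\<^sup>2) *\<^sub>R \<Phi>' z (\<i> * cnj (h' z * w))" for w
  proof -
    define c s a b where "c = cosh (v z)" "s = sinh (v z)" "a = Re (h' z * w)" "b = Im (h' z * w)"
    have "c \<noteq> 0" by (simp add: c_s_a_b_def)
    moreover have "Re (\<i> * cnj (h' z * w)) = b" "Im (\<i> * cnj (h' z * w)) = a" by (simp_all add: c_s_a_b_def)
    ultimately show ?thesis unfolding \<Phi>'_def W'_def c_s_a_b_def[symmetric]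
      by (simp add: vec_eq_iff forall_3 field_simps power2_eq_square)
  qed
  ultimately show ?thesis by simp
qed

lemma cross3_\<Phi>':
  "cross3 (\<Phi>' z a) (\<Phi>' z b) = ((Re a * Im b - Im a * Re b) * (cosh (v z))\<^sup>2) *\<^sub>R N z"
proof -
  define c s C S where "c = cosh (v z)" "s = sinh (v z)" "C = cos (u z)" "S = sin (u z)"
  have 1: "C * C + S * S = 1" using sin_cos_squared_add3[of "u z"] by (simp add: c_s_C_S_def)
  have 0: "c \<noteq> 0" by (simp add: c_s_C_S_def)
  define d where "d = Re a * Im b - Im a * Re b"
  have "cross3 (\<Phi>' z a) (\<Phi>' z b) = vector [d * c * C, d * c * S, - (d * c * s * (C * C + S * S))]"
    unfolding cross3_def \<Phi>'_def W'_def space_vec_nth times_complex.sel cis.sel complex.sel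
      c_s_C_S_def[symmetric] d_def
    by (simp add: vec_eq_iff forall_3 algebra_simps)
  also have "\<dots> = (d * c\<^sup>2) *\<^sub>R N z"
    using 0 unfolding 1 N_def tanh_def c_s_C_S_def[symmetric]
    by (simp add: vec_eq_iff forall_3 power2_eq_square flip: c_s_C_S_def)
  finally show ?thesis by (simp add: d_def c_s_C_S_def)
qed

end

section \<open>Curvature in an arbitrary parametrization\<close>

lemma trace_matrix_inv_mult_2:
  fixes g b :: "real^2^2"
  assumes "det g \<noteq> 0"
  shows "det g * trace (matrix_inv g ** b) = g$2$2 * b$1$1 - g$1$2 * b$2$1 - g$2$1 * b$1$2 + g$1$1 * b$2$2"
    and "trace ((matrix_inv g ** b) ** (matrix_inv g ** b))
      = (trace (matrix_inv g ** b))\<^sup>2 - 2 * (det b / det g)"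
proof -
  \<comment> \<open>Solving \<open>g ** S = b\<close> avoids the entries of the inverse matrix. The
    trace of the square then follows from the Cayley-Hamilton identity for 2 by 2 matrices.\<close>
  define S where "S = matrix_inv g ** b"
  have "\<exists>g'. g ** g' = mat 1 \<and> g' ** g = mat 1"
    using assms by (simp add: invertible_det_nz[symmetric] invertible_def)
  then have "g ** matrix_inv g = mat 1" unfolding matrix_inv_def by (rule someI2_ex) simp
  then have gS: "g ** S = b" by (simp add: S_def matrix_mul_assoc)
  have b: "b$i$j = g$i$1 * S$1$j + g$i$2 * S$2$j" for i j
    by (simp add: gS[symmetric] matrix_matrix_mult_def sum_2)
  have "det g * det S = det b" by (simp add: gS[symmetric] det_mul)
  then have d: "det S = det b / det g" using assms by (simp add: field_simps)
  show "det g * trace (matrix_inv g ** b) = g$2$2 * b$1$1 - g$1$2 * b$2$1 - g$2$1 * b$1$2 + g$1$1 * b$2$2"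
    unfolding S_def[symmetric] b by (simp add: trace_def sum_2 det_2 algebra_simps)
  have "trace (S ** S) = (trace S)\<^sup>2 - 2 * det S"
    by (simp add: trace_def matrix_matrix_mult_def sum_2 det_2 power2_eq_square algebra_simps)
  then show "trace ((matrix_inv g ** b) ** (matrix_inv g ** b))
      = (trace (matrix_inv g ** b))\<^sup>2 - 2 * (det b / det g)"
    by (simp add: S_def[symmetric] d)
qed

context modulated_helicoid
begin

text \<open>The disk is parametrized by a non-conformal \<xi>, so curvature is computed through a
  general reparametrization. Second derivatives of \<Phi> are avoided: differentiating the relation
  between tangent vectors and the normal expresses the second fundamental form by
  \<open>has_derivative_N\<close>.\<close>

lemma curvature:
  fixes \<xi> :: "real^2 \<Rightarrow> complex"
  defines "F \<equiv> \<lambda>p. \<Phi> (\<xi> p)"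
  assumes V: "open V" "p \<in> V" and F: "Ck_on (Suc (Suc 0)) V F"
    and \<xi>: "\<And>q. q \<in> V \<Longrightarrow> (\<xi> has_derivative \<xi>' q) (at q)" and inj: "inj (\<xi>' p)"
  shows "mean_curvature F p = 0"
    and "sff_norm_sq F p = 2 * (cmod (h' (\<xi> p)))\<^sup>2 / cosh (v (\<xi> p)) ^ 4"
    and "inj (frechet_derivative F (at p))"
proof -
  have derF: "(F has_derivative (\<lambda>w. \<Phi>' (\<xi> q) (\<xi>' q w))) (at q)" if "q \<in> V" for q
    unfolding F_def by (rule has_derivative_compose[OF \<xi>[OF that] has_derivative_\<Phi>])
  have frF: "frechet_derivative F (at q) = (\<lambda>w. \<Phi>' (\<xi> q) (\<xi>' q w))" if "q \<in> V" for q
    using frechet_derivative_at[OF derF[OF that]] by simp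
  have F1: "pderiv1 F i q = \<Phi>' (\<xi> q) (\<xi>' q (axis i 1))" if "q \<in> V" for i q
    by (simp add: pderiv1_def frF[OF that])
  define z where "z = \<xi> p"
  define a where "a = (\<lambda>i::2. \<xi>' p (axis i 1))"
  have lin: "linear (\<xi>' p)" using \<xi>[OF V(2)] by (rule has_derivative_linear)
  define c where "c = cosh (v z)"
  have c: "c > 0" by (simp add: c_def)
  show "inj (frechet_derivative F (at p))"
    unfolding frF[OF V(2)]
  proof (rule injI)
    fix x y assume "\<Phi>' (\<xi> p) (\<xi>' p x) = \<Phi>' (\<xi> p) (\<xi>' p y)"
    then have "\<Phi>' (\<xi> p) (\<xi>' p x - \<xi>' p y) = 0" by (simp add: linear_diff[OF linear_\<Phi>'])
    then have "cosh (v (\<xi> p)) * norm (\<xi>' p x - \<xi>' p y) = 0" by (metis norm_\<Phi>' norm_zero)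
    then have "\<xi>' p x = \<xi>' p y" by simp
    then show "x = y" using inj by (simp add: inj_eq)
  qed
  \<comment> \<open>The Jacobian of \<xi>. Its sign decides between the two unit normals and drops
    out of mean curvature zero and of the squared norm.\<close>
  define J where "J = Re (a 1) * Im (a 2) - Im (a 1) * Re (a 2)"
  have J: "J \<noteq> 0"
  proof
    assume J0: "J = 0"
    have zero: "s * a 1 + t * a 2 = 0 \<Longrightarrow> s = 0 \<and> t = 0" for s t :: real
    proof -
      assume *: "s * a 1 + t * a 2 = 0"
      have "\<xi>' p (s *\<^sub>R axis 1 1 + t *\<^sub>R axis 2 1) = s *\<^sub>R a 1 + t *\<^sub>R a 2"
        by (simp add: a_def linear_add[OF lin] linear_scale[OF lin])
      also have "\<dots> = \<xi>' p 0" using * by (simp add: scaleR_conv_of_real linear_0[OF lin])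
      finally have "s *\<^sub>R axis 1 1 + t *\<^sub>R axis 2 1 = (0 :: real^2)" using inj by (simp add: inj_eq)
      then show ?thesis by (simp add: vec_eq_iff forall_2 axis_def)
    qed
    have "Im (a 2) * a 1 + (- Im (a 1)) * a 2 = 0"
      using J0 by (simp add: complex_eq_iff J_def algebra_simps)
    from zero[OF this] have 1: "Im (a 2) = 0" "Im (a 1) = 0" by auto
    have "Re (a 2) * a 1 + (- Re (a 1)) * a 2 = 0"
      using 1 by (simp add: complex_eq_iff algebra_simps)
    from zero[OF this] have "Re (a 1) = 0" by auto
    with 1 have "complex_of_real 1 * a 1 + complex_of_real 0 * a 2 = 0" by (simp add: complex_eq_iff)
    from zero[OF this] show False by simp
  qed
  define \<epsilon> where "\<epsilon> = sgn J"
  have \<epsilon>: "\<epsilon> * \<epsilon> = 1" using J by (simp add: \<epsilon>_def sgn_if)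
  have normal: "unit_normal F p = \<epsilon> *\<^sub>R N z"
  proof -
    have "cross3 (pderiv1 F 1 p) (pderiv1 F 2 p) = (J * c\<^sup>2) *\<^sub>R N z"
      by (simp add: F1[OF V(2)] cross3_\<Phi>' J_def a_def z_def c_def)
    then show ?thesis
      using c by (simp add: unit_normal_def \<epsilon>_def sgn_scaleR sgn_mult) (simp add: sgn_div_norm norm_N)
  qed
  have II: "pderiv2 F i j p \<bullet> N z = a i \<bullet> (\<i> * cnj (h' z * a j))" for i j
  proof -
    have "pderiv1 F i differentiable (at p)"
      using F V(2) by (simp add: pderiv1_def[abs_def])
    then have d1: "(pderiv1 F i has_derivative frechet_derivative (pderiv1 F i) (at p)) (at p)"
      by (simp add: frechet_derivative_works)
    have d2: "((\<lambda>q. N (\<xi> q)) has_derivative (\<lambda>w. (- 1 / c\<^sup>2) *\<^sub>R \<Phi>' z (\<i> * cnj (h' z * \<xi>' p w)))) (at p)"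
      using has_derivative_compose[OF \<xi>[OF V(2)] has_derivative_N] by (simp add: z_def c_def)
    have "((\<lambda>q. pderiv1 F i q \<bullet> N (\<xi> q)) has_derivative
       (\<lambda>w. pderiv1 F i p \<bullet> ((- 1 / c\<^sup>2) *\<^sub>R \<Phi>' z (\<i> * cnj (h' z * \<xi>' p w)))
          + frechet_derivative (pderiv1 F i) (at p) w \<bullet> N (\<xi> p))) (at p)"
      by (rule has_derivative_inner[OF d1 d2])
    moreover have "((\<lambda>q. pderiv1 F i q \<bullet> N (\<xi> q)) has_derivative (\<lambda>w. 0)) (at p)"
      by (rule has_derivative_transform_within_open[OF has_derivative_const[of 0] V])
         (simp add: F1 inner_\<Phi>'_N)
    ultimately have "(\<lambda>w. pderiv1 F i p \<bullet> ((- 1 / c\<^sup>2) *\<^sub>R \<Phi>' z (\<i> * cnj (h' z * \<xi>' p w)))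
          + frechet_derivative (pderiv1 F i) (at p) w \<bullet> N (\<xi> p)) = (\<lambda>w. 0)"
      by (rule has_derivative_unique)
    from fun_cong[OF this, of "axis j 1"]
    have "pderiv2 F i j p \<bullet> N z = (1 / c\<^sup>2) * (pderiv1 F i p \<bullet> \<Phi>' z (\<i> * cnj (h' z * a j)))"
      by (simp add: pderiv2_def z_def a_def)
    also have "pderiv1 F i p \<bullet> \<Phi>' z (\<i> * cnj (h' z * a j)) = c\<^sup>2 * (a i \<bullet> (\<i> * cnj (h' z * a j)))"
      by (simp add: F1[OF V(2)] z_def[symmetric] inner_\<Phi>' c_def a_def)
    finally show ?thesis using c by simp
  qed
  define g where "g = first_fundamental_form F p"
  define b where "b = second_fundamental_form F p"
  have g: "g$i$j = c\<^sup>2 * (a i \<bullet> a j)" for i j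
    by (simp add: g_def first_fundamental_form_def F1[OF V(2)] z_def[symmetric] inner_\<Phi>' c_def a_def)
  have b: "b$i$j = \<epsilon> * (a i \<bullet> (\<i> * cnj (h' z * a j)))" for i j
    by (simp add: b_def second_fundamental_form_def normal II)
  \<comment> \<open>In these coordinates the entries of b are, up to \<epsilon>, the imaginary parts
    of h' a_i a_j: the form comes from a quadratic differential. Its trace against the conformal
    metric vanishes identically and its determinant is
    \<open>- (s\<^sup>2 + t\<^sup>2) * J\<^sup>2\<close>.\<close>
  define a1 a2 b1 b2 s t where "a1 = Re (a 1)" "a2 = Im (a 1)" "b1 = Re (a 2)" "b2 = Im (a 2)"
    "s = Re (h' z)" "t = Im (h' z)"
  note abst = this
  have gs: "g$1$1 = c\<^sup>2 * (a1 * a1 + a2 * a2)" "g$1$2 = c\<^sup>2 * (a1 * b1 + a2 * b2)"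
    "g$2$1 = c\<^sup>2 * (a1 * b1 + a2 * b2)" "g$2$2 = c\<^sup>2 * (b1 * b1 + b2 * b2)"
    by (simp_all add: g inner_complex_def abst mult.commute)
  have bs: "b$1$1 = \<epsilon> * (a1 * (s * a2 + t * a1) + a2 * (s * a1 - t * a2))"
    "b$1$2 = \<epsilon> * (a1 * (s * b2 + t * b1) + a2 * (s * b1 - t * b2))"
    "b$2$1 = \<epsilon> * (b1 * (s * a2 + t * a1) + b2 * (s * a1 - t * a2))"
    "b$2$2 = \<epsilon> * (b1 * (s * b2 + t * b1) + b2 * (s * b1 - t * b2))"
    by (simp_all add: b inner_complex_def abst)
  have detg: "det g = c ^ 4 * J\<^sup>2"
    by (simp add: det_2 gs J_def abst[symmetric] power2_eq_square power4_eq_xxxx algebra_simps)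
  then have detg0: "det g \<noteq> 0" using c J by simp
  have detb: "det b = - (\<epsilon> * \<epsilon>) * (s\<^sup>2 + t\<^sup>2) * J\<^sup>2"
    unfolding det_2 bs J_def abst[symmetric] by (simp add: power2_eq_square algebra_simps)
  have "det g * trace (matrix_inv g ** b) = 0"
    unfolding trace_matrix_inv_mult_2(1)[OF detg0] gs bs by (simp add: algebra_simps)
  then have tr: "trace (matrix_inv g ** b) = 0" using detg0 by simp
  then show "mean_curvature F p = 0" by (simp add: mean_curvature_def shape_operator_def g_def b_def)
  have "sff_norm_sq F p = - 2 * (det b / det g)"
    using trace_matrix_inv_mult_2(2)[OF detg0, of b] tr
    by (simp add: sff_norm_sq_def shape_operator_def g_def b_def)
  also have "\<dots> = 2 * (s\<^sup>2 + t\<^sup>2) / c ^ 4"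
    using J c unfolding detb detg \<epsilon> by (simp add: field_simps)
  finally show "sff_norm_sq F p = 2 * (cmod (h' (\<xi> p)))\<^sup>2 / cosh (v (\<xi> p)) ^ 4"
    by (simp add: cmod_power2 abst c_def z_def)
qed

section \<open>The thin strip and the embeddedness of its image\<close>

definition Y :: real where "Y = sqrt (1 / (2 * B))"
definition strip :: "complex set" where "strip = {z. \<bar>Im z\<bar> < Y}"

lemma Y: "0 < Y" "Y < 1" "B * Y\<^sup>2 = 1 / 2" "Y\<^sup>2 \<le> \<mu> / 2"
proof -
  have Y2: "Y\<^sup>2 = 1 / (2 * B)" using B by (simp add: Y_def)
  show "0 < Y" using B by (simp add: Y_def)
  have "Y\<^sup>2 < 1\<^sup>2" unfolding Y2 using B by simp
  then show "Y < 1" by (rule power2_less_imp_less) simp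
  show "B * Y\<^sup>2 = 1 / 2" using B by (simp add: Y2)
  show "Y\<^sup>2 \<le> \<mu> / 2" unfolding Y2 using B B\<mu> by (simp add: field_simps)
qed

lemma open_strip: "open strip"
proof -
  have "strip = (\<lambda>z. \<bar>Im z\<bar>) -` {..<Y}" by (auto simp: strip_def)
  moreover have "open ((\<lambda>z. \<bar>Im z\<bar>) -` {..<Y})" by (intro open_vimage continuous_intros)
  ultimately show ?thesis by simp
qed

lemma cnj_strip: "z \<in> strip \<Longrightarrow> cnj z \<in> strip" by (simp add: strip_def)

text \<open>This dictates the half-width Y: along a vertical line u changes by at most
  \<open>B * Y\<^sup>2\<close>, which is 1/2. The real axis part of u cancels, leaving only the
  factor cosh, whose deviation from 1 is quadratic.\<close>

lemma u_variation:
  assumes "z \<in> strip" "w \<in> strip" "Re z = Re w"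
  shows "\<bar>u z - u w\<bar> \<le> 1"
proof -
  have c: "1 \<le> cosh (Im z) \<and> cosh (Im z) \<le> 1 + Y\<^sup>2" if "z \<in> strip" for z
  proof -
    have z: "\<bar>Im z\<bar> < Y" using that by (simp add: strip_def)
    then have "cosh (Im z) \<le> 1 + (Im z)\<^sup>2" using Y(2) by (intro cosh_le_one_plus_square) simp
    also have "(Im z)\<^sup>2 \<le> Y\<^sup>2" using z by (intro power2_le_iff_abs_le[THEN iffD2]) auto
    finally show ?thesis by (simp add: cosh_real_ge_1)
  qed
  have "u z - u w = B * (sin (Re w) * (cosh (Im z) - cosh (Im w)))"
    by (simp add: u_eq assms(3) algebra_simps)
  then have "\<bar>u z - u w\<bar> = B * (\<bar>sin (Re w)\<bar> * \<bar>cosh (Im z) - cosh (Im w)\<bar>)"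
    using B by (simp add: abs_mult)
  also have "\<dots> \<le> B * (1 * Y\<^sup>2)"
    using c[OF assms(1)] c[OF assms(2)] B by (intro mult_left_mono mult_mono) (auto simp: abs_le_iff)
  finally show ?thesis using Y(3) by simp
qed

text \<open>The worst case is cosine equal to -1, where the linear terms leave only
  \<open>\<mu> * y\<close>. The cubic excess of sinh consumes at most half of this because
  \<open>Y\<^sup>2\<close> is at most \<open>\<mu> / 2\<close>.\<close>

lemma v_lower:
  assumes "z \<in> strip" "0 \<le> Im z"
  shows "B * \<mu> / 2 * Im z \<le> v z"
proof -
  define y where "y = Im z"
  have y: "0 \<le> y" "y < Y" using assms by (auto simp: y_def strip_def)
  have "y\<^sup>2 \<le> \<mu> / 2" using Y(4) power_mono[of y Y 2] y by linarith
  then have "y * y\<^sup>2 \<le> y * (\<mu> / 2)" using y by (intro mult_left_mono) auto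
  then have y3: "y ^ 3 \<le> \<mu> / 2 * y" by (simp add: power3_eq_cube power2_eq_square mult.commute mult.assoc)
  have "sinh y \<le> y + y ^ 3" using y Y(2) by (intro sinh_le_cubic) auto
  with y3 have s: "sinh y \<le> y + \<mu> / 2 * y" by linarith
  have "(-1) * sinh y \<le> cos (Re z) * sinh y" using y by (intro mult_right_mono) auto
  with s have "\<mu> / 2 * y \<le> (1 + \<mu>) * y + cos (Re z) * sinh y" by (simp add: algebra_simps)
  then have "B * (\<mu> / 2 * y) \<le> v z" unfolding v_eq y_def[symmetric] using B by (intro mult_left_mono) auto
  then show ?thesis by (simp add: y_def)
qed

text \<open>Seen from the direction \<open>W' z \<i>\<close>, the slice of the surface at the height of \<open>z\<close> is a graph,
  because its tangent direction turns by less than a right angle.\<close>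

lemma slice_graph:
  assumes z: "z \<in> strip" and w: "w \<in> strip" "Re w = Re z"
  shows "((\<lambda>t. W (Complex (Re z) t) \<bullet> (cis (u z) * (- \<i>))) has_real_derivative
      cosh (v w) * cos (u w - u z)) (at (Im w))"
    and "cosh (v w) / 2 \<le> cosh (v w) * cos (u w - u z)"
proof -
  have cw: "Complex (Re z) (Im w) = w" using w by (simp add: complex_eq_iff)
  have "((\<lambda>t. complex_of_real (Re z) + \<i> * of_real t) has_derivative (\<lambda>h. \<i> * of_real h)) (at (Im w))"
    by (auto intro!: derivative_eq_intros)
  then have "((\<lambda>t. Complex (Re z) t) has_derivative (\<lambda>h. \<i> * of_real h)) (at (Im w))" by (simp add: Complex_eq)
  moreover have "(W has_derivative W' w) (at (Complex (Re z) (Im w)))" unfolding cw by (rule has_derivative_W)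
  ultimately have "((\<lambda>t. W (Complex (Re z) t)) has_derivative (\<lambda>h. W' w (\<i> * of_real h))) (at (Im w))"
    by (rule has_derivative_compose)
  then have "((\<lambda>t. W (Complex (Re z) t) \<bullet> (cis (u z) * (- \<i>))) has_derivative
      (\<lambda>h. W' w (\<i> * of_real h) \<bullet> (cis (u z) * (- \<i>)))) (at (Im w))"
    by (rule has_derivative_inner_left)
  moreover have "W' w (\<i> * of_real h) \<bullet> (cis (u z) * (- \<i>)) = cosh (v w) * cos (u w - u z) * h" for h
    by (simp add: W'_def inner_complex_def cos_diff algebra_simps)
  ultimately show "((\<lambda>t. W (Complex (Re z) t) \<bullet> (cis (u z) * (- \<i>))) has_real_derivative
      cosh (v w) * cos (u w - u z)) (at (Im w))"
    by (simp add: has_field_derivative_def)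
  have "1 / 2 \<le> cos (u w - u z)" using u_variation[OF w(1) z w(2)] by (rule half_le_cos)
  then have "cosh (v w) * (1 / 2) \<le> cosh (v w) * cos (u w - u z)" by (intro mult_left_mono) auto
  then show "cosh (v w) / 2 \<le> cosh (v w) * cos (u w - u z)" by simp
qed

lemma W_real: "Im z = 0 \<Longrightarrow> W z = 0"
proof -
  assume "Im z = 0"
  then have "cnj z = z" by (simp add: complex_eq_iff)
  then show ?thesis by (simp add: W_def)
qed

lemma W_cnj: "W (cnj z) = - W z" by (simp add: W_def field_simps)

text \<open>Along a slice the component of W in the fixed direction taken at z is strictly
  increasing, by \<open>slice_graph\<close>.\<close>

lemma W_inj:
  assumes "z \<in> strip" "w \<in> strip" "Re z = Re w" "W z = W w"
  shows "z = w"
proof -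
  have False if z: "z \<in> strip" "w \<in> strip" "Re z = Re w" "W z = W w" and less: "Im z < Im w" for z w
  proof -
    let ?E = "\<lambda>t. W (Complex (Re z) t) \<bullet> (cis (u z) * (- \<i>))"
    have "?E (Im z) < ?E (Im w)"
    proof (rule DERIV_pos_imp_increasing[OF less])
      fix t assume t: "Im z \<le> t" "t \<le> Im w"
      define y where "y = Complex (Re z) t"
      have y: "y \<in> strip" "Re y = Re z" "Im y = t" using t z(1,2) by (auto simp: y_def strip_def)
      have "0 < cosh (v y) * cos (u y - u z)"
        using slice_graph(2)[OF z(1) y(1,2)] cosh_real_pos[of "v y"] by linarith
      then show "\<exists>d. (?E has_real_derivative d) (at t) \<and> 0 < d"
        using slice_graph(1)[OF z(1) y(1,2)] y(3) by auto
    qed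
    moreover have "Complex (Re z) (Im z) = z" "Complex (Re z) (Im w) = w" using z(3) by (simp_all add: complex_eq_iff)
    ultimately show False using z(4) by simp
  qed
  from this[of z w] this[of w z] assms show ?thesis by (metis complex_eqI linorder_neqE)
qed

text \<open>The primitive, vanishing at 0, of half of \<open>cosh (B * \<mu> / 2 * y)\<close>, the
  lower bound for the slope of a slice that results from \<open>slice_graph\<close> and
  \<open>v_lower\<close>.\<close>

definition radius :: "real \<Rightarrow> real" where "radius y = sinh (B * \<mu> / 2 * y) / (B * \<mu>)"

text \<open>A comparison of slopes: the component of W along the tangent direction at z starts at 0
  on the axis and grows at least as fast as \<open>radius\<close>. Positivity of this component
  makes the distance from the axis increase along the slice; its size shows how far the slice
  reaches.\<close>

lemma radial:
  assumes z: "z \<in> strip" and pos: "0 < Im z"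
  shows "0 < W z \<bullet> W' z \<i>" "radius (Im z) \<le> cmod (W z)"
proof -
  let ?E = "\<lambda>t. W (Complex (Re z) t) \<bullet> (cis (u z) * (- \<i>))"
  have B\<mu>0: "B * \<mu> > 0" using B\<mu> by linarith
  have "?E 0 - radius 0 \<le> ?E (Im z) - radius (Im z)"
  proof (rule DERIV_nonneg_imp_nondecreasing[of 0 "Im z" "\<lambda>t. ?E t - radius t"])
    show "0 \<le> Im z" using pos by simp
    fix t assume t: "0 \<le> t" "t \<le> Im z"
    define y where "y = Complex (Re z) t"
    have y: "y \<in> strip" "Re y = Re z" "Im y = t" using t z by (auto simp: y_def strip_def)
    have "(radius has_real_derivative cosh (B * \<mu> / 2 * t) / 2) (at t)"
      unfolding radius_def using B\<mu>0 by (auto intro!: derivative_eq_intros)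
    then have "((\<lambda>t. ?E t - radius t) has_real_derivative
        (cosh (v y) * cos (u y - u z) - cosh (B * \<mu> / 2 * t) / 2)) (at t)"
      using slice_graph(1)[OF z y(1,2)] y(3) by (intro DERIV_diff) auto
    moreover have "cosh (B * \<mu> / 2 * t) \<le> cosh (v y)"
    proof -
      have "0 \<le> B * \<mu> / 2 * t" using t B\<mu>0 by simp
      moreover have "B * \<mu> / 2 * t \<le> v y" using v_lower[OF y(1)] y(3) t by simp
      ultimately show ?thesis by (simp add: cosh_real_nonneg_le_iff)
    qed
    ultimately show "\<exists>d. ((\<lambda>t. ?E t - radius t) has_real_derivative d) (at t) \<and> 0 \<le> d"
    proof -
      assume der: "((\<lambda>t. ?E t - radius t) has_real_derivative
          (cosh (v y) * cos (u y - u z) - cosh (B * \<mu> / 2 * t) / 2)) (at t)"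
        and "cosh (B * \<mu> / 2 * t) \<le> cosh (v y)"
      then have "0 \<le> cosh (v y) * cos (u y - u z) - cosh (B * \<mu> / 2 * t) / 2"
        using slice_graph(2)[OF z y(1,2)] by linarith
      with der show ?thesis by blast
    qed
  qed
  moreover have "?E 0 = 0" "?E (Im z) = W z \<bullet> (cis (u z) * (- \<i>))"
    using W_real[of "Complex (Re z) 0"] by simp_all
  ultimately have E: "radius (Im z) \<le> W z \<bullet> (cis (u z) * (- \<i>))" by (simp add: radius_def)
  have "0 < radius (Im z)" using pos B\<mu>0 by (simp add: radius_def)
  with E have E0: "0 < W z \<bullet> (cis (u z) * (- \<i>))" by linarith
  have "W' z \<i> = cosh (v z) *\<^sub>R (cis (u z) * (- \<i>))" by (simp add: W'_def complex_eq_iff)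
  then have "W z \<bullet> W' z \<i> = cosh (v z) * (W z \<bullet> (cis (u z) * (- \<i>)))" by (simp only: inner_scaleR_right)
  then show "0 < W z \<bullet> W' z \<i>" using mult_pos_pos[OF cosh_real_pos E0] by simp
  have "W z \<bullet> (cis (u z) * (- \<i>)) \<le> cmod (W z) * cmod (cis (u z) * (- \<i>))" by (rule norm_cauchy_schwarz)
  then show "radius (Im z) \<le> cmod (W z)" using E by (simp add: norm_mult)
qed

end

section \<open>Parametrization by the disk\<close>

context modulated_helicoid
begin

definition q :: "complex \<Rightarrow> complex" where "q z = - (\<i> / 2) * vertical_moment 0 (deriv Q) z"
definition \<sigma> :: "complex \<Rightarrow> real" where "\<sigma> z = Im z * (q z \<bullet> q z) powr (1 / 2)"
definition G :: "complex \<Rightarrow> complex" where "G z = Complex (Re z) (\<sigma> z)"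

text \<open>The disk is parametrized by height and signed distance \<open>\<sigma>\<close> from the axis, so that \<open>G\<close> turns \<open>norm \<circ> \<Phi>\<close>
  into \<open>cmod\<close> and the boundary lies exactly on a sphere. The quotient \<open>q\<close> of \<open>W\<close> by \<open>Im\<close> makes \<open>\<sigma>\<close>
  smooth across the axis.\<close>

lemma W_eq_q: "W z = Im z *\<^sub>R q z"
proof -
  have "\<i> * Im z * vertical_moment 0 (deriv Q) z = Q z - Q (cnj z)"
    by (rule vertical_moment_deriv[OF Q_holomorphic])
  then have "W z = - (\<i> * Im z * vertical_moment 0 (deriv Q) z) / 2" by (simp add: W_def)
  then show ?thesis by (simp add: q_def scaleR_conv_of_real)
qed

lemma radius_pos: "0 < y \<Longrightarrow> 0 < radius y"
  using B\<mu> by (auto simp: radius_def intro!: divide_pos_pos mult_pos_pos)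

text \<open>Needed because the norm is smooth only away from 0. On the axis q equals
  \<open>- \<i> * exp (\<i> * h z)\<close>; elsewhere W is nonzero by \<open>radial\<close> and its
  oddness under conjugation.\<close>

lemma q_nonzero:
  assumes z: "z \<in> strip"
  shows "q z \<noteq> 0"
proof (cases "Im z = 0")
  case True
  then have "vertical_moment 0 (deriv Q) z = integral (cbox (-1) 1) (\<lambda>t::real. deriv Q (Complex (Re z) 0))"
    by (simp add: vertical_moment_def)
  also have "\<dots> = 2 * exp (\<i> * h (Complex (Re z) 0))" by (simp add: deriv_Q scaleR_conv_of_real)
  finally show ?thesis by (simp add: q_def)
next
  case False
  have pos: "W w \<noteq> 0" if "w \<in> strip" "0 < Im w" for w
    using radial(2)[OF that] radius_pos[OF that(2)] by auto
  have "W z \<noteq> 0"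
    using False pos[of z] pos[of "cnj z"] z cnj_strip[OF z] by (cases "0 < Im z") (auto simp: W_cnj)
  then show ?thesis using W_eq_q by auto
qed

lemma \<sigma>_eq: "\<sigma> z = Im z * cmod (q z)"
  by (simp add: \<sigma>_def powr_half_sqrt norm_eq_sqrt_inner)

lemma abs_\<sigma>: "\<bar>\<sigma> z\<bar> = cmod (W z)"
  by (simp add: \<sigma>_eq W_eq_q abs_mult)

lemma norm_\<Phi>: "norm (\<Phi> z) = cmod (G z)"
proof -
  have "(cmod (W z))\<^sup>2 = (\<sigma> z)\<^sup>2" by (simp flip: abs_\<sigma>)
  then show ?thesis by (simp add: \<Phi>_def norm_space_vec G_def cmod_def add.commute)
qed

lemma Ck_q: "Ck_on k UNIV q"
  unfolding q_def
  by (intro Ck_on_mult Ck_on_const Ck_on_vertical_moment holomorphic_deriv Q_holomorphic open_UNIV)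

lemma Ck_norm_q: "Ck_on k strip (\<lambda>z. (q z \<bullet> q z) powr (1 / 2))"
proof (rule Ck_on_powr[OF open_strip])
  show "0 < q z \<bullet> q z" if "z \<in> strip" for z using q_nonzero[OF that] by simp
  have "Ck_on k strip q" for k by (rule Ck_on_subset[OF Ck_q]) simp
  then show "Ck_on k strip (\<lambda>z. q z \<bullet> q z)" for k
    by (intro Ck_on_bounded_bilinear[OF bounded_bilinear_inner open_strip])
qed

lemma Ck_\<sigma>: "Ck_on k strip \<sigma>"
  unfolding \<sigma>_def
  by (intro Ck_on_mult open_strip Ck_norm_q Ck_on_linear bounded_linear_Im)

definition s1 :: "complex \<Rightarrow> real" where "s1 z = frechet_derivative \<sigma> (at z) 1"
definition s2 :: "complex \<Rightarrow> real" where "s2 z = frechet_derivative \<sigma> (at z) \<i>"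

lemma has_derivative_\<sigma>:
  assumes "z \<in> strip"
  shows "(\<sigma> has_derivative (\<lambda>w. Re w * s1 z + Im w * s2 z)) (at z)"
proof -
  have d: "(\<sigma> has_derivative frechet_derivative \<sigma> (at z)) (at z)"
    by (rule Ck_on_has_derivative[OF Ck_\<sigma> assms])
  then have lin: "linear (frechet_derivative \<sigma> (at z))" by (rule has_derivative_linear)
  have "frechet_derivative \<sigma> (at z) w = Re w * s1 z + Im w * s2 z" for w
  proof -
    have "w = Re w *\<^sub>R 1 + Im w *\<^sub>R \<i>" by (simp add: complex_eq_iff)
    then have "frechet_derivative \<sigma> (at z) w = frechet_derivative \<sigma> (at z) (Re w *\<^sub>R 1 + Im w *\<^sub>R \<i>)" by simp
    also have "\<dots> = Re w * s1 z + Im w * s2 z"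
      by (simp add: linear_add[OF lin] linear_scale[OF lin] s1_def s2_def)
    finally show ?thesis .
  qed
  with d show ?thesis by (rule has_derivative_eq_rhs[OF _ ext])
qed

text \<open>Off the axis, differentiating \<open>\<sigma>\<^sup>2 = norm (W)\<^sup>2\<close> reduces
  the claim to \<open>radial\<close>, with the lower half obtained by conjugation. On the axis this
  identity degenerates, and the product rule gives the value norm (q) instead.\<close>

lemma s2_pos:
  assumes z: "z \<in> strip"
  shows "0 < s2 z"
proof (cases "Im z = 0")
  case True
  let ?\<rho> = "\<lambda>z. (q z \<bullet> q z) powr (1 / 2)"
  have "(?\<rho> has_derivative frechet_derivative ?\<rho> (at z)) (at z)" by (rule Ck_on_has_derivative[OF Ck_norm_q z])
  then have "((\<lambda>z. Im z * ?\<rho> z) has_derivative (\<lambda>w. Im z * frechet_derivative ?\<rho> (at z) w + Im w * ?\<rho> z)) (at z)"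
    by (rule has_derivative_mult[OF bounded_linear_imp_has_derivative[OF bounded_linear_Im]])
  then have "(\<sigma> has_derivative (\<lambda>w. Im z * frechet_derivative ?\<rho> (at z) w + Im w * ?\<rho> z)) (at z)"
    by (simp add: \<sigma>_def[abs_def])
  from fun_cong[OF frechet_derivative_at[OF this], of \<i>] True have "s2 z = ?\<rho> z" by (simp add: s2_def)
  then show ?thesis using q_nonzero[OF z] by simp
next
  case False
  have "((\<lambda>z. \<sigma> z * \<sigma> z) has_derivative
      (\<lambda>w. \<sigma> z * (Re w * s1 z + Im w * s2 z) + (Re w * s1 z + Im w * s2 z) * \<sigma> z)) (at z)"
    by (intro has_derivative_mult has_derivative_\<sigma> z)
  moreover have "((\<lambda>z. W z \<bullet> W z) has_derivative (\<lambda>w. W z \<bullet> W' z w + W' z w \<bullet> W z)) (at z)"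
    by (intro has_derivative_inner has_derivative_W)
  moreover have "(\<lambda>z. \<sigma> z * \<sigma> z) = (\<lambda>z. W z \<bullet> W z)"
    by (simp add: fun_eq_iff power2_norm_eq_inner[symmetric] power2_eq_square flip: abs_\<sigma>)
  ultimately have "(\<lambda>w. \<sigma> z * (Re w * s1 z + Im w * s2 z) + (Re w * s1 z + Im w * s2 z) * \<sigma> z)
      = (\<lambda>w. W z \<bullet> W' z w + W' z w \<bullet> W z)" by (simp only: has_derivative_unique)
  from fun_cong[OF this, of \<i>] have eq: "\<sigma> z * s2 z = W z \<bullet> W' z \<i>" by (simp add: inner_commute)
  have q: "0 < cmod (q z)" using q_nonzero[OF z] by simp
  show ?thesis
  proof (cases "0 < Im z")
    case True
    then have "0 < \<sigma> z * s2 z" using radial(1)[OF z] eq by simp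
    moreover have "0 < \<sigma> z" using True q by (simp add: \<sigma>_eq)
    ultimately show ?thesis by (simp add: zero_less_mult_iff)
  next
    case neg: False
    have "W' (cnj z) \<i> = W' z \<i>" by (simp add: W'_def u_cnj v_cnj)
    moreover have "0 < W (cnj z) \<bullet> W' (cnj z) \<i>" using neg False by (intro radial(1) cnj_strip z) simp
    ultimately have "\<sigma> z * s2 z < 0" using eq by (simp add: W_cnj)
    moreover have "\<sigma> z < 0" using neg False q by (simp add: \<sigma>_eq mult_less_0_iff)
    ultimately show ?thesis by (simp add: mult_less_0_iff)
  qed
qed

lemma \<sigma>_vertical:
  assumes "Complex x t \<in> strip"
  shows "((\<lambda>t. \<sigma> (Complex x t)) has_real_derivative s2 (Complex x t)) (at t)"
proof -
  have "((\<lambda>t. complex_of_real x + \<i> * of_real t) has_derivative (\<lambda>h. \<i> * of_real h)) (at t)"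
    by (auto intro!: derivative_eq_intros)
  then have "((\<lambda>t. Complex x t) has_derivative (\<lambda>h. \<i> * of_real h)) (at t)" by (simp add: Complex_eq)
  from has_derivative_compose[OF this has_derivative_\<sigma>[OF assms]]
  show ?thesis unfolding has_field_derivative_def
    by (rule has_derivative_eq_rhs) (simp add: fun_eq_iff mult.commute)
qed

lemma inj_G: "inj_on G strip"
proof -
  have False if z: "z \<in> strip" "w \<in> strip" "G z = G w" and less: "Im z < Im w" for z w
  proof -
    have eq: "Re z = Re w" "\<sigma> z = \<sigma> w" using z(3) by (auto simp: G_def)
    have "\<sigma> (Complex (Re z) (Im z)) < \<sigma> (Complex (Re z) (Im w))"
    proof (rule DERIV_pos_imp_increasing[OF less])
      fix t assume t: "Im z \<le> t" "t \<le> Im w"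
      then have "Complex (Re z) t \<in> strip" using z(1,2) by (auto simp: strip_def)
      then show "\<exists>d. ((\<lambda>t. \<sigma> (Complex (Re z) t)) has_real_derivative d) (at t) \<and> 0 < d"
        using \<sigma>_vertical s2_pos by blast
    qed
    moreover have "Complex (Re z) (Im z) = z" "Complex (Re z) (Im w) = w" using eq by (simp_all add: complex_eq_iff)
    ultimately show False using eq by simp
  qed
  then show ?thesis unfolding inj_on_def G_def by (metis complex.inject complex_eqI linorder_neqE)
qed

definition \<psi> :: "complex \<Rightarrow> complex" where "\<psi> = inv_into strip G"

lemma Ck_s1: "Ck_on k strip s1"
  unfolding s1_def by (intro Ck_on_frechet_derivative Ck_\<sigma>)

lemma Ck_s2: "Ck_on k strip s2"
  unfolding s2_def by (intro Ck_on_frechet_derivative Ck_\<sigma>)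

lemma
  shows open_G: "open (G ` strip)"
    and has_derivative_\<psi>: "p \<in> G ` strip \<Longrightarrow> (\<psi> has_derivative (\<lambda>w. Complex (Re w)
        ((Im w - s1 (\<psi> p) * Re w) / s2 (\<psi> p)))) (at p)"
    and Ck_\<psi>: "Ck_on k (G ` strip) \<psi>"
proof -
  have inj: "inj_on (\<lambda>z. Complex (Re z) (\<sigma> z)) strip" using inj_G by (simp add: G_def[abs_def])
  note * = fibred_inverse[OF open_strip inj has_derivative_\<sigma> Ck_s1 Ck_s2 s2_pos]
  show "open (G ` strip)" using *(1) by (simp add: G_def[abs_def])
  show "(\<psi> has_derivative (\<lambda>w. Complex (Re w) ((Im w - s1 (\<psi> p) * Re w) / s2 (\<psi> p)))) (at p)"
    if "p \<in> G ` strip"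
    using *(2)[of p] that by (simp add: G_def[abs_def] \<psi>_def)
  show "Ck_on k (G ` strip) \<psi>" using *(3) by (simp add: G_def[abs_def] \<psi>_def)
qed

lemma \<psi>: "p \<in> G ` strip \<Longrightarrow> \<psi> p \<in> strip" "p \<in> G ` strip \<Longrightarrow> G (\<psi> p) = p" "z \<in> strip \<Longrightarrow> \<psi> (G z) = z"
  using inj_G by (auto simp: \<psi>_def inv_into_into f_inv_into_f)

text \<open>On every vertical line \<sigma> runs continuously from at most -R to at least R between
  the heights \<open>- Y / 2\<close> and \<open>Y / 2\<close>, so the intermediate value theorem
  hits each point of the disk. Half of the width keeps the closed segment inside the open
  strip.\<close>

lemma cball_subset_G:
  assumes R: "R \<le> radius (Y / 2)"
  shows "cball 0 R \<subseteq> G ` strip"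
proof
  fix p assume p: "p \<in> cball (0::complex) R"
  define x where "x = Re p"
  have Ims: "\<bar>Im p\<bar> \<le> R" using p abs_Im_le_cmod[of p] by simp
  have st: "Complex x t \<in> strip" if "\<bar>t\<bar> \<le> Y / 2" for t using that Y(1) by (simp add: strip_def)
  have top: "Complex x (Y / 2) \<in> strip" "Complex x (- (Y / 2)) \<in> strip" using st Y(1) by auto
  have W: "R \<le> cmod (W (Complex x (Y / 2)))" using radial(2)[OF top(1)] R Y(1) by simp
  have "Complex x (- (Y / 2)) = cnj (Complex x (Y / 2))" by (simp add: complex_eq_iff)
  then have W': "R \<le> cmod (W (Complex x (- (Y / 2))))" using W by (simp add: W_cnj)
  have "\<sigma> (Complex x (Y / 2)) \<ge> 0" "\<sigma> (Complex x (- (Y / 2))) \<le> 0"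
    using Y(1) by (simp_all add: \<sigma>_eq mult_le_0_iff)
  then have "\<sigma> (Complex x (- (Y / 2))) \<le> Im p \<and> Im p \<le> \<sigma> (Complex x (Y / 2))"
    using W W' Ims abs_\<sigma>[of "Complex x (Y / 2)"] abs_\<sigma>[of "Complex x (- (Y / 2))"] by linarith
  moreover have "continuous_on {- (Y / 2)..Y / 2} (\<lambda>t. \<sigma> (Complex x t))"
  proof (intro continuous_at_imp_continuous_on ballI)
    fix t assume "t \<in> {- (Y / 2)..Y / 2}"
    then have "Complex x t \<in> strip" by (intro st) (auto simp: abs_le_iff)
    then show "isCont (\<lambda>t. \<sigma> (Complex x t)) t" by (rule DERIV_isCont[OF \<sigma>_vertical])
  qed
  ultimately obtain t where t: "- (Y / 2) \<le> t" "t \<le> Y / 2" "\<sigma> (Complex x t) = Im p"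
    using IVT'[of "\<lambda>t. \<sigma> (Complex x t)" "- (Y / 2)" "Im p" "Y / 2"] Y(1) by auto
  have "G (Complex x t) = p" using t(3) by (simp add: G_def x_def complex_eq_iff)
  moreover have "Complex x t \<in> strip" using t by (intro st) auto
  ultimately show "p \<in> G ` strip" by blast
qed

section \<open>Assembly of the compact embedded minimal disk\<close>

definition plane :: "real^2 \<Rightarrow> complex" where "plane p = Complex (p $ 1) (p $ 2)"

lemma bounded_linear_plane: "bounded_linear plane"
proof -
  have "linear plane" by (rule linearI) (simp_all add: plane_def complex_eq_iff)
  then show ?thesis by (simp add: linear_conv_bounded_linear)
qed

lemma cmod_plane: "cmod (plane p) = norm p"
  by (simp add: plane_def cmod_def norm_vec_def L2_set_def sum_2)

lemma inj_plane: "inj plane"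
  by (rule injI) (simp add: plane_def vec_eq_iff forall_2)

lemma surj_plane: "plane (vector [Re w, Im w]) = w"
  by (simp add: plane_def)

text \<open>On the strip the modulus of cosine is at most \<open>cosh (Im z)\<close>, hence at most
  2, and \<open>3 + \<mu>\<close> is at most twice \<open>2 + \<mu>\<close>. The factor 2 here
  becomes the factor 4 allowed for the squared curvature in a blow-up pair.\<close>

lemma h'_bound:
  assumes z: "z \<in> strip"
  shows "cmod (h' z) \<le> 2 * cmod (h' 0)"
proof -
  have "cos z = (exp (\<i> * z) + exp (- (\<i> * z))) / 2" by (simp add: cos_exp_eq)
  then have "cmod (cos z) = cmod (exp (\<i> * z) + exp (- (\<i> * z))) / 2"
    by (simp only: norm_divide norm_numeral)
  also have "\<dots> \<le> (cmod (exp (\<i> * z)) + cmod (exp (- (\<i> * z)))) / 2"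
    by (intro divide_right_mono norm_triangle_ineq) simp
  also have "\<dots> = cosh (Im z)" by (simp add: cosh_field_def add.commute)
  also have "\<dots> \<le> 1 + (Im z)\<^sup>2" using z Y(2) by (intro cosh_le_one_plus_square) (simp add: strip_def)
  also have "\<dots> \<le> 2" using z Y(2) by (simp add: strip_def power2_le_iff_abs_le abs_square_le_1)
  finally have "cmod (of_real (1 + \<mu>) + cos z) \<le> 1 + \<mu> + 2"
    using norm_triangle_ineq[of "of_real (1 + \<mu>)" "cos z"] \<mu> by (simp del: of_real_add)
  then have "cmod (h' z) \<le> B * (1 + \<mu> + 2)"
    unfolding h'_def norm_mult using B by (simp add: mult_left_mono)
  also have "\<dots> \<le> B * (2 * (2 + \<mu>))" using B \<mu> by (intro mult_left_mono) auto
  also have "\<dots> = 2 * cmod (h' 0)"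
  proof -
    have "h' 0 = of_real (B * (2 + \<mu>))" by (simp add: h'_def)
    then show ?thesis using B \<mu> by (simp add: norm_mult del: of_real_add of_real_mult)
  qed
  finally show ?thesis .
qed

lemma \<Phi>_inj: "\<lbrakk>z \<in> strip; w \<in> strip; \<Phi> z = \<Phi> w\<rbrakk> \<Longrightarrow> z = w"
  using W_inj[of z w] by (simp add: \<Phi>_def space_vec_eq_iff)

lemma conformal_chart_sublevel:
  assumes cont: "continuous_on (\<Phi> ` {z \<in> strip. norm (\<Phi> z) < r}) (inv_into {z \<in> strip. norm (\<Phi> z) < r} \<Phi>)"
  shows "conformal_chart \<Phi> \<Phi>' {z \<in> strip. norm (\<Phi> z) < r} (\<lambda>z. cosh (v z))"
proof
  have "continuous_on strip \<Phi>"
    using has_derivative_\<Phi> by (intro continuous_at_imp_continuous_on ballI has_derivative_continuous)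
  then have "open (strip \<inter> (\<lambda>z. norm (\<Phi> z)) -` {..<r})"
    by (intro continuous_open_preimage continuous_on_norm open_strip) auto
  then show "open {z \<in> strip. norm (\<Phi> z) < r}" by (simp add: Int_def vimage_def)
  show "inj_on \<Phi> {z \<in> strip. norm (\<Phi> z) < r}"
    by (rule inj_onI) (auto intro: \<Phi>_inj)
  show "(\<Phi> has_derivative \<Phi>' z) (at z)" for z by (rule has_derivative_\<Phi>)
  show "norm (\<Phi>' z w) = cosh (v z) * norm w" for z w by (rule norm_\<Phi>')
  show "continuous_on {z \<in> strip. norm (\<Phi> z) < r} (\<lambda>z. \<Phi>' z w)" for w by (rule continuous_\<Phi>')
  show "0 < cosh (v z)" for z by simp
qed (rule cont)

text \<open>With F the composition of \<Phi>, the inverse of G and scaling by R, one has norm (F p)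
  = R norm (p) near the closed disk. The boundary thus lies on a sphere, and a smaller concentric
  ball cuts out the image of a disk. This image is connected, so the component of 0 is the whole
  intersection.\<close>

lemma embedded_disk:
  assumes R: "0 < R" "R \<le> radius (Y / 2)" and r: "0 < r" "r < R"
  obtains F where "compact_embedded_minimal_disk F" "0 \<in> surface F" "surface_boundary F \<subseteq> sphere 0 R"
    "A_sq F 0 = 2 * (cmod (h' 0))\<^sup>2" "\<And>x. x \<in> surface F \<Longrightarrow> A_sq F x \<le> 4 * A_sq F 0"
    "connected_component_set (ball 0 r \<inter> surface F) 0 = \<Phi> ` {z \<in> strip. norm (\<Phi> z) < r}"
    "conformal_chart \<Phi> \<Phi>' {z \<in> strip. norm (\<Phi> z) < r} (\<lambda>z. cosh (v z))"
proof -
  define m where "m p = R *\<^sub>R plane p" for p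
  define V where "V = m -` (G ` strip)"
  define \<xi> where "\<xi> p = \<psi> (m p)" for p
  define F where "F p = \<Phi> (\<xi> p)" for p
  have blm: "bounded_linear m"
    unfolding m_def by (rule bounded_linear_compose[OF bounded_linear_scaleR_right bounded_linear_plane])
  have V: "open V" unfolding V_def
    by (intro open_vimage open_G linear_continuous_on blm)
  have cV: "cball 0 1 \<subseteq> V"
  proof
    fix p :: "real^2" assume "p \<in> cball 0 1"
    then have "cmod (m p) \<le> R * 1" using R(1) by (auto simp: m_def cmod_plane intro!: mult_left_mono)
    then show "p \<in> V" using cball_subset_G[OF R(2)] by (auto simp: V_def)
  qed
  have mV: "p \<in> V \<Longrightarrow> m p \<in> G ` strip" for p by (simp add: V_def)
  have \<xi>: "\<xi> p \<in> strip" "G (\<xi> p) = m p" if "p \<in> V" for p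
    using \<psi> mV[OF that] by (auto simp: \<xi>_def)
  have normF: "norm (F p) = R * norm p" if "p \<in> V" for p
    using \<xi>(2)[OF that] R(1) by (simp add: F_def norm_\<Phi> m_def cmod_plane)
  have Ck\<xi>: "Ck_on k V \<xi>" for k
    unfolding \<xi>_def by (rule Ck_on_compose[OF V open_G Ck_\<psi> Ck_on_linear[OF blm V]]) (auto simp: V_def)
  have CkW: "Ck_on k UNIV W" for k
    unfolding W_eq_q[abs_def]
    by (intro Ck_on_scaleR Ck_q open_UNIV Ck_on_linear bounded_linear_Im)
  have Ck\<Phi>: "Ck_on k UNIV \<Phi>" for k
    unfolding \<Phi>_def[abs_def] space_vec_eq_sum
    by (intro Ck_on_add Ck_on_scaleR Ck_on_const open_UNIV CkW Ck_on_linear[OF bounded_linear_Re]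
        Ck_on_bounded_linear[OF bounded_linear_Re] Ck_on_bounded_linear[OF bounded_linear_Im])
  have CkF: "Ck_on k V F" for k
    unfolding F_def by (rule Ck_on_compose[OF V open_UNIV Ck\<Phi> Ck\<xi>]) simp
  define \<psi>' where "\<psi>' p w = Complex (Re w) ((Im w - s1 (\<psi> p) * Re w) / s2 (\<psi> p))" for p w
  have der\<xi>: "(\<xi> has_derivative (\<lambda>w. \<psi>' (m q) (m w))) (at q)" if "q \<in> V" for q
    unfolding \<xi>_def \<psi>'_def
    by (rule has_derivative_compose[OF bounded_linear_imp_has_derivative[OF blm] has_derivative_\<psi>[OF mV[OF that]]])
  have inj\<xi>': "inj (\<lambda>w. \<psi>' (m q) (m w))" if "q \<in> V" for q
  proof (rule injI)
    fix x y assume eq: "\<psi>' (m q) (m x) = \<psi>' (m q) (m y)"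
    have "s2 (\<psi> (m q)) > 0" using s2_pos \<xi>(1)[OF that] by (simp add: \<xi>_def)
    with eq have "m x = m y" by (auto simp: \<psi>'_def complex_eq_iff)
    then show "x = y" using R(1) inj_plane by (simp add: m_def inj_eq)
  qed
  have F_eq: "F = (\<lambda>p. \<Phi> (\<xi> p))" by (simp add: F_def fun_eq_iff)
  have curv: "mean_curvature F p = 0" "sff_norm_sq F p = 2 * (cmod (h' (\<xi> p)))\<^sup>2 / cosh (v (\<xi> p)) ^ 4"
      "inj (frechet_derivative F (at p))" if "p \<in> V" for p
    using curvature[where \<xi> = \<xi> and \<xi>' = "\<lambda>q w. \<psi>' (m q) (m w)", OF V that CkF[unfolded F_eq] der\<xi> inj\<xi>'[OF that]]
    by (simp_all add: F_eq)
  have \<xi>_inj: "p = p'" if p: "p \<in> V" "p' \<in> V" "F p = F p'" for p p'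
  proof -
    have "\<xi> p = \<xi> p'" using p(3) by (intro \<Phi>_inj \<xi>(1) p(1,2)) (simp add: F_def)
    then have "m p = m p'" using \<xi>(2)[OF p(1)] \<xi>(2)[OF p(2)] by simp
    then show ?thesis using R(1) inj_plane by (simp add: m_def inj_eq)
  qed
  have injF: "inj_on F (cball 0 1)" using \<xi>_inj cV by (auto simp: inj_on_def)
  have AF: "A_sq F (F p) = 2 * (cmod (h' (\<xi> p)))\<^sup>2 / cosh (v (\<xi> p)) ^ 4" if "p \<in> cball 0 1" for p
    using that cV injF curv(2)[of p] by (auto simp: A_sq_def)
  have "m 0 = 0" using blm by (simp add: linear_simps)
  moreover have "G 0 = 0" by (simp add: G_def \<sigma>_def complex_eq_iff)
  moreover have "0 \<in> strip" using Y by (simp add: strip_def)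
  ultimately have \<xi>0: "\<xi> 0 = 0" using \<psi>(3)[of 0] by (simp add: \<xi>_def)
  have F0: "F 0 = 0"
    using W_real[of 0] by (simp add: F_def \<xi>0 \<Phi>_def vec_eq_iff forall_3)
  have A0: "A_sq F 0 = 2 * (cmod (h' 0))\<^sup>2" using AF[of 0] by (simp add: F0 \<xi>0 v_eq)
  have contF: "continuous_on (cball 0 1) F"
    using CkF[of 0] cV by (auto elim: continuous_on_subset)
  have "r / R \<le> 1" using r by simp
  then have sub: "ball 0 (r / R) \<subseteq> cball (0 :: real^2) 1" by auto
  have img: "\<Phi> ` {z \<in> strip. norm (\<Phi> z) < r} = F ` ball 0 (r / R)"
  proof (intro equalityI subsetI)
    fix x assume "x \<in> \<Phi> ` {z \<in> strip. norm (\<Phi> z) < r}"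
    then obtain z where z: "z \<in> strip" "norm (\<Phi> z) < r" "x = \<Phi> z" by auto
    define p where "p = (vector [Re (G z /\<^sub>R R), Im (G z /\<^sub>R R)] :: real^2)"
    have "plane p = G z /\<^sub>R R" unfolding p_def by (rule surj_plane)
    then have mp: "m p = G z" using R(1) by (simp add: m_def)
    then have "\<xi> p = z" using \<psi>(3)[OF z(1)] by (simp add: \<xi>_def)
    then have Fp: "F p = x" by (simp add: F_def z)
    have "p \<in> V" using mp z(1) by (simp add: V_def)
    then have "norm p < r / R" using normF[of p] Fp z R(1) by (simp add: field_simps)
    then show "x \<in> F ` ball 0 (r / R)" using Fp by auto
  next
    fix x assume "x \<in> F ` ball 0 (r / R)"
    then obtain p where p: "norm p < r / R" "x = F p" by auto
    then have "p \<in> V" using sub cV by auto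
    then show "x \<in> \<Phi> ` {z \<in> strip. norm (\<Phi> z) < r}"
      using p \<xi>(1) normF[of p] R(1) by (auto simp: F_def field_simps)
  qed
  show ?thesis
  proof (rule that[of F])
    show "compact_embedded_minimal_disk F"
      unfolding compact_embedded_minimal_disk_def compact_embedded_disk_def smooth_on_open_def
      using cV V CkF injF curv(1,3) by blast
    show "0 \<in> surface F" unfolding surface_def by (rule image_eqI[of _ _ 0]) (simp_all add: F0)
    show "surface_boundary F \<subseteq> sphere 0 R"
    proof
      fix x assume "x \<in> surface_boundary F"
      then obtain p where p: "norm p = 1" "x = F p" by (auto simp: surface_boundary_def)
      then have "p \<in> V" using cV by auto
      then show "x \<in> sphere 0 R" using normF[of p] p by simp
    qed
    show "A_sq F 0 = 2 * (cmod (h' 0))\<^sup>2" by (rule A0)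
    show "A_sq F x \<le> 4 * A_sq F 0" if x: "x \<in> surface F" for x
    proof -
      obtain p where p: "p \<in> cball 0 1" "x = F p" using x by (auto simp: surface_def)
      define z where "z = \<xi> p"
      \<comment> \<open>Since the factor cosh only lowers curvature, the bound holds on the entire
        surface and not just in the ball of radius s.\<close>
      have "1 \<le> cosh (v z) ^ 4" by (rule one_le_power) (rule cosh_real_ge_1)
      then have "2 * (cmod (h' z))\<^sup>2 / cosh (v z) ^ 4 \<le> 2 * (cmod (h' z))\<^sup>2 / 1"
        by (intro divide_left_mono) auto
      moreover have "z \<in> strip" using \<xi>(1)[of p] p(1) cV by (auto simp: z_def)
      then have "(cmod (h' z))\<^sup>2 \<le> (2 * cmod (h' 0))\<^sup>2" by (intro power_mono h'_bound) auto
      then have "2 * (cmod (h' z))\<^sup>2 / 1 \<le> 2 * (2 * cmod (h' 0))\<^sup>2" by simp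
      ultimately have "2 * (cmod (h' z))\<^sup>2 / cosh (v z) ^ 4 \<le> 2 * (2 * cmod (h' 0))\<^sup>2" by linarith
      then show ?thesis using AF[OF p(1)] by (simp add: p(2) A0 z_def power_mult_distrib)
    qed
    have "ball 0 r \<inter> surface F = F ` ball 0 (r / R)"
    proof (intro equalityI subsetI)
      fix x assume "x \<in> ball 0 r \<inter> surface F"
      then obtain p where "p \<in> cball 0 1" "x = F p" "norm x < r" by (auto simp: surface_def)
      then show "x \<in> F ` ball 0 (r / R)"
        using normF[of p] cV R(1) by (auto simp: field_simps)
    next
      fix x assume "x \<in> F ` ball 0 (r / R)"
      then obtain p where p: "norm p < r / R" "x = F p" by auto
      then have "p \<in> cball 0 1" using sub by auto
      then show "x \<in> ball 0 r \<inter> surface F"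
        using p normF[of p] cV R(1) by (auto simp: surface_def field_simps)
    qed
    moreover have "connected (F ` ball 0 (r / R))"
      using contF sub by (intro connected_continuous_image) (auto elim: continuous_on_subset)
    moreover have "0 \<in> F ` ball 0 (r / R)" using F0 r by (intro image_eqI[of _ _ 0]) simp_all
    ultimately show "connected_component_set (ball 0 r \<inter> surface F) 0 = \<Phi> ` {z \<in> strip. norm (\<Phi> z) < r}"
      unfolding img by (simp add: connected_component_eq_self)
    show "conformal_chart \<Phi> \<Phi>' {z \<in> strip. norm (\<Phi> z) < r} (\<lambda>z. cosh (v z))"
    proof (rule conformal_chart_sublevel)
      \<comment> \<open>Continuity of the inverse comes from compactness: F is a homeomorphism from
        the closed disk onto its image, and composing its inverse with \<xi> gives the inverse of
        \<Phi>.\<close>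
      let ?D = "{z \<in> strip. norm (\<Phi> z) < r}"
      have "continuous_on (F ` cball 0 1) (inv_into (cball 0 1) F)"
        by (rule continuous_on_inv[OF contF]) (use injF in auto)
      then have c1: "continuous_on (\<Phi> ` ?D) (inv_into (cball 0 1) F)"
        unfolding img by (rule continuous_on_subset) (use sub in auto)
      have "continuous_on (cball 0 1) \<xi>" using Ck\<xi>[of 0] cV by (auto elim: continuous_on_subset)
      then have "continuous_on (\<Phi> ` ?D) (\<lambda>x. \<xi> (inv_into (cball 0 1) F x))"
        by (rule continuous_on_compose2[OF _ c1]) (use sub in \<open>auto simp: img injF intro!: inv_into_into\<close>)
      moreover have "\<xi> (inv_into (cball 0 1) F x) = inv_into ?D \<Phi> x" if x: "x \<in> \<Phi> ` ?D" for x
      proof -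
        obtain p where p: "p \<in> ball 0 (r / R)" "x = F p" using x img by auto
        then have pc: "p \<in> cball 0 1" "p \<in> V" using sub cV by auto
        have "inv_into ?D \<Phi> x \<in> ?D" using x by (rule inv_into_into)
        moreover have "\<Phi> (inv_into ?D \<Phi> x) = x" using x by (rule f_inv_into_f)
        ultimately have "inv_into ?D \<Phi> x = \<xi> p"
          using \<xi>(1)[OF pc(2)] by (intro \<Phi>_inj) (auto simp: p(2) F_def)
        moreover have "inv_into (cball 0 1) F x = p" using p pc injF by simp
        ultimately show ?thesis by simp
      qed
      ultimately show "continuous_on (\<Phi> ` ?D) (inv_into ?D \<Phi>)" by (metis (no_types, lifting) continuous_on_cong)
    qed
  qed
qed

end

section \<open>The two pitches\<close>

lemma abs_sinh_diff_le:
  assumes "\<bar>y::real\<bar> \<le> 1"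
  shows "\<bar>sinh y - y\<bar> \<le> y\<^sup>2"
proof -
  have main: "0 \<le> sinh y - y \<and> sinh y - y \<le> y\<^sup>2" if y: "0 \<le> y" "y \<le> 1" for y :: real
  proof
    have "sinh 0 - 0 \<le> sinh y - y"
    proof (rule DERIV_nonneg_imp_nondecreasing[OF y(1)])
      fix x :: real
      show "\<exists>d. ((\<lambda>t. sinh t - t) has_real_derivative d) (at x) \<and> 0 \<le> d"
        using cosh_real_ge_1[of x] by (intro exI[of _ "cosh x - 1"]) (auto intro!: derivative_eq_intros)
    qed
    then show "0 \<le> sinh y - y" by simp
    have "y ^ 3 \<le> y ^ 2" using y by (intro power_decreasing) auto
    then show "sinh y - y \<le> y\<^sup>2" using sinh_le_cubic[OF y] by linarith
  qed
  show ?thesis using main[of "\<bar>y\<bar>"] assms by (cases "0 \<le> y") auto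
qed

context modulated_helicoid
begin

text \<open>The condition \<open>sin t = 0\<close> makes t a critical point of h', so the deviation
  of v from that of a helicoid of pitch p is quadratic: at most
  \<open>2 * B * \<rho>\<^sup>2\<close>. The same smallness condition puts the disk inside the
  strip.\<close>

lemma pitch_near:
  assumes t: "sin t = 0" and p: "p = 1 / (B * (1 + \<mu> + cos t))" "1 + \<mu> + cos t > 0"
    and \<rho>: "2 * B * \<rho>\<^sup>2 < 1" and z: "dist (of_real t) z \<le> \<rho>"
  shows "z \<in> strip" "\<bar>v z - Im z / p\<bar> \<le> 1"
proof -
  define x y where "x = Re z - t" "y = Im z"
  have "\<bar>Re (z - of_real t)\<bar> \<le> \<rho>" "\<bar>Im (z - of_real t)\<bar> \<le> \<rho>"
    using z abs_Re_le_cmod[of "z - of_real t"] abs_Im_le_cmod[of "z - of_real t"]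
    by (auto simp: dist_norm norm_minus_commute)
  then have xy: "\<bar>x\<bar> \<le> \<rho>" "\<bar>y\<bar> \<le> \<rho>" by (simp_all add: x_y_def)
  have \<rho>0: "0 \<le> \<rho>" using xy by linarith
  have "B * \<rho>\<^sup>2 < B * Y\<^sup>2" using \<rho> Y(3) by simp
  then have "\<rho>\<^sup>2 < Y\<^sup>2" using B by simp
  then have \<rho>Y: "\<rho> < Y" using Y(1) by (simp add: power2_less_imp_less)
  then show "z \<in> strip" using xy by (simp add: strip_def x_y_def)
  have y1: "\<bar>y\<bar> \<le> 1" using xy \<rho>Y Y(2) by linarith
  have y2: "y\<^sup>2 \<le> \<rho>\<^sup>2" using xy \<rho>0 by (intro power2_le_iff_abs_le[THEN iffD2]) auto
  have "\<bar>sinh y - y\<bar> \<le> y\<^sup>2" by (rule abs_sinh_diff_le[OF y1])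
  also have "y\<^sup>2 \<le> \<rho>\<^sup>2" by (rule y2)
  finally have 1: "\<bar>sinh y - y\<bar> \<le> \<rho>\<^sup>2" .
  have s2: "\<bar>sinh y\<bar> \<le> 2"
    using abs_sinh_diff_le[OF y1] y1 abs_square_le_1[of y] by linarith
  have c: "\<bar>cos x - 1\<bar> \<le> \<rho>\<^sup>2 / 2"
  proof -
    have "cos x - 1 = - (2 * (sin (x / 2))\<^sup>2)" using cos_double_sin[of "x / 2"] by simp
    moreover have "(sin (x / 2))\<^sup>2 \<le> (\<rho> / 2)\<^sup>2"
      using abs_sin_x_le_abs_x[of "x / 2"] xy \<rho>0 by (intro power2_le_iff_abs_le[THEN iffD2]) auto
    ultimately show ?thesis by (simp add: power2_eq_square)
  qed
  have "\<bar>(cos x - 1) * sinh y\<bar> \<le> \<rho>\<^sup>2 / 2 * 2" unfolding abs_mult using c s2 by (intro mult_mono) auto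
  then have 2: "\<bar>cos x * sinh y - y\<bar> \<le> 2 * \<rho>\<^sup>2" using 1 by (simp add: algebra_simps)
  have ct: "\<bar>cos t\<bar> = 1" using t sin_cos_squared_add[of t] by (simp add: power2_eq_1_iff) auto
  have "cos (Re z) = cos t * cos x" using cos_add[of t x] t by (simp add: x_y_def)
  then have "v z - Im z / p = B * (cos t * (cos x * sinh y - y))"
    unfolding v_eq p(1) using B p(2) by (simp add: x_y_def[symmetric] algebra_simps)
  then have "\<bar>v z - Im z / p\<bar> = B * \<bar>cos x * sinh y - y\<bar>" using B ct by (simp add: abs_mult)
  also have "\<dots> \<le> B * (2 * \<rho>\<^sup>2)" using 2 B by (intro mult_left_mono) auto
  finally show "\<bar>v z - Im z / p\<bar> \<le> 1" using \<rho> by simp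
qed

text \<open>The axis point over t has height t, so its norm is at most 4. By the mean value
  inequality the disk of A pitches around it is mapped within distance 1 of this point, hence into
  the ball of radius 5.\<close>

lemma pitch_ball:
  fixes A :: real
  assumes t: "sin t = 0" "\<bar>t\<bar> \<le> 4" and p: "p = 1 / (B * (1 + \<mu> + cos t))" "1 + \<mu> + cos t > 0"
    and A: "2 * B * (A * p)\<^sup>2 < 1" "cosh (A + 1) * (A * p) \<le> 1" and r: "5 < r"
    and z: "dist (of_real t) z \<le> A * p"
  shows "z \<in> {z \<in> strip. norm (\<Phi> z) < r} \<and> \<bar>v z - Im z / p\<bar> \<le> 1"
proof -
  note near = pitch_near[OF t(1) p A(1)]
  have p0: "p > 0" using p B by simp
  have "norm (\<Phi> z - \<Phi> (of_real t)) \<le> cosh (A + 1) * norm (z - of_real t)"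
  proof (rule differentiable_bound)
    show "convex (cball (complex_of_real t) (A * p))" by simp
    show "(\<Phi> has_derivative \<Phi>' w) (at w within cball (complex_of_real t) (A * p))" for w
      using has_derivative_\<Phi> by (rule has_derivative_at_withinI)
    show "z \<in> cball (complex_of_real t) (A * p)" using z by simp
    then have "0 \<le> A * p" using zero_le_dist order_trans z by blast
    then show "complex_of_real t \<in> cball (complex_of_real t) (A * p)" by simp
    fix w assume "w \<in> cball (complex_of_real t) (A * p)"
    then have w: "dist (of_real t) w \<le> A * p" by simp
    have "\<bar>Im (w - of_real t)\<bar> \<le> A * p"
      using w abs_Im_le_cmod[of "w - of_real t"] by (simp add: dist_norm norm_minus_commute)
    then have "\<bar>Im w / p\<bar> \<le> A" using p0 by (simp add: pos_divide_le_eq)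
    then have "\<bar>v w\<bar> \<le> A + 1" using near(2)[OF w] by linarith
    then have "cosh (v w) \<le> cosh (A + 1)"
      by (metis cosh_real_abs cosh_real_nonneg_le_iff abs_ge_zero order_trans)
    then show "onorm (\<Phi>' w) \<le> cosh (A + 1)"
      by (intro onorm_le) (simp add: norm_\<Phi>' mult_right_mono)
  qed
  also have "\<dots> \<le> cosh (A + 1) * (A * p)"
    using z by (intro mult_left_mono) (simp_all add: dist_norm norm_minus_commute)
  also have "\<dots> \<le> 1" by (rule A(2))
  finally have "norm (\<Phi> z) \<le> 1 + norm (\<Phi> (of_real t))"
    using norm_triangle_sub[of "\<Phi> z" "\<Phi> (of_real t)"] by linarith
  also have "norm (\<Phi> (of_real t)) = \<bar>t\<bar>" by (simp add: \<Phi>_def norm_space_vec W_real)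
  finally have "norm (\<Phi> z) < r" using t(2) r by linarith
  then show ?thesis using near[OF z] by blast
qed

end

section \<open>Choice of the parameters and conclusion\<close>

theorem theorem0p1:
  fixes C \<Omega> \<epsilon> \<gamma> :: real
  assumes "C > 0"
    and "0 < \<Omega>" and "\<Omega> < 1"
    and "0 < \<epsilon>" and "\<epsilon> < 1"
    and "0 \<le> \<gamma>" and "\<gamma> < 1/2"
  shows "\<exists>R s F. R > 0 \<and> s > 0 \<and>
    compact_embedded_minimal_disk F \<and>
    0 \<in> surface F \<and>
    surface_boundary F \<subseteq> sphere 0 R \<and>
    blow_up_pair C F 0 s \<and>
    \<not> bilipschitz_to_helicoid_piece (1 + \<epsilon>)
        (connected_component_set (ball 0 (\<Omega> * R powr (1 - \<gamma>) * s powr \<gamma>) \<inter> surface F) 0)"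
proof -
  obtain N0 where N0: "crowded N0 (1 / 5000)" using ex_crowded[of "1 / 5000"] by auto
  define N where "N = max N0 5"
  have N5: "N \<ge> 5" by (simp add: N_def)
  have N: "crowded N (1 / 5000)" using N0 by (rule crowded_mono) (simp add: N_def)
  define A where "A = real (144 * N)"
  have A: "A > 0" using N5 by (simp add: A_def)
  obtain M where M0: "M > 0" and M: "crowded M (1 / (48 * cosh (144 * N + 1)))"
    using ex_crowded[of "1 / (48 * cosh (144 * N + 1))"] by auto
  \<comment> \<open>The ratio of the two pitches is \<open>(2 + \<mu>) / \<mu> = 2 * M + 1\<close>,
    which exceeds the M required by the counting argument.\<close>
  define \<mu> where "\<mu> = 1 / real M"
  have \<mu>: "0 < \<mu>" "\<mu> \<le> 1" and M\<mu>: "M * \<mu> = 1" using M0 by (auto simp: \<mu>_def)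
  \<comment> \<open>Forced by the blow-up condition: at the origin the squared curvature is
    \<open>2 * (B * (2 + \<mu>))\<^sup>2\<close>, and equating it with
    \<open>C\<^sup>2 / s\<^sup>2\<close> gives \<open>s = K / B\<close>.\<close>
  define K where "K = C / (sqrt 2 * (2 + \<mu>))"
  have K: "K > 0" using assms \<mu> by (simp add: K_def)
  \<comment> \<open>Six conditions on B are collected: the locale hypothesis; the two smallness
    conditions of \<open>pitch_ball\<close> at the larger pitch; \<open>B\<^sup>2\<close> below
    \<open>radius (Y / 2)\<close>, with sinh replaced by the smaller \<open>(exp - 1) / 2\<close>;
    \<open>s < R\<close>; and \<open>R * s\<close> large enough for r to be at least 6.\<close>
  have "\<forall>\<^sub>F B in at_top. 1 \<le> B * \<mu>" using \<mu>(1) by real_asymp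
  moreover have "\<forall>\<^sub>F B in at_top. 2 * B * (A * (1 / (B * \<mu>)))\<^sup>2 < 1" using \<mu>(1) A by real_asymp
  moreover have "\<forall>\<^sub>F B in at_top. cosh (A + 1) * (A * (1 / (B * \<mu>))) \<le> 1"
  proof -
    define L where "L = cosh (A + 1)"
    have "L > 0" by (simp add: L_def)
    then show ?thesis unfolding L_def[symmetric] using \<mu>(1) A by real_asymp
  qed
  moreover have "\<forall>\<^sub>F B in at_top. B\<^sup>2 \<le> (exp (B * \<mu> / 2 * (sqrt (1 / (2 * B)) / 2)) - 1) / 2 / (B * \<mu>)"
    using \<mu>(1) by real_asymp
  moreover have "\<forall>\<^sub>F B in at_top. K / B < B\<^sup>2" using K by real_asymp
  moreover have "\<forall>\<^sub>F B in at_top. 36 / \<Omega>\<^sup>2 \<le> B * K" using K assms(2) by real_asymp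
  ultimately have "\<forall>\<^sub>F B in at_top. 1 \<le> B * \<mu> \<and> 2 * B * (A * (1 / (B * \<mu>)))\<^sup>2 < 1 \<and>
      cosh (A + 1) * (A * (1 / (B * \<mu>))) \<le> 1 \<and>
      B\<^sup>2 \<le> (exp (B * \<mu> / 2 * (sqrt (1 / (2 * B)) / 2)) - 1) / 2 / (B * \<mu>) \<and> K / B < B\<^sup>2 \<and> 36 / \<Omega>\<^sup>2 \<le> B * K"
    by eventually_elim blast
  from eventually_happens'[OF trivial_limit_at_top_linorder this]
  obtain B :: real where "1 \<le> B * \<mu> \<and> 2 * B * (A * (1 / (B * \<mu>)))\<^sup>2 < 1 \<and>
      cosh (A + 1) * (A * (1 / (B * \<mu>))) \<le> 1 \<and>
      B\<^sup>2 \<le> (exp (B * \<mu> / 2 * (sqrt (1 / (2 * B)) / 2)) - 1) / 2 / (B * \<mu>) \<and> K / B < B\<^sup>2 \<and> 36 / \<Omega>\<^sup>2 \<le> B * K" ..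
  then have large: "1 \<le> B * \<mu>" "2 * B * (A * (1 / (B * \<mu>)))\<^sup>2 < 1"
      "cosh (A + 1) * (A * (1 / (B * \<mu>))) \<le> 1"
      "B\<^sup>2 \<le> (exp (B * \<mu> / 2 * (sqrt (1 / (2 * B)) / 2)) - 1) / 2 / (B * \<mu>)" "K / B < B\<^sup>2" "36 / \<Omega>\<^sup>2 \<le> B * K"
    by blast+
  have hol: "(\<lambda>z. exp (\<i> * (of_real B * (of_real (1 + \<mu>) * z + sin z)))) holomorphic_on UNIV"
    by (intro holomorphic_intros)
  obtain Q where Q0: "\<And>z. (Q has_field_derivative exp (\<i> * (of_real B * (of_real (1 + \<mu>) * z + sin z)))) (at z)"
  proof (rule holomorphic_convex_primitive'[OF convex_UNIV open_UNIV hol])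
    fix g assume "\<And>z. z \<in> UNIV \<Longrightarrow>
      (g has_field_derivative exp (\<i> * (of_real B * (of_real (1 + \<mu>) * z + sin z)))) (at z)"
    then show thesis by (intro that[of g]) simp
  qed
  interpret modulated_helicoid B \<mu> Q by unfold_locales (use \<mu> large(1) Q0 in auto)
  define R where "R = B\<^sup>2"
  define s where "s = K / B"
  define r where "r = \<Omega> * R powr (1 - \<gamma>) * s powr \<gamma>"
  have B1: "B \<ge> 1" by (rule B)
  have R: "0 < R" using B1 by (simp add: R_def)
  have s: "0 < s" "s < R" using B1 K large(5) by (auto simp: s_def R_def)
  have R_radius: "R \<le> radius (Y / 2)"
  proof -
    let ?a = "B * \<mu> / 2 * (Y / 2)"
    have "0 \<le> ?a" using B1 \<mu> Y(1) by simp
    then have "exp (- ?a) \<le> 1" by simp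
    then have "(exp ?a - 1) / 2 \<le> sinh ?a" by (simp add: sinh_field_def)
    then have "(exp ?a - 1) / 2 / (B * \<mu>) \<le> radius (Y / 2)"
      unfolding radius_def using large(1) by (intro divide_right_mono) auto
    with large(4) show ?thesis by (simp add: R_def Y_def)
  qed
  have rR: "r < R"
  proof -
    have "R powr (1 - \<gamma>) * s powr \<gamma> \<le> R powr (1 - \<gamma>) * R powr \<gamma>"
      using s assms(6) by (intro mult_left_mono powr_mono2) auto
    also have "\<dots> = R" using R by (simp flip: powr_add)
    finally have "\<Omega> * (R powr (1 - \<gamma>) * s powr \<gamma>) \<le> \<Omega> * R" using assms(2) by (intro mult_left_mono) auto
    also have "\<Omega> * R < 1 * R" by (rule mult_strict_right_mono[OF assms(3) R])
    finally show ?thesis by (simp add: r_def mult.assoc)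
  qed
  \<comment> \<open>Here \<gamma> < 1/2 is used: with \<open>s < R\<close>, moving the exponent
    \<open>1/2 - \<gamma>\<close> from s to R only enlarges the product, so it dominates sqrt (R s).
    The value 6 exceeds the radius 5 demanded by \<open>pitch_ball\<close>.\<close>
  have r6: "6 \<le> r"
  proof -
    have "(R * s) powr (1/2) = R powr (1/2) * s powr (1/2)" using R s by (simp add: powr_mult)
    also have "s powr (1/2) = s powr (1/2 - \<gamma>) * s powr \<gamma>" by (simp flip: powr_add)
    also have "s powr (1/2 - \<gamma>) \<le> R powr (1/2 - \<gamma>)" using s assms(7) by (intro powr_mono2) auto
    then have "R powr (1/2) * (s powr (1/2 - \<gamma>) * s powr \<gamma>) \<le> R powr (1/2) * (R powr (1/2 - \<gamma>) * s powr \<gamma>)"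
      by (intro mult_left_mono mult_right_mono) auto
    also have "\<dots> = R powr (1 - \<gamma>) * s powr \<gamma>" by (simp add: mult.assoc[symmetric] flip: powr_add)
    finally have 1: "(R * s) powr (1/2) \<le> R powr (1 - \<gamma>) * s powr \<gamma>" by simp
    have "(6 / \<Omega>)\<^sup>2 \<le> R * s" using large(6) B1 by (simp add: R_def s_def power_divide power2_eq_square)
    then have "6 / \<Omega> \<le> sqrt (R * s)" by (rule real_le_rsqrt)
    also have "sqrt (R * s) = (R * s) powr (1/2)" using R s by (simp add: powr_half_sqrt)
    finally have "6 / \<Omega> \<le> R powr (1 - \<gamma>) * s powr \<gamma>" using 1 by linarith
    then show ?thesis using assms(2) by (simp add: r_def field_simps)
  qed
  obtain F where F: "compact_embedded_minimal_disk F" "0 \<in> surface F" "surface_boundary F \<subseteq> sphere 0 R"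
    "A_sq F 0 = 2 * (cmod (h' 0))\<^sup>2" "\<And>x. x \<in> surface F \<Longrightarrow> A_sq F x \<le> 4 * A_sq F 0"
    "connected_component_set (ball 0 r \<inter> surface F) 0 = \<Phi> ` {z \<in> strip. norm (\<Phi> z) < r}"
    "conformal_chart \<Phi> \<Phi>' {z \<in> strip. norm (\<Phi> z) < r} (\<lambda>z. cosh (v z))"
    using embedded_disk[OF R R_radius _ rR] r6 by auto
  have A0: "A_sq F 0 = C\<^sup>2 / s\<^sup>2"
  proof -
    have "h' 0 = of_real (B * (2 + \<mu>))" by (simp add: h'_def)
    then have "(cmod (h' 0))\<^sup>2 = (B * (2 + \<mu>))\<^sup>2" by (simp only: norm_of_real power2_abs)
    moreover have "C / s = sqrt 2 * (B * (2 + \<mu>))" using assms(1) B1 \<mu> by (simp add: s_def K_def field_simps)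
    then have "C\<^sup>2 / s\<^sup>2 = 2 * (B * (2 + \<mu>))\<^sup>2" by (simp flip: power_divide add: power_mult_distrib)
    ultimately show ?thesis using F(4) by simp
  qed
  have blow: "blow_up_pair C F 0 s"
    unfolding blow_up_pair_def
  proof (intro conjI)
    show "(SUP x\<in>ball 0 s \<inter> surface F. ereal (A_sq F x)) \<le> ereal (4 * C\<^sup>2 / s\<^sup>2)"
      using F(5) by (intro SUP_least) (simp add: A0)
  qed (use F(2) s in \<open>simp_all add: A0\<close>)
  have "\<not> bilipschitz_to_helicoid_piece (1 + \<epsilon>) (\<Phi> ` {z \<in> strip. norm (\<Phi> z) < r})"
  proof (rule not_bilipschitz_to_helicoid_piece[OF F(7) N M N5])
    let ?p1 = "1 / (B * (1 + \<mu> + cos 0))" and ?p2 = "1 / (B * (1 + \<mu> + cos pi))"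
    show "0 < ?p1" "0 < ?p2" using B1 \<mu> by simp_all
    \<comment> \<open>The conditions on B are stated for the larger pitch
      \<open>1 / (B * \<mu>)\<close>; this comparison transfers them to the smaller one.\<close>
    have p12: "?p1 \<le> 1 / (B * \<mu>)" using B1 \<mu> by (simp add: frac_le)
    have p1pos: "0 \<le> ?p1" using B1 \<mu> by simp
    have pos: "0 < B * \<mu>" using B1 \<mu>(1) by simp
    have "M * ?p1 = M / (B * (2 + \<mu>))" by simp
    also have "\<dots> = (M * \<mu>) / (B * \<mu> * (2 + \<mu>))" using \<mu>(1) by simp
    also have "\<dots> < 1 / (B * \<mu>)"
    proof -
      have "B * \<mu> * 1 < B * \<mu> * (2 + \<mu>)" by (rule mult_strict_left_mono[OF _ pos]) (use \<mu>(1) in simp)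
      moreover have "0 < (B * \<mu> * (2 + \<mu>)) * (B * \<mu>)" using pos \<mu>(1) by simp
      ultimately show ?thesis unfolding M\<mu> by (intro divide_strict_left_mono) auto
    qed
    also have "\<dots> = ?p2" by simp
    finally show "M * ?p1 < ?p2" .
    show "z \<in> {z \<in> strip. norm (\<Phi> z) < r} \<and> \<bar>v z - Im z / ?p1\<bar> \<le> 1"
      if z: "dist (of_real 0) z \<le> 144 * N * ?p1" for z
    proof (rule pitch_ball[where A = A])
      have le: "A * ?p1 \<le> A * (1 / (B * \<mu>))" using p12 A by (intro mult_left_mono) auto
      have nonneg: "0 \<le> A * ?p1" using p1pos A by simp
      have "(A * ?p1)\<^sup>2 \<le> (A * (1 / (B * \<mu>)))\<^sup>2" by (rule power_mono[OF le nonneg])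
      then have "2 * B * (A * ?p1)\<^sup>2 \<le> 2 * B * (A * (1 / (B * \<mu>)))\<^sup>2" using B1 by (intro mult_left_mono) auto
      then show "2 * B * (A * ?p1)\<^sup>2 < 1" using large(2) by linarith
      have "cosh (A + 1) * (A * ?p1) \<le> cosh (A + 1) * (A * (1 / (B * \<mu>)))" by (rule mult_left_mono[OF le]) simp
      then show "cosh (A + 1) * (A * ?p1) \<le> 1" using large(3) by linarith
      show "dist (of_real 0) z \<le> A * ?p1" using z by (simp add: A_def)
    qed (use \<mu> r6 in auto)
    show "z \<in> {z \<in> strip. norm (\<Phi> z) < r} \<and> \<bar>v z - Im z / ?p2\<bar> \<le> 1"
      if z: "dist (of_real pi) z \<le> 144 * N * ?p2" for z
    proof (rule pitch_ball[where A = A])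
      show "2 * B * (A * ?p2)\<^sup>2 < 1" using large(2) by simp
      show "cosh (A + 1) * (A * ?p2) \<le> 1" using large(3) by simp
      show "dist (of_real pi) z \<le> A * ?p2" using z by (simp add: A_def)
    qed (use \<mu> r6 pi_less_4 pi_gt_zero in auto)
    show "1 + \<epsilon> \<le> 2" using assms(5) by simp
  qed
  with F R s blow show ?thesis unfolding r_def by (metis (no_types, lifting))
qed

end
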